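(* Let $X\subset\mathbb{R}^m$ be a closed subset of $\mathbb{R}^m$ equipped with a norm $\|\cdot\|$ and let $\theta:\mathbb{R}^m\to\mathbb{R}_+$ be a convex function such that $\theta(x)\ge a\|x\|+b$ for all $x\in\mathbb{R}^m$, for some $a>0$ and $b\in\mathbb{R}$. Then: (1) For all $\mu,\nu\in\mathcal{P}_1(X)$, $$\overline{\mathcal{T}}_\theta(\nu|\mu)=\sup_{\varphi\in\Phi_{1,b}(X)}\left\{\int\overline{Q}_\theta\varphi(x)\,\mu(dx)-\int\varphi(y)\,\nu(dy)\right\},$$ where for $x\in\mathbb{R}^m$ and $\varphi\in\Phi_{1,b}(X)$, $$\overline{Q}_\theta\varphi(x)=\inf_{p\in\mathcal{P}_1(X)}\left\{\int\varphi(y)\,p(dy)+\theta\left(x-\int y\,p(dy)\right)\right\}.$$ The same conclusion holds when $\Phi_{1,b}(X)$ is replaced by $\Phi_{1,b}(\mathbb{R}^m)$ in the dual expression of $\overline{\mathcal{T}}_\theta(\nu|\mu)$ and $\mathcal{P}_1(X)$ by $\mathcal{P}_1(\mathbb{R}^m)$ in the definition of $\overline{Q}_\theta\varphi$. (2) For all $\varphi\in\Phi_{1,b}(\mathbb{R}^m)$ and all $x\in\mathbb{R}^m$, $$\overline{Q}_\theta\varphi(x):=\inf_{p\in\mathcal{P}_1(\mathbb{R}^m)}\left\{\int\varphi(y)\,p(dy)+\theta\left(x-\int y\,p(dy)\right)\right\}=Q_\theta\overline{\varphi}(x),$$ where $\overline{\varphi}$ is the greatest convex function $h:\mathbb{R}^m\to\mathbb{R}$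 such that $h\le\varphi$, and $Q_\theta g(x)=\inf_{y\in\mathbb{R}^m}\{g(y)+\theta(x-y)\}$. (3) For all $\mu,\nu\in\mathcal{P}_1(X)$, $$\overline{\mathcal{T}}_\theta(\nu|\mu)=\sup\left\{\int Q_\theta\varphi\,d\mu-\int\varphi\,d\nu\;:\;\varphi:\mathbb{R}^m\to\mathbb{R}\text{ convex, Lipschitz, bounded from below}\right\}.$$ The results (1), (2), (3) also hold when $\theta:\mathbb{R}^m\to[0,+\infty]$ is a lower-semicontinuous convex function and $X$ is either compact or a countable set of isolated points.
   Context: For a closed set $Y\subset\mathbb{R}^m$, $\mathcal{P}_1(Y)$ is the set of Borel probability measures $\mu$ on $Y$ with $\int\|x\|\,\mu(dx)<\infty$, and $\Phi_{1,b}(Y)$ is the set of continuous functions $\varphi:Y\to\mathbb{R}$ bounded from below with $|\varphi(x)|\le a'+b'\|x-x_o\|$ for all $x\in Y$, for some $a',b'\ge0$ and $x_o\in Y$. $\Pi(\mu,\nu)$ is the set of probability measures on $X\times X$ with first marginal $\mu$ and second marginal $\nu$; each $\pi\in\Pi(\mu,\nu)$ is disintegrated as $\pi(dxdy)=\mu(dx)p_x(dy)$. The barycentric transport cost is $$\overline{\mathcal{T}}_\theta(\nu|\mu)=\inf_{\pi\in\Pi(\mu,\nu)}\int\theta\left(x-\int y\,p_x(dy)\right)\mu(dx).$$ *)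

theory Defs
  imports "HOL-Probability.Probability"
begin

text \<open>The norm on \<open>\<real>\<^sup>m\<close> is an arbitrary one, so it is a parameter rather than the Euclidean norm
  of the type class. All norms induce the same topology, hence \<^term>\<open>borel\<close> is the right
  \<open>\<sigma>\<close>-algebra for each of them.\<close>

definition is_norm :: "('a::real_vector \<Rightarrow> real) \<Rightarrow> bool" where
  "is_norm N \<longleftrightarrow> (\<forall>x. 0 \<le> N x) \<and> (\<forall>x. N x = 0 \<longleftrightarrow> x = 0)
     \<and> (\<forall>c x. N (c *\<^sub>R x) = \<bar>c\<bar> * N x) \<and> (\<forall>x y. N (x + y) \<le> N x + N y)"

definition P1 :: "(real^'m \<Rightarrow> real) \<Rightarrow> (real^'m) set \<Rightarrow> (real^'m) measure set" where
  "P1 N Y = {\<mu>. prob_space \<mu> \<and> sets \<mu> = sets (restrict_space borel Y) \<and> integrable \<mu> N}"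

text \<open>A function on \<open>Y\<close> is represented by a function on the whole type; nothing below depends on its
  values outside \<open>Y\<close>.\<close>

definition Phi1b :: "(real^'m \<Rightarrow> real) \<Rightarrow> (real^'m) set \<Rightarrow> (real^'m \<Rightarrow> real) set" where
  "Phi1b N Y = {\<phi>. continuous_on Y \<phi> \<and> bdd_below (\<phi> ` Y)
     \<and> (\<exists>a'\<ge>0. \<exists>b'\<ge>0. \<exists>x0\<in>Y. \<forall>x\<in>Y. \<bar>\<phi> x\<bar> \<le> a' + b' * N (x - x0))}"

definition couplings :: "'a measure \<Rightarrow> 'a measure \<Rightarrow> ('a \<times> 'a) measure set" where
  "couplings \<mu> \<nu> = {\<pi>. prob_space \<pi> \<and> sets \<pi> = sets (\<mu> \<Otimes>\<^sub>M \<nu>)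
     \<and> distr \<pi> \<mu> fst = \<mu> \<and> distr \<pi> \<nu> snd = \<nu>}"

text \<open>The probability kernels \<open>p\<close> with \<open>\<pi>(dx dy) = \<mu>(dx) p\<^sub>x(dy)\<close>. Such a \<open>p\<close> is determined by
  \<open>\<pi>\<close> up to a \<open>\<mu>\<close>-null set.\<close>

definition disintegrations ::
    "'a measure \<Rightarrow> 'a measure \<Rightarrow> ('a \<times> 'a) measure \<Rightarrow> ('a \<Rightarrow> 'a measure) set" where
  "disintegrations \<mu> \<nu> \<pi> = {p. p \<in> \<mu> \<rightarrow>\<^sub>M prob_algebra \<nu>
     \<and> (\<forall>A\<in>sets (\<mu> \<Otimes>\<^sub>M \<nu>). emeasure \<pi> A = (\<integral>\<^sup>+ x. emeasure (p x) (Pair x -` A) \<partial>\<mu>))}"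

text \<open>The inner infimum ranges over the versions of the disintegration of \<open>\<pi>\<close>, all of which give the
  same value. For \<open>\<nu>\<close> with finite first moment, \<open>p x\<close> has a barycenter for \<open>\<mu>\<close>-almost every \<open>x\<close>; the
  default value of the Bochner integral at other \<open>x\<close> does not matter.\<close>

definition bary_cost ::
    "(real^'m \<Rightarrow> ennreal) \<Rightarrow> (real^'m) measure \<Rightarrow> (real^'m) measure \<Rightarrow> ennreal" where
  "bary_cost \<theta> \<nu> \<mu> =
     (INF \<pi>\<in>couplings \<mu> \<nu>. INF p\<in>disintegrations \<mu> \<nu> \<pi>. \<integral>\<^sup>+ x. \<theta> (x - (\<integral> y. y \<partial>p x)) \<partial>\<mu>)"

definition Qbar ::
    "(real^'m \<Rightarrow> real) \<Rightarrow> (real^'m) set \<Rightarrow> (real^'m \<Rightarrow> ennreal) \<Rightarrow> (real^'m \<Rightarrow> real)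
      \<Rightarrow> real^'m \<Rightarrow> ereal" where
  "Qbar N Y \<theta> \<phi> x =
     (INF p\<in>P1 N Y. ereal (\<integral> y. \<phi> y \<partial>p) + enn2ereal (\<theta> (x - (\<integral> y. y \<partial>p))))"

definition Qinf ::
    "(real^'m \<Rightarrow> ennreal) \<Rightarrow> (real^'m \<Rightarrow> real) \<Rightarrow> real^'m \<Rightarrow> ereal" where
  "Qinf \<theta> g x = (INF y. ereal (g y) + enn2ereal (\<theta> (x - y)))"

text \<open>Integral of an extended-real function as the difference of the integrals of its positive and
  negative parts (\<^const>\<open>e2ennreal\<close> truncates negative values to 0). It is used only for functions
  bounded from below on a probability space, where the subtracted term is finite.\<close>

definition ereal_integral :: "'a measure \<Rightarrow> ('a \<Rightarrow> ereal) \<Rightarrow> ereal" where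
  "ereal_integral M f =
     enn2ereal (\<integral>\<^sup>+ x. e2ennreal (f x) \<partial>M) - enn2ereal (\<integral>\<^sup>+ x. e2ennreal (- f x) \<partial>M)"

definition convex_ennreal :: "('a::real_vector \<Rightarrow> ennreal) \<Rightarrow> bool" where
  "convex_ennreal f \<longleftrightarrow> (\<forall>x y. \<forall>u\<ge>0. \<forall>v\<ge>0. u + v = 1 \<longrightarrow>
     f (u *\<^sub>R x + v *\<^sub>R y) \<le> ennreal u * f x + ennreal v * f y)"

definition lsc :: "('a::topological_space \<Rightarrow> ennreal) \<Rightarrow> bool" where
  "lsc f \<longleftrightarrow> (\<forall>x. f x \<le> Liminf (at x) f)"

definition convex_envelope :: "('a::real_vector \<Rightarrow> real) \<Rightarrow> 'a \<Rightarrow> real" where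
  "convex_envelope \<phi> = (GREATEST h. convex_on UNIV h \<and> h \<le> \<phi>)"

text \<open>The greatest convex minorant exists whenever \<open>\<phi>\<close> is bounded from below.\<close>

lemma convex_envelope_greatest:
  fixes \<phi> :: "'a::real_vector \<Rightarrow> real"
  assumes "bdd_below (range \<phi>)"
  shows "convex_on UNIV (convex_envelope \<phi>)" "convex_envelope \<phi> \<le> \<phi>"
    and "convex_on UNIV g \<Longrightarrow> g \<le> \<phi> \<Longrightarrow> g \<le> convex_envelope \<phi>"
proof -
  define G where "G = {g. convex_on UNIV g \<and> g \<le> \<phi>}"
  define h where "h = (\<lambda>x. SUP g\<in>G. g x)"
  obtain c where c: "\<And>x. c \<le> \<phi> x"
    using assms by (auto simp: bdd_below_def)
  have ne: "G \<noteq> {}"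
    using c by (auto simp: G_def le_fun_def convex_on_def simp flip: distrib_right
        intro!: exI[of _ "\<lambda>_. c"])
  have bdd: "bdd_above ((\<lambda>g. g x) ` G)" for x
    by (auto simp: bdd_above_def G_def le_fun_def)
  have upper: "g x \<le> h x" if "g \<in> G" for g x
    unfolding h_def using that bdd by (rule cSUP_upper)
  have "convex_on UNIV h"
  proof (unfold convex_on_def, intro conjI ballI allI impI)
    fix x y :: 'a and u v :: real
    assume uv: "0 \<le> u" "0 \<le> v" "u + v = 1"
    show "h (u *\<^sub>R x + v *\<^sub>R y) \<le> u * h x + v * h y"
      unfolding h_def[THEN fun_cong, of "u *\<^sub>R x + v *\<^sub>R y"]
    proof (rule cSUP_least[OF ne])
      fix g assume g: "g \<in> G"
      then have "g (u *\<^sub>R x + v *\<^sub>R y) \<le> u * g x + v * g y"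
        using uv by (auto simp: G_def convex_on_def)
      also have "\<dots> \<le> u * h x + v * h y"
        using uv upper[OF g] by (intro add_mono mult_left_mono) auto
      finally show "g (u *\<^sub>R x + v *\<^sub>R y) \<le> u * h x + v * h y" .
    qed
  qed auto
  moreover have "h \<le> \<phi>"
    unfolding h_def le_fun_def by (intro allI cSUP_least[OF ne]) (auto simp: G_def le_fun_def)
  moreover have "g \<le> h" if "convex_on UNIV g \<and> g \<le> \<phi>" for g
    using upper[of g] that by (auto simp: G_def le_fun_def)
  ultimately have "convex_envelope \<phi> = h"
    unfolding convex_envelope_def by (intro Greatest_equality) auto
  then show "convex_on UNIV (convex_envelope \<phi>)" "convex_envelope \<phi> \<le> \<phi>"
    and "convex_on UNIV g \<Longrightarrow> g \<le> \<phi> \<Longrightarrow> g \<le> convex_envelope \<phi>"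
    using \<open>convex_on UNIV h\<close> \<open>h \<le> \<phi>\<close> \<open>\<And>g. convex_on UNIV g \<and> g \<le> \<phi> \<Longrightarrow> g \<le> h\<close> by auto
qed

end

theory Submission
  imports Defs
begin

text \<open>Jensen's inequality along a disintegration gives the easy half of (1), and (2) holds because the
  convex envelope is the infimum of \<open>\<integral>\<phi> dp\<close> over finitely supported \<open>p\<close> with prescribed barycenter. Hence
  the three dual values are ordered, and it remains to find, when the smallest of them (over convex
  Lipschitz potentials) is at most \<open>d\<close>, a coupling of cost at most \<open>d\<close>.

  Such a coupling is produced without compactness. On the functions on \<open>X \<times> X\<close> dominated by a sum of
  integrable functions of the two coordinates, the least price of a superhedge is sublinear, and the
  dual bound says exactly that the price of \<open>0\<close> is not negative. A linear functional below it
  (Hahn-Banach) is positive and has marginals \<open>\<mu>\<close> and \<open>\<nu>\<close>; on products of indicators it is a bimeasure,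
  from which the Radon-Nikodym theorem and a Borel embedding of the space into \<open>\<real>\<close> yield a
  kernel. Since \<open>\<theta>\<close> is a countable supremum of affine functions, the functional controls the cost of
  this kernel.\<close>

subsection \<open>Norms and affine minorants\<close>

text \<open>A functional obtained from Hahn-Banach need not be countably additive; this is the
  obstacle that shapes the proof. It is overcome because the barycentric cost sees a plan only
  through integrals of functions \<open>indicator A x * g y\<close>: positivity and the two
  marginals bound the functional on a product of indicators by \<open>measure \<mu> A\<close> and by
  \<open>measure \<nu> B\<close>, which forces countable additivity in each variable separately, and
  a kernel requires no more. The dual bound \<open>d\<close> enters by admitting, besides functions
  of one coordinate, hedges \<open>U x \<bullet> (x - y) - C x\<close> at the price
  \<open>s * d\<close>. Solving a hedge of 0 for its y-part produces exactly a convex Lipschitz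
  potential, the bound on \<open>U\<close> divided by \<open>s\<close> being its Lipschitz constant.
  This is why the smallest of the dual classes suffices. Neither the functions on the product nor
  \<open>U\<close> and \<open>C\<close> are asked to be measurable, so no measurable selection
  theorem enters.\<close>

lemma is_norm_sum:
  assumes "is_norm N" "finite A"
  shows "N (\<Sum>i\<in>A. f i) \<le> (\<Sum>i\<in>A. N (f i))"
  using assms(2)
proof (induction A rule: finite_induct)
  case empty
  have "N 0 = 0" using assms(1) unfolding is_norm_def by blast
  then show ?case by simp
next
  case (insert i A)
  have "N (f i + sum f A) \<le> N (f i) + N (sum f A)"
    using assms(1) by (simp add: is_norm_def)
  with insert show ?case by simp
qed

lemma is_norm_equivalent:
  fixes N :: "'a::euclidean_space \<Rightarrow> real"
  assumes N: "is_norm N"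
  obtains c C where "0 < c" "0 < C" "\<And>x. c * norm x \<le> N x" "\<And>x. N x \<le> C * norm x"
    "continuous_on UNIV N"
proof -
  have tri: "N (x + y) \<le> N x + N y" and hom: "N (t *\<^sub>R x) = \<bar>t\<bar> * N x"
    and nn: "0 \<le> N x" and zero: "N x = 0 \<longleftrightarrow> x = 0" for x y t
    using N by (auto simp: is_norm_def)
  \<comment> \<open>The 1 makes positivity of \<open>C\<close> immediate from nonnegativity of
    \<open>N\<close>.\<close>
  define C where "C = 1 + (\<Sum>b\<in>Basis. N b)"
  have Cpos: "0 < C" unfolding C_def using nn by (simp add: add_pos_nonneg sum_nonneg)
  have upper: "N x \<le> C * norm x" for x
  proof -
    have "N x = N (\<Sum>b\<in>Basis. (x \<bullet> b) *\<^sub>R b)" by (simp add: euclidean_representation)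
    also have "\<dots> \<le> (\<Sum>b\<in>Basis. N ((x \<bullet> b) *\<^sub>R b))" by (rule is_norm_sum[OF N]) simp
    also have "\<dots> = (\<Sum>b\<in>Basis. \<bar>x \<bullet> b\<bar> * N b)" by (simp add: hom)
    also have "\<dots> \<le> (\<Sum>b\<in>Basis. norm x * N b)"
      by (intro sum_mono mult_right_mono Basis_le_norm nn)
    also have "\<dots> = norm x * (\<Sum>b\<in>Basis. N b)" by (simp add: sum_distrib_left)
    also have "\<dots> \<le> C * norm x" by (simp add: C_def algebra_simps)
    finally show ?thesis .
  qed
  have lip: "\<bar>N x - N y\<bar> \<le> C * norm (x - y)" for x y
  proof -
    have "N x \<le> N (x - y) + N y" "N y \<le> N (y - x) + N x"
      using tri[of "x - y" y] tri[of "y - x" x] by auto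
    moreover have "N (y - x) = N (x - y)" using hom[of "-1" "x - y"] by simp
    ultimately show ?thesis using upper[of "x - y"] by linarith
  qed
  have "C-lipschitz_on UNIV N"
    using lip Cpos by (auto simp: lipschitz_on_def dist_norm)
  then have cont: "continuous_on UNIV N" by (rule lipschitz_on_continuous_on)
  obtain z where z: "z \<in> sphere 0 1" "\<And>y. y \<in> sphere 0 1 \<Longrightarrow> N z \<le> N y"
    using continuous_attains_inf[of "sphere 0 1" N] continuous_on_subset[OF cont]
    by (metis compact_sphere order.refl sphere_eq_empty subset_UNIV not_one_less_zero)
  have "0 < N z" using z(1) nn[of z] zero[of z] by (cases "z = 0") (auto simp: less_le)
  moreover have "N z * norm x \<le> N x" for x
  proof (cases "x = 0")
    case False
    have "N z \<le> N ((1 / norm x) *\<^sub>R x)" using False by (intro z(2)) simp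
    also have "\<dots> = N x / norm x" by (simp only: hom) simp
    finally show ?thesis using False by (simp add: field_simps)
  qed (simp add: nn)
  ultimately show ?thesis using that Cpos upper cont by blast
qed

section \<open>Lower semicontinuous functions and their affine minorants\<close>

lemma lsc_open_greater:
  assumes "lsc f" shows "open {x. r < f x}"
proof (subst open_subopen, intro ballI)
  fix x assume "x \<in> {x. r < f x}"
  then have r: "r < f x" by simp
  also have "f x \<le> Liminf (at x) f" using assms by (simp add: lsc_def)
  finally have "eventually (\<lambda>y. r < f y) (at x)" by (rule less_LiminfD)
  then obtain T where T: "open T" "x \<in> T" "\<forall>y\<in>T. y \<noteq> x \<longrightarrow> r < f y"
    unfolding eventually_at_topological by blast
  \<comment> \<open>\<open>Liminf (at x)\<close> ignores the value at \<open>x\<close>, so the point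
    itself is covered by \<open>r < f x\<close>.\<close>
  then have "T \<subseteq> {x. r < f x}" using r by auto
  with T show "\<exists>T. open T \<and> x \<in> T \<and> T \<subseteq> {x. r < f x}" by blast
qed

lemma lsc_borel_measurable: "lsc f \<Longrightarrow> f \<in> borel_measurable borel"
  by (rule borel_measurableI_greater) (simp add: borel_open lsc_open_greater)

text \<open>A pair (u, c) codes the affine function z -> u . z - c. As \<open>ennreal\<close>
  truncates at 0 and \<open>f\<close> is nonnegative, comparing \<open>f\<close> with the truncation
  is the same as comparing it with the affine function itself.\<close>

definition affine_minorant :: "('a::real_inner \<Rightarrow> ennreal) \<Rightarrow> 'a \<times> real \<Rightarrow> bool" where
  "affine_minorant f l \<longleftrightarrow> (\<forall>z. ennreal (fst l \<bullet> z - snd l) \<le> f z)"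

text \<open>The epigraph of \<open>f\<close> is closed and convex, so a hyperplane strictly
  separates it from the point (z, r). A non-vertical hyperplane is the graph of the minorant. A
  vertical one comes from an affine function that is negative where \<open>f\<close> is finite and
  positive at z; its positive multiples stay below the nonnegative \<open>f\<close>, and a large one
  exceeds \<open>r\<close> at z.\<close>

lemma ex_affine_minorant_above:
  fixes f :: "'a::euclidean_space \<Rightarrow> ennreal"
  assumes lsc: "lsc f" and conv: "convex_ennreal f" and r: "ennreal r < f z" "0 \<le> r"
  shows "\<exists>l. affine_minorant f l \<and> r < fst l \<bullet> z - snd l"
proof -
  \<comment> \<open>Negative t are excluded because \<open>ennreal\<close> maps them to 0: whole
    lines above the zeros of \<open>f\<close> could spoil convexity.\<close>
  define S where "S = {(w, t). 0 \<le> t \<and> f w \<le> ennreal t}"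
  have "convex S"
  proof (rule convexI)
    fix p q and u v :: real
    assume "p \<in> S" "q \<in> S" and uv: "0 \<le> u" "0 \<le> v" "u + v = 1"
    then obtain x s y t where pq: "p = (x, s)" "q = (y, t)"
      and st: "0 \<le> s" "f x \<le> ennreal s" "0 \<le> t" "f y \<le> ennreal t"
      by (auto simp: S_def)
    have nn: "0 \<le> u * s + v * t" using st uv by simp
    have "f (u *\<^sub>R x + v *\<^sub>R y) \<le> ennreal u * f x + ennreal v * f y"
      using conv uv by (simp add: convex_ennreal_def)
    also have "\<dots> \<le> ennreal u * ennreal s + ennreal v * ennreal t"
      using st by (intro add_mono mult_left_mono) auto
    also have "\<dots> = ennreal (u * s + v * t)" using st uv by (simp add: ennreal_mult ennreal_plus)
    finally have "f (u *\<^sub>R x + v *\<^sub>R y) \<le> ennreal (u * s + v * t)" .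
    then show "u *\<^sub>R p + v *\<^sub>R q \<in> S" using nn by (simp add: pq S_def)
  qed
  moreover have "closed S"
  proof -
    have "- S = UNIV \<times> {..<0} \<union> (\<Union>q\<in>{0..}. {w. ennreal q < f w} \<times> {..<q})"
    proof (intro equalityI subsetI)
      fix p assume p: "p \<in> - S"
      obtain w t where [simp]: "p = (w, t)" by (cases p)
      show "p \<in> UNIV \<times> {..<0} \<union> (\<Union>q\<in>{0..}. {w. ennreal q < f w} \<times> {..<q})"
      proof (cases "0 \<le> t")
        case True
        then have "ennreal t < f w" using p by (auto simp: S_def)
        then obtain e where e: "ennreal t < e" "e < f w" using dense by blast
        then obtain q where "e = ennreal q" "0 \<le> q" by (cases e) auto
        with e True show ?thesis by (auto simp: ennreal_less_iff)
      qed auto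
    next
      fix p assume p: "p \<in> UNIV \<times> {..<0} \<union> (\<Union>q\<in>{0..}. {w. ennreal q < f w} \<times> {..<q})"
      show "p \<in> - S"
      proof
        assume "p \<in> S"
        then obtain w t where wt: "p = (w, t)" "0 \<le> t" "f w \<le> ennreal t" by (auto simp: S_def)
        then obtain q where "ennreal q < f w" "t < q" using p by auto
        then show False using wt ennreal_leI[of t q] by (meson leD less_imp_le order_trans)
      qed
    qed
    moreover have "open (UNIV \<times> {..<0} \<union> (\<Union>q\<in>{0..}. {w. ennreal q < f w} \<times> {..<q}))"
      by (intro open_Un open_UN open_Times ballI lsc_open_greater[OF lsc]) auto
    ultimately show ?thesis by (simp add: closed_def)
  qed
  moreover have "(z, r) \<notin> S" using r by (auto simp: S_def)
  ultimately obtain a b where ab: "a \<bullet> (z, r) < b" "\<And>p. p \<in> S \<Longrightarrow> b < a \<bullet> p"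
    using separating_hyperplane_closed_point[of S "(z, r)"] by blast
  obtain v \<beta> where a: "a = (v, \<beta>)" by (cases a)
  have sep: "b < v \<bullet> w + \<beta> * t" if "f w \<le> ennreal t" "0 \<le> t" for w t
    using ab(2)[of "(w, t)"] that by (simp add: S_def a)
  have at_z: "v \<bullet> z + \<beta> * r < b" using ab(1) by (simp add: a)
  show ?thesis
  proof (cases "\<exists>w. f w < top")
    case False
    then have "f w = top" for w by (metis top.not_eq_extremum)
    \<comment> \<open>Here \<open>f\<close> is infinite everywhere, and the pair codes the constant
      function r + 1.\<close>
    then show ?thesis
      by (intro exI[of _ "(0, - r - 1)"]) (simp add: affine_minorant_def)
  next
    case True
    then obtain w0 t0 where w0: "f w0 = ennreal t0" "0 \<le> t0"
      by (metis ennreal_cases less_top)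
    have "\<beta> \<ge> 0"
    proof (rule ccontr)
      assume neg: "\<not> 0 \<le> \<beta>"
      \<comment> \<open>With a negative slope in t, the separation inequality fails high enough
        above \<open>w0\<close>.\<close>
      define t where "t = max t0 ((b - v \<bullet> w0) / \<beta>)"
      have "b < v \<bullet> w0 + \<beta> * t" using w0 by (intro sep) (auto simp: t_def ennreal_leI)
      moreover have "\<beta> * t \<le> \<beta> * ((b - v \<bullet> w0) / \<beta>)"
        using neg by (intro mult_left_mono_neg) (auto simp: t_def)
      ultimately show False using neg by simp
    qed
    then consider "\<beta> > 0" | "\<beta> = 0" by linarith
    then show ?thesis
    proof cases
      case 1
      define l where "l = (- (1 / \<beta>) *\<^sub>R v, - b / \<beta>)"
      have l: "fst l \<bullet> w - snd l = (b - v \<bullet> w) / \<beta>" for w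
        using 1 by (simp add: l_def diff_divide_distrib)
      have "affine_minorant f l"
        unfolding affine_minorant_def
      proof
        fix w
        show "ennreal (fst l \<bullet> w - snd l) \<le> f w"
        proof (cases "f w")
          case (real t)
          then have "b < v \<bullet> w + \<beta> * t" by (intro sep) auto
          then have "(b - v \<bullet> w) / \<beta> \<le> t" using 1 by (simp add: field_simps)
          then show ?thesis using real by (simp add: l ennreal_leI)
        qed simp
      qed
      moreover have "r < fst l \<bullet> z - snd l" using at_z 1 by (simp add: l field_simps)
      ultimately show ?thesis by blast
    next
      case 2
      \<comment> \<open>The factor makes the affine function equal to r + 1 at z.\<close>
      define k where "k = (r + 1) / (b - v \<bullet> z)"
      have pos: "0 < b - v \<bullet> z" using at_z 2 by simp
      then have k: "0 \<le> k" using r by (simp add: k_def)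
      define l where "l = (- k *\<^sub>R v, - k * b)"
      have l: "fst l \<bullet> w - snd l = k * (b - v \<bullet> w)" for w
        by (simp add: l_def algebra_simps)
      have "affine_minorant f l"
        unfolding affine_minorant_def
      proof
        fix w
        show "ennreal (fst l \<bullet> w - snd l) \<le> f w"
        proof (cases "f w")
          case (real t)
          then have "b < v \<bullet> w" using sep[of w t] 2 by auto
          then have "k * (b - v \<bullet> w) \<le> 0" using k by (intro mult_nonneg_nonpos) auto
          then show ?thesis by (simp add: l ennreal_neg)
        qed simp
      qed
      moreover have "r < fst l \<bullet> z - snd l" using pos by (simp add: l k_def)
      ultimately show ?thesis by blast
    qed
  qed
qed

text \<open>The zero function is put in front of the sequence, so that all partial maxima are
  nonnegative.\<close>

lemma lsc_convex_eq_SUP_affine: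
  fixes f :: "'a::euclidean_space \<Rightarrow> ennreal"
  assumes lsc: "lsc f" and conv: "convex_ennreal f"
  obtains l :: "nat \<Rightarrow> 'a \<times> real" where "l 0 = 0" "\<And>n. affine_minorant f (l n)"
    "\<And>z. f z = (SUP n. ennreal (fst (l n) \<bullet> z - snd (l n)))"
proof -
  define A where "A = {l. affine_minorant f l}"
  \<comment> \<open>Affine minorants are coded by points of a finite-dimensional space, so countably
    many are dense among them. A strict inequality at z is an open condition on the code, hence the
    dense ones suffice.\<close>
  obtain T where T: "countable T" "T \<subseteq> A" "A \<subseteq> closure T" by (rule separable)
  have "affine_minorant f 0" by (simp add: affine_minorant_def)
  then have T0: "countable (insert 0 T)" "insert 0 T \<subseteq> A" using T by (auto simp: A_def)
  define l where "l n = (case n of 0 \<Rightarrow> 0 | Suc m \<Rightarrow> from_nat_into (insert 0 T) m)" for n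
  have rng: "insert 0 T = range l"
  proof (intro equalityI subsetI)
    fix x assume "x \<in> insert 0 T"
    then obtain m where "from_nat_into (insert 0 T) m = x"
      using from_nat_into_surj[OF T0(1)] by blast
    then have "l (Suc m) = x" by (simp add: l_def)
    then show "x \<in> range l" by blast
  next
    fix x assume "x \<in> range l"
    then obtain n where "x = l n" by blast
    then show "x \<in> insert 0 T"
      by (cases n) (use from_nat_into[of "insert 0 T"] in \<open>auto simp: l_def\<close>)
  qed
  have min: "affine_minorant f (l n)" for n using rng T0(2) by (auto simp: A_def)
  have "f z \<le> (SUP n. ennreal (fst (l n) \<bullet> z - snd (l n)))" for z
  proof (rule ccontr)
    assume "\<not> ?thesis"
    then obtain e where e: "(SUP n. ennreal (fst (l n) \<bullet> z - snd (l n))) < e" "e < f z"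
      using dense by (auto simp: not_le)
    then obtain r where r: "e = ennreal r" "0 \<le> r" by (cases e) auto
    obtain p where p: "p \<in> A" "r < fst p \<bullet> z - snd p"
      using ex_affine_minorant_above[OF lsc conv, of r z] e(2) r unfolding A_def by blast
    have "open {q. r < fst q \<bullet> z - snd q}"
      by (intro open_Collect_less continuous_intros)
    moreover have "p \<in> closure T" using p T by blast
    ultimately have "\<exists>q\<in>T. r < fst q \<bullet> z - snd q"
      using p(2) unfolding closure_iff_nhds_not_empty by blast
    then obtain n where "r < fst (l n) \<bullet> z - snd (l n)" using rng by (metis insertI2 rangeE)
    then have "e \<le> ennreal (fst (l n) \<bullet> z - snd (l n))" using r by (simp add: ennreal_leI)
    also have "\<dots> \<le> (SUP n. ennreal (fst (l n) \<bullet> z - snd (l n)))" by (rule SUP_upper) simp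
    finally show False using e(1) by simp
  qed
  moreover have "(SUP n. ennreal (fst (l n) \<bullet> z - snd (l n))) \<le> f z" for z
    using min by (intro SUP_least) (simp add: affine_minorant_def)
  ultimately show ?thesis
    using min by (intro that[of l]) (auto intro: antisym simp: l_def)
qed

subsection \<open>A Hahn-Banach theorem for sublinear functionals\<close>

definition sublinear_on :: "('a \<Rightarrow> real) set \<Rightarrow> (('a \<Rightarrow> real) \<Rightarrow> real) \<Rightarrow> bool" where
  "sublinear_on V P \<longleftrightarrow> (\<forall>f\<in>V. \<forall>g\<in>V. P (\<lambda>x. f x + g x) \<le> P f + P g)
     \<and> (\<forall>c\<ge>0. \<forall>f\<in>V. P (\<lambda>x. c * f x) = c * P f)"

definition linear_on :: "('a \<Rightarrow> real) set \<Rightarrow> (('a \<Rightarrow> real) \<Rightarrow> real) \<Rightarrow> bool" where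
  "linear_on V L \<longleftrightarrow> (\<forall>f\<in>V. \<forall>g\<in>V. L (\<lambda>x. f x + g x) = L f + L g)
     \<and> (\<forall>c. \<forall>f\<in>V. L (\<lambda>x. c * f x) = c * L f)"

text \<open>A minimal sublinear functional \<open>q\<close> is linear: otherwise \<open>f \<mapsto> inf\<^sub>t q (f + t h) - t q h\<close>
  would be strictly smaller for some direction \<open>h\<close>.\<close>

theorem Hahn_Banach_sublinear:
  fixes V :: "('a \<Rightarrow> real) set"
  assumes ne: "V \<noteq> {}" and add: "\<And>f g. f \<in> V \<Longrightarrow> g \<in> V \<Longrightarrow> (\<lambda>x. f x + g x) \<in> V"
    and scale: "\<And>c f. f \<in> V \<Longrightarrow> (\<lambda>x. c * f x) \<in> V"
    and P: "sublinear_on V P"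
  obtains L where "linear_on V L" "\<And>f. f \<in> V \<Longrightarrow> L f \<le> P f"
proof -
  \<comment> \<open>Fixing the value 0 off \<open>V\<close> makes the pointwise order see only
    \<open>V\<close>, so that minimality yields equality of functions.\<close>
  define S where "S = {q. sublinear_on V q \<and> (\<forall>f\<in>V. q f \<le> P f) \<and> (\<forall>f. f \<notin> V \<longrightarrow> q f = 0)}"
  have q_add: "q (\<lambda>x. f x + g x) \<le> q f + q g" and q_scale: "0 \<le> c \<Longrightarrow> q (\<lambda>x. c * f x) = c * q f"
    and q_le: "q f \<le> P f" if "q \<in> S" "f \<in> V" "g \<in> V" for q f g c
    using that by (auto simp: S_def sublinear_on_def)
  have neg: "(\<lambda>x. - f x) \<in> V" if "f \<in> V" for f using scale[OF that, of "-1"] by simp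
  have zero: "(\<lambda>x. 0) \<in> V" using ne scale[of _ 0] by auto
  have q0: "q (\<lambda>x. 0) = 0" if "q \<in> S" for q using q_scale[OF that zero zero, of 0] by simp
  have q_neg: "- q f \<le> q (\<lambda>x. - f x)" if "q \<in> S" "f \<in> V" for q f
    using q_add[OF that neg[OF that(2)]] q0[OF that(1)] by simp
  have q_bd: "- P (\<lambda>x. - f x) \<le> q f" if "q \<in> S" "f \<in> V" for q f
    using q_neg[OF that(1) neg[OF that(2)]] q_neg[OF that] q_le[OF that(1) neg neg, of f f] that by simp
  define P0 where "P0 f = (if f \<in> V then P f else 0)" for f
  have "P0 \<in> S" using P add scale by (auto simp: S_def P0_def sublinear_on_def)
  have "\<exists>m\<in>S. \<forall>q\<in>S. q \<le> m \<longrightarrow> q = m"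
  proof -
    have po: "partial_order_on S (relation_of (\<ge>) S)"
      by (rule partial_order_on_relation_ofI) auto
    have "\<exists>m\<in>S. \<forall>q\<in>S. m \<ge> q \<longrightarrow> q = m"
    proof (rule predicate_Zorn[OF po])
      fix C assume C: "C \<in> Chains (relation_of (\<ge>) S)"
      have CS: "C \<subseteq> S" and ch: "\<And>p q. p \<in> C \<Longrightarrow> q \<in> C \<Longrightarrow> p \<le> q \<or> q \<le> p"
        using C by (auto simp: Chains_def relation_of_def)
      show "\<exists>u\<in>S. \<forall>q\<in>C. u \<le> q"
      proof (cases "C = {}")
        case True
        then show ?thesis using \<open>P0 \<in> S\<close> by blast
      next
        case False
        define u where "u f = (if f \<in> V then INF q\<in>C. q f else 0)" for f
        \<comment> \<open>Sublinearity bounds all members of \<open>S\<close> from below by the same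
          number \<open>- P (\<lambda>x. - f x)\<close>, so the pointwise infimum over a chain is
          finite.\<close>
        have bdd: "bdd_below ((\<lambda>q. q f) ` C)" if "f \<in> V" for f
          using q_bd that CS by (auto intro!: bdd_belowI2[where m="- P (\<lambda>x. - f x)"])
        have u_le: "u f \<le> q f" if "q \<in> C" for q f
          using bdd that CS by (cases "f \<in> V") (auto simp: u_def S_def intro!: cINF_lower)
        have u_ge: "m \<le> u f" if "f \<in> V" "\<And>q. q \<in> C \<Longrightarrow> m \<le> q f" for f m
          using that False by (auto simp: u_def intro!: cINF_greatest)
        have "u (\<lambda>x. f x + g x) \<le> u f + u g" if fg: "f \<in> V" "g \<in> V" for f g
        proof -
          have "u (\<lambda>x. f x + g x) \<le> p f + q g" if pq: "p \<in> C" "q \<in> C" for p q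
          proof -
            \<comment> \<open>In a chain the smaller of \<open>p\<close> and \<open>q\<close> serves
              for both, which makes the infimum subadditive.\<close>
            obtain r where r: "r \<in> C" "r \<le> p" "r \<le> q"
              using ch[OF pq] pq by (metis order.refl)
            have "u (\<lambda>x. f x + g x) \<le> r (\<lambda>x. f x + g x)" by (rule u_le[OF r(1)])
            also have "\<dots> \<le> r f + r g" using r CS fg by (intro q_add) auto
            also have "\<dots> \<le> p f + q g" using r by (intro add_mono) (auto simp: le_fun_def)
            finally show ?thesis .
          qed
          then have "u (\<lambda>x. f x + g x) - q g \<le> u f" if "q \<in> C" for q
            using that fg by (intro u_ge) (auto simp: algebra_simps)
          then have "u (\<lambda>x. f x + g x) - u f \<le> u g"
            using fg by (intro u_ge) (auto simp: algebra_simps)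
          then show ?thesis by simp
        qed
        moreover have "u (\<lambda>x. c * f x) = c * u f" if "0 \<le> c" "f \<in> V" for c f
        proof (cases "c = 0")
          case True
          have "(\<lambda>q. q (\<lambda>x. 0)) ` C = (\<lambda>q. 0) ` C" using q0 CS by (intro image_cong) auto
          then have "(\<lambda>q. q (\<lambda>x. 0)) ` C = {0}" using False by auto
          then show ?thesis using True zero by (simp add: u_def)
        next
          case c: False
          have le: "d * u g \<le> u (\<lambda>x. d * g x)" if "g \<in> V" "0 < d" for g d
          proof (rule u_ge[OF scale[OF that(1)]])
            fix q assume "q \<in> C"
            then show "d * u g \<le> q (\<lambda>x. d * g x)"
              using q_scale[of q g g d] that CS u_le[of q g] by auto
          qed
          have "u (\<lambda>x. c * f x) \<le> c * u f"
            using le[OF scale[OF that(2), of c], of "1/c"] that c by (simp add: field_simps)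
          then show ?thesis using le[OF that(2), of c] that c by simp
        qed
        moreover have "u f \<le> P f" if "f \<in> V" for f
        proof -
          obtain q where "q \<in> C" using False by blast
          then show ?thesis using u_le[of q f] q_le[of q f f] CS that by fastforce
        qed
        ultimately have "u \<in> S" by (auto simp: S_def sublinear_on_def u_def[of "_ :: 'a \<Rightarrow> real"])
        then show ?thesis using u_le by (auto simp: le_fun_def)
      qed
    qed
    then show ?thesis by blast
  qed
  then obtain q where q: "q \<in> S" and minimal: "\<And>p. p \<in> S \<Longrightarrow> p \<le> q \<Longrightarrow> p = q" by blast
  have odd: "q (\<lambda>x. - h x) = - q h" if h: "h \<in> V" for h
  proof -
    define T where "T f = (\<lambda>t. q (\<lambda>x. f x + t * h x) - t * q h) ` {0..}" for f
    define p where "p f = (if f \<in> V then Inf (T f) else 0)" for f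
    have bdd: "bdd_below (T f)" if f: "f \<in> V" for f
      unfolding T_def
    proof (rule bdd_belowI2[where m="- q (\<lambda>x. - f x)"])
      fix t :: real assume t: "t \<in> {0..}"
      have "q (\<lambda>x. t * h x) \<le> q (\<lambda>x. f x + t * h x) + q (\<lambda>x. - f x)"
        using q_add[OF q add[OF f scale[OF h, of t]] neg[OF f]] by simp
      moreover have "q (\<lambda>x. t * h x) = t * q h" using t q_scale[OF q h h] by simp
      ultimately show "- q (\<lambda>x. - f x) \<le> q (\<lambda>x. f x + t * h x) - t * q h" by simp
    qed
    have p_le: "p f \<le> q (\<lambda>x. f x + t * h x) - t * q h" if "f \<in> V" "0 \<le> t" for f t
      using bdd[OF that(1)] that by (auto simp: p_def T_def intro!: cINF_lower)
    have p_ge: "m \<le> p f" if "f \<in> V" "\<And>t. 0 \<le> t \<Longrightarrow> m \<le> q (\<lambda>x. f x + t * h x) - t * q h" for f m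
      using that by (auto simp: p_def T_def intro!: cINF_greatest)
    have pq: "p f \<le> q f" if "f \<in> V" for f using p_le[OF that, of 0] by simp
    have "p (\<lambda>x. f x + g x) \<le> p f + p g" if fg: "f \<in> V" "g \<in> V" for f g
    proof -
      have *: "p (\<lambda>x. f x + g x) \<le> (q (\<lambda>x. f x + s * h x) - s * q h) + (q (\<lambda>x. g x + t * h x) - t * q h)"
        if "0 \<le> s" "0 \<le> t" for s t
      proof -
        have "p (\<lambda>x. f x + g x) \<le> q (\<lambda>x. (f x + g x) + (s + t) * h x) - (s + t) * q h"
          using that fg by (intro p_le add) auto
        also have "(\<lambda>x. (f x + g x) + (s + t) * h x) = (\<lambda>x. (f x + s * h x) + (g x + t * h x))"
          by (auto simp: algebra_simps)
        also have "q \<dots> \<le> q (\<lambda>x. f x + s * h x) + q (\<lambda>x. g x + t * h x)"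
          using fg h by (intro q_add[OF q] add scale)
        finally show ?thesis by (simp add: algebra_simps)
      qed
      have "p (\<lambda>x. f x + g x) - (q (\<lambda>x. g x + t * h x) - t * q h) \<le> p f" if "0 \<le> t" for t
        using *[OF _ that] fg by (intro p_ge) (auto simp: algebra_simps)
      then have "p (\<lambda>x. f x + g x) - p f \<le> p g"
        using fg by (intro p_ge) (auto simp: algebra_simps)
      then show ?thesis by simp
    qed
    moreover have "p (\<lambda>x. c * f x) = c * p f" if c: "0 \<le> c" and f: "f \<in> V" for c f
    proof (cases "c = 0")
      case True
      have "q (\<lambda>x. t * h x) - t * q h = 0" if "0 \<le> t" for t
        using q_scale[OF q h h that] by simp
      then have "T (\<lambda>x. 0) = {0}" by (auto simp: T_def image_iff intro: exI[of _ 0])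
      then show ?thesis using True zero by (simp add: p_def)
    next
      case False
      have le: "d * p g \<le> p (\<lambda>x. d * g x)" if g: "g \<in> V" and d: "0 < d" for g d
      proof (rule p_ge[OF scale[OF g]])
        fix t :: real assume t: "0 \<le> t"
        have "d * p g \<le> d * (q (\<lambda>x. g x + (t / d) * h x) - (t / d) * q h)"
          using d t g by (intro mult_left_mono p_le) auto
        also have "\<dots> = q (\<lambda>x. d * (g x + (t / d) * h x)) - t * q h"
          using d q_scale[OF q add[OF g scale[OF h, of "t / d"]] h, of d] by (simp add: right_diff_distrib)
        also have "(\<lambda>x. d * (g x + (t / d) * h x)) = (\<lambda>x. d * g x + t * h x)"
          using d by (auto simp: field_simps)
        finally show "d * p g \<le> q (\<lambda>x. d * g x + t * h x) - t * q h" .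
      qed
      have "p (\<lambda>x. c * f x) \<le> c * p f"
        using le[OF scale[OF f, of c], of "1/c"] c False by (simp add: field_simps)
      then show ?thesis using le[OF f, of c] c False by simp
    qed
    moreover have "p f \<le> P f" if "f \<in> V" for f
      using pq[OF that] q_le[OF q that that] by simp
    ultimately have "p \<in> S" by (simp add: S_def sublinear_on_def p_def[of "_ :: 'a \<Rightarrow> real"])
    moreover have "p \<le> q" using pq q by (auto simp: le_fun_def S_def p_def)
    ultimately have "p = q" by (rule minimal)
    \<comment> \<open>At \<open>- h\<close> with t = 1 the shifted functional is evaluated at 0,
      which bounds \<open>q\<close> at \<open>- h\<close> by \<open>- q h\<close>; subadditivity
      gives the reverse.\<close>
    then have "q (\<lambda>x. - h x) \<le> q (\<lambda>x. - h x + 1 * h x) - 1 * q h"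
      using p_le[OF neg[OF h], of 1] by simp
    then have "q (\<lambda>x. - h x) \<le> - q h" using q0[OF q] by simp
    then show ?thesis using q_neg[OF q h] by simp
  qed
  have "linear_on V q"
    unfolding linear_on_def
  proof (intro conjI ballI allI)
    fix f g assume fg: "f \<in> V" "g \<in> V"
    have "q (\<lambda>x. - (f x + g x)) \<le> q (\<lambda>x. - f x) + q (\<lambda>x. - g x)"
      using q_add[OF q neg[OF fg(1)] neg[OF fg(2)]] by simp
    then show "q (\<lambda>x. f x + g x) = q f + q g"
      using odd[OF add[OF fg]] odd[OF fg(1)] odd[OF fg(2)] q_add[OF q fg] by simp
  next
    fix c and f assume f: "f \<in> V"
    show "q (\<lambda>x. c * f x) = c * q f"
    proof (cases "0 \<le> c")
      case False
      then have "q (\<lambda>x. (- c) * f x) = (- c) * q f" using q_scale[OF q f f, of "- c"] by simp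
      then show ?thesis using odd[OF scale[OF f, of c]] by simp
    qed (use q_scale[OF q f f] in simp)
  qed
  then show ?thesis using that q_le[OF q] by blast
qed

subsection \<open>A Borel embedding into the real line\<close>

text \<open>The greedy expansion in powers of 1/3 with digits 0 and 1: this is what remains of t
  once the digits before position n are taken off. It is a Borel function of t, which makes the
  decoding of digits measurable.\<close>

primrec ternary_rest :: "nat \<Rightarrow> real \<Rightarrow> real" where
  "ternary_rest 0 t = t"
| "ternary_rest (Suc n) t =
     ternary_rest n t - (if (1/3) ^ n \<le> ternary_rest n t then (1/3) ^ n else 0)"

lemma ternary_rest_measurable [measurable]: "ternary_rest n \<in> borel_measurable borel"
proof (induction n)
  case 0
  then show ?case by (simp cong: measurable_cong)
next
  case (Suc n)
  note [measurable] = Suc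
  show ?case unfolding ternary_rest.simps by measurable
qed

text \<open>Base 3 with digits 0 and 1 only: in base 2 two sequences may have the same sum, while
  here the tails are too small for that.\<close>

definition ternary_code :: "(nat \<Rightarrow> bool) \<Rightarrow> real" where
  "ternary_code b = (\<Sum>n. of_bool (b n) * (1/3) ^ n)"

lemma ternary_summable: "summable (\<lambda>k. of_bool (b k) * (1/3 :: real) ^ (k + n))"
proof (rule summable_comparison_test[of _ "\<lambda>k. (1/3 :: real) ^ n * (1/3) ^ k"])
  show "summable (\<lambda>k. (1/3 :: real) ^ n * (1/3) ^ k)" by (intro summable_mult summable_geometric) simp
qed (auto simp: power_add)

lemma ternary_tail_le: "(\<Sum>k. of_bool (b k) * (1/3 :: real) ^ (k + n)) \<le> 3/2 * (1/3) ^ n"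
proof -
  have "(\<Sum>k. of_bool (b k) * (1/3 :: real) ^ (k + n)) \<le> (\<Sum>k. (1/3) ^ n * (1/3) ^ k)"
    by (intro suminf_le ternary_summable summable_mult summable_geometric) (auto simp: power_add)
  also have "\<dots> = (1/3) ^ n * (\<Sum>k. (1/3) ^ k)" by (intro suminf_mult summable_geometric) simp
  also have "\<dots> = 3/2 * (1/3) ^ n" by (simp add: suminf_geometric)
  finally show ?thesis .
qed

text \<open>All digits after position n together contribute at most
  \<open>3/2 * (1/3) ^ (n + 1)\<close>, half of the weight at position n, so they cannot imitate
  that digit.\<close>

lemma ternary_tail_digit:
  "(1/3) ^ n \<le> (\<Sum>k. of_bool (b (k + n)) * (1/3 :: real) ^ (k + n)) \<longleftrightarrow> b n"
proof -
  define S where "S = (\<Sum>k. of_bool (b (Suc k + n)) * (1/3 :: real) ^ (Suc k + n))"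
  define p where "p = (1/3 :: real) ^ n"
  have "(\<Sum>k. of_bool (b (k + n)) * (1/3 :: real) ^ (k + n)) = S + of_bool (b n) * p"
    using suminf_split_head[OF ternary_summable[of "\<lambda>k. b (k + n)" n]] by (simp add: S_def p_def)
  moreover have "S \<le> p / 2"
    using ternary_tail_le[of "\<lambda>k. b (Suc k + n)" "Suc n"] by (simp add: S_def p_def)
  moreover have "0 \<le> S"
    unfolding S_def using ternary_summable[of "\<lambda>k. b (Suc k + n)" "Suc n"]
    by (intro suminf_nonneg) auto
  moreover have "0 < p" by (simp add: p_def)
  ultimately have "p \<le> (\<Sum>k. of_bool (b (k + n)) * (1/3 :: real) ^ (k + n)) \<longleftrightarrow> b n"
    by (cases "b n") auto
  then show ?thesis by (simp add: p_def)
qed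

lemma ternary_rest_code:
  "ternary_rest n (ternary_code b) = (\<Sum>k. of_bool (b (k + n)) * (1/3) ^ (k + n))"
proof (induction n)
  case (Suc n)
  have "(\<Sum>k. of_bool (b (k + n)) * (1/3 :: real) ^ (k + n))
      = (\<Sum>k. of_bool (b (k + Suc n)) * (1/3) ^ (k + Suc n)) + of_bool (b n) * (1/3) ^ n"
    using suminf_split_head[OF ternary_summable[of "\<lambda>k. b (k + n)" n]] by simp
  then show ?case using Suc ternary_tail_digit[of n b] by simp
qed (simp add: ternary_code_def)

lemma ternary_digit_code: "(1/3) ^ n \<le> ternary_rest n (ternary_code b) \<longleftrightarrow> b n"
  by (simp only: ternary_rest_code ternary_tail_digit)

text \<open>A point is coded by the truth values of \<open>q < x \<bullet> i\<close>, which are the ternary digits of its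
  image.\<close>

lemma borel_embedding_real:
  obtains \<iota> :: "'a::euclidean_space \<Rightarrow> real" and r :: "real \<Rightarrow> 'a"
  where "\<iota> \<in> borel_measurable borel" "r \<in> borel_measurable borel"
    "\<And>x. r (\<iota> x) = x" "\<And>x. 0 \<le> \<iota> x" "\<And>x. \<iota> x \<le> 2"
proof -
  define d where "d = from_nat_into ((Basis :: 'a set) \<times> (\<rat> :: real set))"
  have cnt: "countable ((Basis :: 'a set) \<times> (\<rat> :: real set))"
    by (intro countable_SIGMA countable_finite countable_rat) auto
  have "(0 :: real) \<in> \<rat>" by simp
  then have "(Basis :: 'a set) \<times> (\<rat> :: real set) \<noteq> {}" by auto
  then have rng: "range d = Basis \<times> \<rat>"
    unfolding d_def using cnt by (rule range_from_nat_into)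
  define \<iota> where "\<iota> x = ternary_code (\<lambda>n. snd (d n) < x \<bullet> fst (d n))" for x :: 'a
  define e where "e t n = (if (1/3) ^ n \<le> ternary_rest n t then ereal (snd (d n)) else - \<infinity>)" for t n
  \<comment> \<open>Each coordinate is the supremum of the rationals below it. Off the range of
    \<open>\<iota>\<close> the supremum may be infinite, and \<open>real_of_ereal\<close> then
    returns 0; only measurability matters there.\<close>
  define r where "r t = (\<Sum>i\<in>Basis. real_of_ereal (SUP n\<in>{n. fst (d n) = i}. e t n) *\<^sub>R i)" for t
  have "\<iota> \<in> borel_measurable borel" unfolding \<iota>_def ternary_code_def by measurable
  moreover have "r \<in> borel_measurable borel" unfolding r_def e_def by measurable
  moreover have "r (\<iota> x) = x" for x
  proof -
    have e: "e (\<iota> x) n = (if snd (d n) < x \<bullet> fst (d n) then ereal (snd (d n)) else - \<infinity>)" for n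
      by (simp only: e_def \<iota>_def ternary_digit_code)
    have "(SUP n\<in>{n. fst (d n) = i}. e (\<iota> x) n) = ereal (x \<bullet> i)" if i: "i \<in> Basis" for i
    proof (rule antisym)
      show "(SUP n\<in>{n. fst (d n) = i}. e (\<iota> x) n) \<le> ereal (x \<bullet> i)"
        by (rule SUP_least) (auto simp: e)
      show "ereal (x \<bullet> i) \<le> (SUP n\<in>{n. fst (d n) = i}. e (\<iota> x) n)"
      proof (rule ccontr)
        assume "\<not> ?thesis"
        then have "(SUP n\<in>{n. fst (d n) = i}. e (\<iota> x) n) < ereal (x \<bullet> i)" by simp
        then obtain s where s: "(SUP n\<in>{n. fst (d n) = i}. e (\<iota> x) n) < ereal s" "s < x \<bullet> i"
          using ereal_dense2 by (metis less_ereal.simps(1))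
        obtain q where q: "q \<in> \<rat>" "s < q" "q < x \<bullet> i" using Rats_dense_in_real[OF s(2)] by blast
        then obtain n where n: "d n = (i, q)" using rng i by (metis SigmaI rangeE)
        have "ereal q = e (\<iota> x) n" using q by (simp add: e n)
        also have "\<dots> \<le> (SUP n\<in>{n. fst (d n) = i}. e (\<iota> x) n)" by (rule SUP_upper) (simp add: n)
        also note s(1)
        finally have "ereal q < ereal s" .
        then show False using q by simp
      qed
    qed
    then show ?thesis by (simp add: r_def euclidean_representation cong: sum.cong)
  qed
  moreover have "0 \<le> \<iota> x" for x
    unfolding \<iota>_def ternary_code_def using ternary_summable[of _ 0] by (intro suminf_nonneg) auto
  \<comment> \<open>The geometric series gives 3/2, rounded up to 2.\<close>
  moreover have "\<iota> x \<le> 2" for x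
    using ternary_tail_le[of "\<lambda>n. snd (d n) < x \<bullet> fst (d n)" 0] by (simp add: \<iota>_def ternary_code_def)
  ultimately show ?thesis using that by blast
qed

subsection \<open>Kernels from bimeasures\<close>

text \<open>Domination by \<open>M\<close> transfers continuity at the empty set, which turns finite
  additivity into countable additivity.\<close>

lemma (in finite_measure) dominated_additive_measure:
  fixes f :: "'a set \<Rightarrow> real"
  assumes nonneg: "\<And>A. A \<in> sets M \<Longrightarrow> 0 \<le> f A"
    and add: "\<And>A B. A \<in> sets M \<Longrightarrow> B \<in> sets M \<Longrightarrow> A \<inter> B = {} \<Longrightarrow> f (A \<union> B) = f A + f B"
    and le: "\<And>A. A \<in> sets M \<Longrightarrow> f A \<le> measure M A"
  obtains M' where "sets M' = sets M" "\<And>A. A \<in> sets M \<Longrightarrow> emeasure M' A = ennreal (f A)"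
proof -
  define M' where "M' = measure_of (space M) (sets M) (\<lambda>A. ennreal (f A))"
  have sets: "sets M' = sets M" by (simp add: M'_def)
  have "f {} = 0" using add[of "{}" "{}"] by simp
  then have pos: "positive (sets M) (\<lambda>A. ennreal (f A))" by (simp add: positive_def)
  have "countably_additive (sets M) (\<lambda>A. ennreal (f A))"
  proof (rule sets.empty_continuous_imp_countably_additive[OF pos])
    show "additive (sets M) (\<lambda>A. ennreal (f A))"
      by (auto simp: additive_def add nonneg ennreal_plus)
    fix A assume A: "range A \<subseteq> sets M" "decseq A" "(\<Inter>i. A i) = ({} :: 'a set)"
    have "(\<lambda>i. measure M (A i)) \<longlonglongrightarrow> 0"
      using finite_Lim_measure_decseq[OF A(1,2)] A(3) by simp
    then have "(\<lambda>i. f (A i)) \<longlonglongrightarrow> 0"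
      using A by (intro tendsto_sandwich[of "\<lambda>_. 0" "\<lambda>i. f (A i)" _ "\<lambda>i. measure M (A i)"])
        (auto intro!: always_eventually nonneg le)
    then show "(\<lambda>i. ennreal (f (A i))) \<longlonglongrightarrow> 0" using tendsto_ennrealI[of _ 0] by simp
  qed simp
  then have "emeasure M' A = ennreal (f A)" if "A \<in> sets M" for A
    using that pos by (intro emeasure_measure_of[OF M'_def]) (auto simp: sets sets.space_closed)
  then show ?thesis using that sets by blast
qed

text \<open>Only finite additivity is asked, in each argument separately, and nothing is said about
  unions of rectangles. The two marginal conditions supply the domination that makes each section a
  measure.\<close>

definition bimeasure :: "'a measure \<Rightarrow> 'b measure \<Rightarrow> ('a set \<Rightarrow> 'b set \<Rightarrow> real) \<Rightarrow> bool" where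
  "bimeasure M L \<beta> \<longleftrightarrow> (\<forall>A\<in>sets M. \<forall>B\<in>sets L. 0 \<le> \<beta> A B)
     \<and> (\<forall>A\<in>sets M. \<forall>A'\<in>sets M. \<forall>B\<in>sets L. A \<inter> A' = {} \<longrightarrow> \<beta> (A \<union> A') B = \<beta> A B + \<beta> A' B)
     \<and> (\<forall>A\<in>sets M. \<forall>B\<in>sets L. \<forall>B'\<in>sets L. B \<inter> B' = {} \<longrightarrow> \<beta> A (B \<union> B') = \<beta> A B + \<beta> A B')
     \<and> (\<forall>A\<in>sets M. \<beta> A (space L) = measure M A) \<and> (\<forall>B\<in>sets L. \<beta> (space M) B = measure L B)"

lemma bimeasureD:
  assumes "bimeasure M L \<beta>" "A \<in> sets M" "B \<in> sets L"
  shows bimeasure_nonneg: "0 \<le> \<beta> A B"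
    and bimeasure_add_left: "A' \<in> sets M \<Longrightarrow> A \<inter> A' = {} \<Longrightarrow> \<beta> (A \<union> A') B = \<beta> A B + \<beta> A' B"
    and bimeasure_add_right: "B' \<in> sets L \<Longrightarrow> B \<inter> B' = {} \<Longrightarrow> \<beta> A (B \<union> B') = \<beta> A B + \<beta> A B'"
    and bimeasure_left: "\<beta> A (space L) = measure M A"
    and bimeasure_right: "\<beta> (space M) B = measure L B"
  using assms by (auto simp: bimeasure_def)

text \<open>The increment \<open>\<beta> A (B' - B)\<close> is at most
  \<open>\<beta> (space M) (B' - B)\<close>, which the second marginal computes. This control,
  uniform in \<open>A\<close>, later gives continuity from the right in a threshold.\<close>

lemma bimeasure_mono_right:
  assumes \<beta>: "bimeasure M L \<beta>" and A: "A \<in> sets M" and B: "B \<in> sets L" "B' \<in> sets L" "B \<subseteq> B'"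
  shows "\<beta> A B \<le> \<beta> A B'" "\<beta> A B' - \<beta> A B \<le> measure L B' - measure L B"
proof -
  have D: "B' - B \<in> sets L" "B \<union> (B' - B) = B'" using B by auto
  have eq: "\<beta> A B' = \<beta> A B + \<beta> A (B' - B)" if "A \<in> sets M" for A
    using bimeasure_add_right[OF \<beta> that B(1) D(1)] D by simp
  show "\<beta> A B \<le> \<beta> A B'" using eq[OF A] bimeasure_nonneg[OF \<beta> A D(1)] by simp
  have A': "space M - A \<in> sets M" "A \<union> (space M - A) = space M"
    using A sets.sets_into_space by auto
  have "\<beta> A (B' - B) \<le> \<beta> (space M) (B' - B)"
    using bimeasure_add_left[OF \<beta> A D(1) A'(1)] A'(2) bimeasure_nonneg[OF \<beta> A'(1) D(1)] by simp
  then show "\<beta> A B' - \<beta> A B \<le> measure L B' - measure L B"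
    using eq[OF A] eq[OF sets.top] bimeasure_right[OF \<beta> A] B by simp
qed

lemma bimeasure_le:
  assumes \<beta>: "bimeasure M L \<beta>" and A: "A \<in> sets M" and B: "B \<in> sets L"
  shows "\<beta> A B \<le> measure M A" "\<beta> A B \<le> measure L B"
proof -
  show "\<beta> A B \<le> measure M A"
    using bimeasure_mono_right(1)[OF \<beta> A B sets.top sets.sets_into_space[OF B]]
      bimeasure_left[OF \<beta> A B] by simp
  have "\<beta> A {} = 0" using bimeasure_add_right[OF \<beta> A, of "{}" "{}"] by simp
  then show "\<beta> A B \<le> measure L B" using bimeasure_mono_right(2)[OF \<beta> A _ B, of "{}"] by simp
qed

text \<open>The hypothesis is tested on the set where \<open>g < f\<close>. There the integral of f
  - g vanishes; finiteness of the integral of \<open>f\<close> makes the subtraction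
  legitimate.\<close>

lemma AE_le_of_nn_integral_indicator_le:
  fixes f g :: "'a \<Rightarrow> ennreal"
  assumes [measurable]: "f \<in> borel_measurable M" "g \<in> borel_measurable M"
    and fin: "(\<integral>\<^sup>+x. f x \<partial>M) < \<infinity>"
    and le: "\<And>A. A \<in> sets M \<Longrightarrow> (\<integral>\<^sup>+x. f x * indicator A x \<partial>M) \<le> (\<integral>\<^sup>+x. g x * indicator A x \<partial>M)"
  shows "AE x in M. f x \<le> g x"
proof -
  define A where "A = {x \<in> space M. g x < f x}"
  have A [measurable]: "A \<in> sets M" unfolding A_def by measurable
  have gf: "g x * indicator A x \<le> f x * indicator A x" for x
    by (auto simp: A_def indicator_def)
  have "(\<integral>\<^sup>+x. f x * indicator A x \<partial>M) \<le> (\<integral>\<^sup>+x. f x \<partial>M)"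
    by (intro nn_integral_mono) (auto simp: indicator_def)
  then have f_fin: "(\<integral>\<^sup>+x. f x * indicator A x \<partial>M) < \<infinity>" using fin by simp
  have g_fin: "(\<integral>\<^sup>+x. g x * indicator A x \<partial>M) < \<infinity>"
    using f_fin nn_integral_mono[of M "\<lambda>x. g x * indicator A x" "\<lambda>x. f x * indicator A x"] gf
    by (simp add: order.strict_trans1)
  have "(\<integral>\<^sup>+x. f x * indicator A x - g x * indicator A x \<partial>M) = 0"
    using le[OF A] f_fin g_fin gf
    by (subst nn_integral_diff) (auto simp: diff_eq_0_iff_ennreal)
  then have "AE x in M. f x * indicator A x - g x * indicator A x = 0"
    by (subst (asm) nn_integral_0_iff_AE) auto
  moreover have "AE x in M. f x \<noteq> \<infinity>"
    using fin by (intro nn_integral_noteq_infinite) auto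
  ultimately show ?thesis
    using AE_space
  proof eventually_elim
    case (elim x)
    then show ?case
      by (cases "x \<in> A") (auto simp: diff_eq_0_iff_ennreal A_def not_less)
  qed
qed

text \<open>Turns a monotone function on the rationals into a right-continuous one, as a
  distribution function must be. The last claim recovers its values as limits along rational
  sequences, through which measurability and integral identities pass.\<close>

lemma right_continuous_INF_rat:
  fixes g :: "real \<Rightarrow> real"
  assumes mono: "\<And>q q'. q \<in> \<rat> \<Longrightarrow> q' \<in> \<rat> \<Longrightarrow> q \<le> q' \<Longrightarrow> g q \<le> g q'"
    and nonneg: "\<And>q. q \<in> \<rat> \<Longrightarrow> 0 \<le> g q"
  defines "F \<equiv> \<lambda>t. INF q\<in>{q\<in>\<rat>. t < q}. g q"
  shows "t \<le> t' \<Longrightarrow> F t \<le> F t'" and "continuous (at_right t) F"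
    and "filterlim s (at_right t) sequentially \<Longrightarrow> (\<And>n. s n \<in> \<rat>) \<Longrightarrow> (\<lambda>n. g (s n)) \<longlonglongrightarrow> F t"
proof -
  have ne: "{q\<in>\<rat>. t < q} \<noteq> {}" for t :: real
    using Rats_dense_in_real[of t "t + 1"] by auto
  have bdd: "bdd_below (g ` {q\<in>\<rat>. t < q})" for t
    using nonneg by (auto intro!: bdd_belowI2[where m=0])
  show mono_F: "F t \<le> F t'" if "t \<le> t'" for t t'
    unfolding F_def using that by (intro cINF_superset_mono bdd ne) auto
  have F_le: "F t \<le> g q" if "q \<in> \<rat>" "t < q" for q t
    unfolding F_def using that bdd by (intro cINF_lower) auto
  have ex: "\<exists>q\<in>\<rat>. t < q \<and> g q < a" if "F t < a" for a t
    using that cINF_less_iff[OF ne bdd, of t a] by (auto simp: F_def)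
  show "continuous (at_right t) F"
    unfolding continuous_within
  proof (rule order_tendstoI)
    fix a assume a: "a < F t"
    show "eventually (\<lambda>x. a < F x) (at_right t)"
      by (rule eventually_mono[OF eventually_at_right_less[of t]])
        (meson a less_le_trans less_imp_le mono_F)
  next
    fix a assume "F t < a"
    then obtain q where q: "q \<in> \<rat>" "t < q" "g q < a" using ex by blast
    show "eventually (\<lambda>x. F x < a) (at_right t)"
      by (rule eventually_mono[OF eventually_at_right_real[OF q(2)]])
        (metis F_le[OF q(1)] q(3) le_less_trans greaterThanLessThan_iff)
  qed
  assume s: "filterlim s (at_right t) sequentially" "\<And>n. s n \<in> \<rat>"
  have gt: "eventually (\<lambda>n. t < s n) sequentially"
    using s(1) by (auto simp: filterlim_at eventually_conj_iff)
  show "(\<lambda>n. g (s n)) \<longlonglongrightarrow> F t"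
  proof (rule order_tendstoI)
    fix a assume a: "a < F t"
    show "eventually (\<lambda>n. a < g (s n)) sequentially"
      using gt by eventually_elim (rule less_le_trans[OF a F_le[OF s(2)]])
  next
    fix a assume "F t < a"
    then obtain q where q: "q \<in> \<rat>" "t < q" "g q < a" using ex by blast
    have "eventually (\<lambda>n. s n < q) sequentially"
      using s(1) q(2) by (auto simp: filterlim_at dest: order_tendstoD(2))
    then show "eventually (\<lambda>n. g (s n) < a) sequentially"
      by eventually_elim (rule le_less_trans[OF mono[OF s(2) q(1)] q(3)], simp)
  qed
qed

lemma ex_rat_seq_at_right:
  obtains s :: "nat \<Rightarrow> real" where "\<And>n. s n \<in> \<rat>" "\<And>n. t < s n" "filterlim s (at_right t) sequentially"
proof -
  have "\<exists>q\<in>\<rat>. t < q \<and> q < t + 1 / real (Suc n)" for n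
    using Rats_dense_in_real[of t "t + 1 / real (Suc n)"] by auto
  then obtain s where s: "\<And>n. s n \<in> \<rat>" "\<And>n. t < s n" "\<And>n. s n < t + 1 / real (Suc n)" by metis
  have "(\<lambda>n. t + 1 / real (Suc n)) \<longlonglongrightarrow> t + 0"
    by (intro tendsto_intros LIMSEQ_inverse_real_of_nat[unfolded inverse_eq_divide])
  then have "s \<longlonglongrightarrow> t"
    using s by (intro tendsto_sandwich[of "\<lambda>_. t" s _ "\<lambda>n. t + 1 / real (Suc n)"])
      (auto intro!: always_eventually less_imp_le)
  moreover have "s n \<noteq> t" for n using s(2)[of n] by simp
  ultimately show ?thesis using that[of s] s(1,2) by (simp add: filterlim_at)
qed

text \<open>The classical construction of a regular conditional distribution, with a bimeasure in
  place of a joint law: Radon-Nikodym densities at the rational thresholds are repaired on a null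
  set, regularised from the right, and read as distribution functions.\<close>

lemma real_kernel_of_bimeasure:
  fixes M :: "'a measure" and L :: "real measure"
  assumes M: "prob_space M" and L: "real_distribution L" and supp: "measure L {0..2} = 1"
    and \<beta>: "bimeasure M L \<beta>"
  obtains \<kappa> where "\<kappa> \<in> M \<rightarrow>\<^sub>M prob_algebra borel"
    "\<And>A B. A \<in> sets M \<Longrightarrow> B \<in> sets borel \<Longrightarrow>
      (\<integral>\<^sup>+x. emeasure (\<kappa> x) B * indicator A x \<partial>M) = ennreal (\<beta> A B)"
proof -
  interpret M: prob_space M by fact
  interpret L: real_distribution L by fact
  have sL [simp]: "B \<in> sets L \<longleftrightarrow> B \<in> sets borel" for B by simp
  define I where "I t = {..t::real}" for t
  have I [measurable]: "I t \<in> sets borel" for t by (simp add: I_def)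
  \<comment> \<open>Since \<open>L\<close> lives on [0, 2], the distribution functions will be
    constant outside this interval, and their limits at both infinities are trivial.\<close>
  have low: "measure L (I t) = 0" if "t < 0" for t
  proof -
    have "measure L (I t \<union> {0..2}) = measure L (I t) + measure L {0..2}"
      using that by (intro L.finite_measure_Union) (auto simp: I_def)
    then show ?thesis using supp L.prob_le_1[of "I t \<union> {0..2}"] measure_nonneg[of L "I t"] by linarith
  qed
  have high: "measure L (I t) = 1" if "2 \<le> t" for t
  proof (rule antisym)
    have "measure L {0..2} \<le> measure L (I t)"
      using that by (intro L.finite_measure_mono) (auto simp: I_def)
    then show "1 \<le> measure L (I t)" using supp by simp
  qed simp
  have \<beta>_low: "\<beta> A (I t) = 0" if "A \<in> sets M" "t < 0" for A t
    using bimeasure_le(2)[OF \<beta> that(1), of "I t"] low[OF that(2)] bimeasure_nonneg[OF \<beta> that(1), of "I t"]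
    by simp
  have \<beta>_high: "\<beta> A (I t) = measure M A" if "A \<in> sets M" "2 \<le> t" for A t
  proof -
    have "\<beta> A (space L) - \<beta> A (I t) \<le> measure L (space L) - measure L (I t)"
      by (intro bimeasure_mono_right(2)[OF \<beta> that(1)]) auto
    then show ?thesis
      using high[OF that(2)] L.prob_space bimeasure_left[OF \<beta> that(1), of "I t"]
        bimeasure_le(1)[OF \<beta> that(1), of "I t"] by simp
  qed
  \<comment> \<open>The density of \<open>\<lambda>A. \<beta> A (I q)\<close> with respect to
    \<open>M\<close> plays the role of the conditional probability of the half-line up to
    \<open>q\<close>.\<close>
  have "\<exists>f\<in>borel_measurable M. \<forall>A\<in>sets M. (\<integral>\<^sup>+x. f x * indicator A x \<partial>M) = ennreal (\<beta> A (I q))" for q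
  proof -
    obtain M' where M': "sets M' = sets M" "\<And>A. A \<in> sets M \<Longrightarrow> emeasure M' A = ennreal (\<beta> A (I q))"
      using M.dominated_additive_measure[of "\<lambda>A. \<beta> A (I q)"]
        bimeasure_nonneg[OF \<beta> _] bimeasure_add_left[OF \<beta> _] bimeasure_le(1)[OF \<beta> _] I sL by metis
    have "emeasure M' A = 0" if "A \<in> null_sets M" for A
      using that bimeasure_le(1)[OF \<beta>, of A "I q"] M'(2)[of A] bimeasure_nonneg[OF \<beta>, of A "I q"]
      by (auto simp: null_sets_def measure_def)
    then have "absolutely_continuous M M'"
      using M'(1) by (auto simp: absolutely_continuous_def null_sets_def)
    then obtain f where f: "f \<in> borel_measurable M" "density M f = M'"
      using M.Radon_Nikodym M'(1) by blast
    have "(\<integral>\<^sup>+x. f x * indicator A x \<partial>M) = ennreal (\<beta> A (I q))" if "A \<in> sets M" for A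
      using f M'(2)[OF that] emeasure_density[OF f(1) that] by simp
    then show ?thesis using f(1) by blast
  qed
  then obtain f where f [measurable]: "\<And>q. f q \<in> borel_measurable M"
    and f_int: "\<And>q A. A \<in> sets M \<Longrightarrow> (\<integral>\<^sup>+x. f q x * indicator A x \<partial>M) = ennreal (\<beta> A (I q))"
    by metis
  have f_fin: "(\<integral>\<^sup>+x. f q x \<partial>M) < \<infinity>" for q
  proof -
    have "(\<integral>\<^sup>+x. f q x \<partial>M) = (\<integral>\<^sup>+x. f q x * indicator (space M) x \<partial>M)"
      by (intro nn_integral_cong) simp
    then show ?thesis using f_int[of "space M" q] by simp
  qed
  have f_mono: "AE x in M. f q x \<le> f q' x" if "q \<le> q'" for q q'
    using that bimeasure_mono_right(1)[OF \<beta>, of _ "I q" "I q'"]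
    by (intro AE_le_of_nn_integral_indicator_le f f_fin) (auto simp: f_int I_def ennreal_leI)
  have f_low: "AE x in M. f q x = 0" if "q < 0" for q
    using AE_le_of_nn_integral_indicator_le[OF f _ f_fin, of "\<lambda>_. 0" q] \<beta>_low[OF _ that]
    by (simp add: f_int)
  have f_high: "AE x in M. f q x = 1" if "2 \<le> q" for q
    using that by (intro M.density_unique_finite_measure)
      (auto simp: f_int \<beta>_high M.emeasure_eq_measure)
  define good where "good x \<longleftrightarrow> (\<forall>q\<in>\<rat>. \<forall>q'\<in>\<rat>. q \<le> q' \<longrightarrow> f q x \<le> f q' x)
    \<and> (\<forall>q\<in>\<rat>. q < 0 \<longrightarrow> f q x = 0) \<and> (\<forall>q\<in>\<rat>. 2 \<le> q \<longrightarrow> f q x = 1)" for x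
  have [measurable]: "Measurable.pred M good"
    unfolding good_def using countable_rat by measurable
  have good: "AE x in M. good x"
    unfolding good_def
    by (intro AE_conjI AE_ball_countable[THEN iffD2, OF countable_rat] ballI AE_impI f_mono f_low f_high)
  \<comment> \<open>Off the good set the distribution function of the point mass at 0 is
    substituted; it obeys the same constraints.\<close>
  define g where "g x q = (if good x then enn2real (f q x) else of_bool (0 \<le> q))" for x q
  have [measurable]: "(\<lambda>x. g x q) \<in> borel_measurable M" for q unfolding g_def by measurable
  have f_le1: "f q x \<le> 1" if gq: "good x" "q \<in> \<rat>" for x q
  proof -
    obtain q' where q': "q' \<in> \<rat>" "q \<le> q'" "2 \<le> q'"
      using gq(2) by (metis Rats_number_of linear order.refl)
    then have "f q x \<le> f q' x" "f q' x = 1" using gq unfolding good_def by blast+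
    then show ?thesis by simp
  qed
  have f_real: "f q x = ennreal (g x q)" if "good x" "q \<in> \<rat>" for x q
  proof -
    have "f q x \<noteq> \<top>"
    proof
      assume top: "f q x = \<top>"
      have "(\<top> :: ennreal) \<le> 1" using f_le1[OF that] unfolding top .
      then show False by (simp add: top_unique)
    qed
    then show ?thesis using that by (simp add: g_def ennreal_enn2real_if)
  qed
  have g_nonneg: "0 \<le> g x q" for x q by (simp add: g_def)
  have g_mono: "g x q \<le> g x q'" if "q \<in> \<rat>" "q' \<in> \<rat>" "q \<le> q'" for x q q'
  proof (cases "good x")
    case True
    then have "f q x \<le> f q' x" using that unfolding good_def by blast
    then show ?thesis using f_real[OF True] that g_nonneg by (simp add: ennreal_le_iff)
  qed (use that in \<open>simp add: g_def\<close>)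
  have g_le1: "g x q \<le> 1" if "q \<in> \<rat>" for x q
  proof (cases "good x")
    case True
    have "ennreal (g x q) \<le> 1" using f_le1[OF True that] unfolding f_real[OF True that] .
    then show ?thesis by (simp add: ennreal_le_1)
  qed (simp add: g_def)
  have g_low: "g x q = 0" if q: "q \<in> \<rat>" "q < 0" for x q
  proof -
    have "good x \<Longrightarrow> f q x = 0" using q unfolding good_def by blast
    then show ?thesis using q by (simp add: g_def)
  qed
  have g_high: "g x q = 1" if q: "q \<in> \<rat>" "2 \<le> q" for x q
  proof -
    have "good x \<Longrightarrow> f q x = 1" using q unfolding good_def by blast
    then show ?thesis using q by (simp add: g_def)
  qed
  have g_int: "(\<integral>\<^sup>+x. ennreal (g x q) * indicator A x \<partial>M) = ennreal (\<beta> A (I q))"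
    if "A \<in> sets M" "q \<in> \<rat>" for A q
  proof -
    have "AE x in M. ennreal (g x q) * indicator A x = f q x * indicator A x"
      using good by eventually_elim (simp add: f_real that(2))
    then show ?thesis by (simp add: f_int[OF that(1)] cong: nn_integral_cong_AE)
  qed
  define F where "F x t = (INF q\<in>{q\<in>\<rat>. t < q}. g x q)" for x t
  have F_mono: "F x t \<le> F x t'" if "t \<le> t'" for x t t'
    unfolding F_def using that by (intro right_continuous_INF_rat(1) g_mono g_nonneg)
  have F_cont: "continuous (at_right t) (F x)" for x t
    unfolding F_def by (intro right_continuous_INF_rat(2) g_mono g_nonneg)
  have F_lim: "(\<lambda>n. g x (s n)) \<longlonglongrightarrow> F x t"
    if "filterlim s (at_right t) sequentially" "\<And>n. s n \<in> \<rat>" for x t s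
    unfolding F_def using that by (intro right_continuous_INF_rat(3) g_mono g_nonneg)
  have F_low: "F x t = 0" if "t < 0" for x t
  proof -
    obtain s where s: "\<And>n. s n \<in> \<rat>" "\<And>n. t < s n" "filterlim s (at_right t) sequentially"
      using ex_rat_seq_at_right[of t] by blast
    have "eventually (\<lambda>n. s n < 0) sequentially"
      using s(3) that unfolding filterlim_at by (blast dest: order_tendstoD(2))
    then have "eventually (\<lambda>n. g x (s n) = 0) sequentially"
      by eventually_elim (simp add: g_low s(1))
    from tendsto_eventually[OF this] show ?thesis
      using LIMSEQ_unique[OF F_lim[OF s(3,1)]] by blast
  qed
  have F_high: "F x t = 1" if "2 \<le> t" for x t
  proof -
    obtain s where s: "\<And>n. s n \<in> \<rat>" "\<And>n. t < s n" "filterlim s (at_right t) sequentially"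
      using ex_rat_seq_at_right[of t] by blast
    have "g x (s n) = 1" for n using s(2)[of n] that by (intro g_high s) simp
    then show ?thesis using LIMSEQ_unique[OF F_lim[OF s(3,1), of x], of 1] by simp
  qed
  have F_bot: "(F x \<longlongrightarrow> 0) at_bot" for x
    by (intro tendsto_eventually eventually_mono[OF eventually_gt_at_bot[of 0]] F_low)
  have F_top: "(F x \<longlongrightarrow> 1) at_top" for x
    by (intro tendsto_eventually eventually_mono[OF eventually_ge_at_top[of 2]] F_high)
  have F_meas [measurable]: "(\<lambda>x. F x t) \<in> borel_measurable M" for t
  proof -
    obtain s where s: "\<And>n. s n \<in> \<rat>" "\<And>n. t < s n" "filterlim s (at_right t) sequentially"
      using ex_rat_seq_at_right[of t] by blast
    show ?thesis by (rule borel_measurable_LIMSEQ_real[OF F_lim[OF s(3,1)]]) measurable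
  qed
  have F_int: "(\<integral>\<^sup>+x. ennreal (F x t) * indicator A x \<partial>M) = ennreal (\<beta> A (I t))" if A: "A \<in> sets M" for A t
  proof -
    obtain s where s: "\<And>n. s n \<in> \<rat>" "\<And>n. t < s n" "filterlim s (at_right t) sequentially"
      using ex_rat_seq_at_right[of t] by blast
    have [measurable]: "A \<in> sets M" by fact
    have "(\<lambda>n. \<integral>\<^sup>+x. ennreal (g x (s n)) * indicator A x \<partial>M) \<longlonglongrightarrow>
      (\<integral>\<^sup>+x. ennreal (F x t) * indicator A x \<partial>M)"
    proof (rule nn_integral_dominated_convergence[where w="\<lambda>_. 1"])
      show "AE x in M. ennreal (g x (s j)) * indicator A x \<le> 1" for j
        using g_le1[OF s(1)] by (auto simp: indicator_def)
      show "AE x in M. (\<lambda>i. ennreal (g x (s i)) * indicator A x) \<longlonglongrightarrow> ennreal (F x t) * indicator A x"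
        using F_lim[OF s(3,1)] by (auto simp: indicator_def intro!: tendsto_ennrealI)
    qed (auto simp: M.emeasure_space_1)
    \<comment> \<open>Right-continuity in the threshold is inherited from the distribution function
      of \<open>L\<close>, whose increments dominate those of \<open>\<beta> A\<close>.\<close>
    moreover have "(\<lambda>n. \<beta> A (I (s n))) \<longlonglongrightarrow> \<beta> A (I t)"
    proof (rule tendsto_sandwich[of "\<lambda>_. \<beta> A (I t)" _ _ "\<lambda>n. \<beta> A (I t) + (cdf L (s n) - cdf L t)"])
      have "(\<lambda>n. cdf L (s n)) \<longlonglongrightarrow> cdf L t"
        using L.cdf_is_right_cont[of t] s(3) unfolding continuous_within by (rule filterlim_compose)
      then have "(\<lambda>n. \<beta> A (I t) + (cdf L (s n) - cdf L t)) \<longlonglongrightarrow> \<beta> A (I t) + (cdf L t - cdf L t)"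
        by (intro tendsto_intros)
      then show "(\<lambda>n. \<beta> A (I t) + (cdf L (s n) - cdf L t)) \<longlonglongrightarrow> \<beta> A (I t)" by simp
      have sub: "I t \<subseteq> I (s n)" for n using s(2)[of n] by (auto simp: I_def)
      show "eventually (\<lambda>n. \<beta> A (I t) \<le> \<beta> A (I (s n))) sequentially"
        using bimeasure_mono_right(1)[OF \<beta> A _ _ sub] by simp
      show "eventually (\<lambda>n. \<beta> A (I (s n)) \<le> \<beta> A (I t) + (cdf L (s n) - cdf L t)) sequentially"
        using bimeasure_mono_right(2)[OF \<beta> A _ _ sub] by (simp add: cdf_def I_def[symmetric] algebra_simps)
    qed simp
    ultimately show ?thesis
      using LIMSEQ_unique[OF _ tendsto_ennrealI] by (simp add: g_int[OF A s(1)])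
  qed
  define \<kappa> where "\<kappa> x = interval_measure (F x)" for x
  have \<kappa>_dist: "real_distribution (\<kappa> x)" for x
    unfolding \<kappa>_def by (intro real_distribution_interval_measure F_mono F_cont F_bot F_top)
  have \<kappa>_Iic: "emeasure (\<kappa> x) {..t} = ennreal (F x t)" for x t
    unfolding \<kappa>_def by (intro emeasure_interval_measure_Iic F_mono F_cont F_bot)
  have gen: "sets borel = sigma_sets UNIV (range (\<lambda>a::real. {..a}))"
    by (subst borel_eq_atMost) simp
  have Is: "Int_stable (range (\<lambda>a::real. {..a}))"
    by (auto simp: Int_stable_def)
  have \<kappa>: "\<kappa> \<in> M \<rightarrow>\<^sub>M prob_algebra borel"
  proof (rule measurable_prob_algebra_generated[OF gen Is])
    show "prob_space (\<kappa> x)" "sets (\<kappa> x) = sets borel" for x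
      using \<kappa>_dist[of x] by (auto simp: real_distribution_def real_distribution_axioms_def)
  qed (auto simp: \<kappa>_Iic)
  have "(\<integral>\<^sup>+x. emeasure (\<kappa> x) B * indicator A x \<partial>M) = ennreal (\<beta> A B)"
    if A: "A \<in> sets M" and B: "B \<in> sets borel" for A B
  proof -
    \<comment> \<open>For fixed \<open>A\<close> both sides are measures in \<open>B\<close>: the
      mixture of the kernel over \<open>A\<close>, and the section \<open>\<beta> A\<close>, a
      measure by domination. Half-lines determine them.\<close>
    define D where "D = density M (indicator A)"
    have D: "sets D = sets M" "space D = space M" by (simp_all add: D_def)
    have kD: "\<kappa> \<in> D \<rightarrow>\<^sub>M subprob_algebra borel"
      using measurable_prob_algebraD[OF \<kappa>] by (simp add: D cong: measurable_cong_sets)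
    have m1: "emeasure (D \<bind> \<kappa>) B = (\<integral>\<^sup>+x. emeasure (\<kappa> x) B * indicator A x \<partial>M)"
      if [measurable]: "B \<in> sets borel" for B
    proof -
      have [measurable]: "(\<lambda>x. emeasure (\<kappa> x) B) \<in> borel_measurable M"
        using measurable_prob_algebraD[OF \<kappa>] that by (intro measurable_emeasure_kernel)
      have "emeasure (D \<bind> \<kappa>) B = (\<integral>\<^sup>+x. emeasure (\<kappa> x) B \<partial>D)"
        using M.not_empty by (intro emeasure_bind[OF _ kD that]) (simp add: D)
      also have "\<dots> = (\<integral>\<^sup>+x. indicator A x * emeasure (\<kappa> x) B \<partial>M)"
        unfolding D_def using A by (intro nn_integral_density) auto
      finally show ?thesis by (simp add: mult.commute)
    qed
    obtain M' where M': "sets M' = sets L" "\<And>B. B \<in> sets L \<Longrightarrow> emeasure M' B = ennreal (\<beta> A B)"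
      using L.dominated_additive_measure[of "\<beta> A"]
        bimeasure_nonneg[OF \<beta> A] bimeasure_add_right[OF \<beta> A] bimeasure_le(2)[OF \<beta> A] by metis
    have "D \<bind> \<kappa> = M'"
    proof (rule measure_eqI_generator_eq[OF Is])
      show "sets (D \<bind> \<kappa>) = sigma_sets UNIV (range (\<lambda>a::real. {..a}))"
        using sets_bind[of D \<kappa> borel] kD M.not_empty gen
        by (metis D(2) sets_kernel)
      show "range (\<lambda>n. {..real n}) \<subseteq> range (\<lambda>a::real. {..a})" by auto
      show "(\<Union>n. {..real n}) = UNIV" using real_arch_simple by auto
      show "sets M' = sigma_sets UNIV (range (\<lambda>a::real. {..a}))" using M'(1) gen by simp
    next
      fix X assume "X \<in> range (\<lambda>a::real. {..a})"
      then obtain t where X: "X = {..t}" by blast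
      show "emeasure (D \<bind> \<kappa>) X = emeasure M' X"
        using F_int[OF A, of t] by (simp add: X m1 \<kappa>_Iic M'(2) I_def)
    next
      fix n :: nat
      show "emeasure (D \<bind> \<kappa>) {..real n} \<noteq> \<infinity>"
        using F_int[OF A, of "real n"] by (simp add: m1 \<kappa>_Iic)
    qed simp
    then show ?thesis using m1[OF B] M'(2)[of B] B by simp
  qed
  then show ?thesis using that \<kappa> by blast
qed

text \<open>\<open>\<iota>\<close> carries the problem to the real line and \<open>r\<close> brings
  the kernel back. As \<open>r\<close> inverts \<open>\<iota>\<close> on the space of
  \<open>L\<close>, taking the preimage of a set under \<open>r\<close> and then under
  \<open>\<iota>\<close> restores it.\<close>

lemma kernel_of_bimeasure:
  fixes \<iota> :: "'b \<Rightarrow> real"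
  assumes M: "prob_space M" and L: "prob_space L" and \<beta>: "bimeasure M L \<beta>"
    and \<iota> [measurable]: "\<iota> \<in> borel_measurable L" and r [measurable]: "r \<in> borel \<rightarrow>\<^sub>M L"
    and inv: "\<And>y. y \<in> space L \<Longrightarrow> r (\<iota> y) = y" and range: "\<And>y. y \<in> space L \<Longrightarrow> \<iota> y \<in> {0..2}"
  obtains p where "p \<in> M \<rightarrow>\<^sub>M prob_algebra L"
    "\<And>A B. A \<in> sets M \<Longrightarrow> B \<in> sets L \<Longrightarrow>
      (\<integral>\<^sup>+x. emeasure (p x) B * indicator A x \<partial>M) = ennreal (\<beta> A B)"
proof -
  interpret M: prob_space M by fact
  interpret L: prob_space L by fact
  define L' where "L' = distr L borel \<iota>"
  define \<beta>' where "\<beta>' A B = \<beta> A (\<iota> -` B \<inter> space L)" for A B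
  have bi: "bimeasure M L' \<beta>'"
    unfolding bimeasure_def \<beta>'_def
  proof (intro conjI ballI impI)
    show "\<beta> (space M) (\<iota> -` B \<inter> space L) = measure L' B" if "B \<in> sets L'" for B
      using that bimeasure_right[OF \<beta> sets.top[of M]] by (simp add: L'_def measure_distr)
    show "\<beta> A (\<iota> -` (B \<union> B') \<inter> space L) = \<beta> A (\<iota> -` B \<inter> space L) + \<beta> A (\<iota> -` B' \<inter> space L)"
      if "A \<in> sets M" "B \<in> sets L'" "B' \<in> sets L'" "B \<inter> B' = {}" for A B B'
    proof -
      have "\<iota> -` (B \<union> B') \<inter> space L = (\<iota> -` B \<inter> space L) \<union> (\<iota> -` B' \<inter> space L)" by auto
      moreover have "(\<iota> -` B \<inter> space L) \<inter> (\<iota> -` B' \<inter> space L) = {}" using that by auto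
      ultimately show ?thesis using that
        by (simp add: L'_def bimeasure_add_right[OF \<beta>])
    qed
  qed (auto simp: L'_def bimeasureD[OF \<beta>] bimeasure_left[OF \<beta> _ sets.top])
  have rd: "real_distribution L'" unfolding L'_def by (rule L.real_distribution_distr) fact
  have supp: "measure L' {0..2} = 1"
  proof -
    have "\<iota> -` {0..2} \<inter> space L = space L" using range by auto
    then show ?thesis by (simp add: L'_def measure_distr L.prob_space)
  qed
  obtain \<kappa> where \<kappa> [measurable]: "\<kappa> \<in> M \<rightarrow>\<^sub>M prob_algebra borel"
    and int: "\<And>A B. A \<in> sets M \<Longrightarrow> B \<in> sets borel \<Longrightarrow>
      (\<integral>\<^sup>+x. emeasure (\<kappa> x) B * indicator A x \<partial>M) = ennreal (\<beta>' A B)"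
    by (rule real_kernel_of_bimeasure[OF M rd supp bi]) blast
  define p where "p x = distr (\<kappa> x) L r" for x
  have "p \<in> M \<rightarrow>\<^sub>M prob_algebra L"
    unfolding p_def by (rule measurable_compose[OF \<kappa> measurable_distr_prob_space[OF r]])
  moreover have "(\<integral>\<^sup>+x. emeasure (p x) B * indicator A x \<partial>M) = ennreal (\<beta> A B)"
    if A: "A \<in> sets M" and B: "B \<in> sets L" for A B
  proof -
    have sb: "sets (\<kappa> x) = sets borel" if "x \<in> space M" for x
      using measurable_space[OF \<kappa> that] by (simp add: space_prob_algebra)
    have "emeasure (p x) B = emeasure (\<kappa> x) (r -` B)" if x: "x \<in> space M" for x
    proof -
      have "r \<in> \<kappa> x \<rightarrow>\<^sub>M L" using r measurable_cong_sets[OF sb[OF x] refl] by blast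
      then show ?thesis
        using B sets_eq_imp_space_eq[OF sb[OF x]] by (simp add: p_def emeasure_distr)
    qed
    then have "(\<integral>\<^sup>+x. emeasure (p x) B * indicator A x \<partial>M) = (\<integral>\<^sup>+x. emeasure (\<kappa> x) (r -` B) * indicator A x \<partial>M)"
      by (intro nn_integral_cong) simp
    also have "\<dots> = ennreal (\<beta>' A (r -` B))"
      using measurable_sets[OF r B] by (intro int A) simp
    also have "\<iota> -` (r -` B) \<inter> space L = B"
      using inv sets.sets_into_space[OF B] by auto
    then have "\<beta>' A (r -` B) = \<beta> A B" by (simp add: \<beta>'_def)
    finally show ?thesis .
  qed
  ultimately show ?thesis using that by blast
qed

subsection \<open>Kernels and couplings\<close>

text \<open>For a probability measure \<mu> these are exactly the disintegrations of the couplings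
  of \<mu> and \<nu>, described without a measure on the product.\<close>

definition mixture_kernel :: "'a measure \<Rightarrow> 'b measure \<Rightarrow> ('a \<Rightarrow> 'b measure) \<Rightarrow> bool" where
  "mixture_kernel \<mu> \<nu> p \<longleftrightarrow> prob_space \<mu> \<and> p \<in> \<mu> \<rightarrow>\<^sub>M prob_algebra \<nu>
     \<and> (\<forall>B\<in>sets \<nu>. (\<integral>\<^sup>+x. emeasure (p x) B \<partial>\<mu>) = emeasure \<nu> B)"

lemma mixture_kernel_space:
  assumes "mixture_kernel \<mu> \<nu> p" "x \<in> space \<mu>"
  shows "prob_space (p x)" "sets (p x) = sets \<nu>" "space (p x) = space \<nu>"
proof -
  have "p x \<in> space (prob_algebra \<nu>)"
    using assms measurable_space unfolding mixture_kernel_def by metis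
  then show "prob_space (p x)" "sets (p x) = sets \<nu>" by (auto simp: space_prob_algebra)
  then show "space (p x) = space \<nu>" by (metis sets_eq_imp_space_eq)
qed

lemma mixture_kernel_subprob:
  "mixture_kernel \<mu> \<nu> p \<Longrightarrow> p \<in> \<mu> \<rightarrow>\<^sub>M subprob_algebra \<nu>"
  by (auto simp: mixture_kernel_def intro: measurable_prob_algebraD)

lemma mixture_kernel_nn_integral:
  assumes p: "mixture_kernel \<mu> \<nu> p" and f: "f \<in> borel_measurable \<nu>"
  shows "(\<integral>\<^sup>+x. (\<integral>\<^sup>+y. f y \<partial>p x) \<partial>\<mu>) = (\<integral>\<^sup>+y. f y \<partial>\<nu>)"
    and "(\<lambda>x. \<integral>\<^sup>+y. f y \<partial>p x) \<in> borel_measurable \<mu>"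
proof -
  interpret prob_space \<mu> using p by (simp add: mixture_kernel_def)
  note sub = mixture_kernel_subprob[OF p]
  have "\<mu> \<bind> p = \<nu>"
  proof (rule measure_eqI)
    show s: "sets (\<mu> \<bind> p) = sets \<nu>" using sets_bind[OF sets_kernel[OF sub] not_empty] by simp
    fix B assume "B \<in> sets (\<mu> \<bind> p)"
    then have "B \<in> sets \<nu>" using s by simp
    then show "emeasure (\<mu> \<bind> p) B = emeasure \<nu> B"
      using emeasure_bind[OF not_empty sub] p by (simp add: mixture_kernel_def)
  qed
  then show "(\<integral>\<^sup>+x. (\<integral>\<^sup>+y. f y \<partial>p x) \<partial>\<mu>) = (\<integral>\<^sup>+y. f y \<partial>\<nu>)"
    using nn_integral_bind[OF f sub] by simp
  show "(\<lambda>x. \<integral>\<^sup>+y. f y \<partial>p x) \<in> borel_measurable \<mu>"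
    using sub nn_integral_measurable_subprob_algebra[OF f] by (rule measurable_compose)
qed

lemma mixture_kernel_integrable:
  fixes f :: "'b \<Rightarrow> 'c::{banach, second_countable_topology}"
  assumes p: "mixture_kernel \<mu> \<nu> p" and f: "integrable \<nu> f"
  shows "AE x in \<mu>. integrable (p x) f"
    and "integrable \<mu> (\<lambda>x. \<integral>y. f y \<partial>p x)"
    and "(\<integral>x. norm (\<integral>y. f y \<partial>p x) \<partial>\<mu>) \<le> (\<integral>y. norm (f y) \<partial>\<nu>)"
proof -
  have fm: "f \<in> borel_measurable \<nu>" "(\<lambda>y. ennreal (norm (f y))) \<in> borel_measurable \<nu>"
    using f by auto
  note nn = mixture_kernel_nn_integral[OF p fm(2)]
  have "(\<integral>\<^sup>+y. norm (f y) \<partial>\<nu>) < \<infinity>" using f by (simp add: integrable_iff_bounded)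
  then have "AE x in \<mu>. (\<integral>\<^sup>+y. norm (f y) \<partial>p x) \<noteq> \<infinity>"
    using nn by (intro nn_integral_noteq_infinite) auto
  then show "AE x in \<mu>. integrable (p x) f"
    using AE_space
  proof eventually_elim
    case (elim x)
    then show ?case
      using fm(1) measurable_cong_sets[OF mixture_kernel_space(2)[OF p elim(2)] refl]
      by (auto simp: integrable_iff_bounded less_top)
  qed
  have meas: "(\<lambda>x. \<integral>y. f y \<partial>p x) \<in> borel_measurable \<mu>"
    using mixture_kernel_subprob[OF p] integral_measurable_subprob_algebra[OF fm(1)]
    by (rule measurable_compose)
  have le: "(\<integral>\<^sup>+x. norm (\<integral>y. f y \<partial>p x) \<partial>\<mu>) \<le> (\<integral>\<^sup>+y. norm (f y) \<partial>\<nu>)"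
  proof -
    have "(\<integral>\<^sup>+x. norm (\<integral>y. f y \<partial>p x) \<partial>\<mu>) \<le> (\<integral>\<^sup>+x. (\<integral>\<^sup>+y. norm (f y) \<partial>p x) \<partial>\<mu>)"
    proof (rule nn_integral_mono)
      fix x
      \<comment> \<open>Where \<open>f\<close> is not integrable the Bochner integral is 0 by
        convention, and the bound is trivial.\<close>
      show "ennreal (norm (\<integral>y. f y \<partial>p x)) \<le> (\<integral>\<^sup>+y. norm (f y) \<partial>p x)"
        by (cases "integrable (p x) f")
          (auto simp: integral_norm_bound_ennreal not_integrable_integral_eq)
    qed
    then show ?thesis by (simp add: nn)
  qed
  then show int: "integrable \<mu> (\<lambda>x. \<integral>y. f y \<partial>p x)"
    using meas \<open>(\<integral>\<^sup>+y. norm (f y) \<partial>\<nu>) < \<infinity>\<close> by (simp add: integrable_iff_bounded)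
  show "(\<integral>x. norm (\<integral>y. f y \<partial>p x) \<partial>\<mu>) \<le> (\<integral>y. norm (f y) \<partial>\<nu>)"
    using le int f by (subst (asm) (1 2) nn_integral_eq_integral) (auto simp: integral_nonneg_AE ennreal_le_iff)
qed

lemma mixture_kernel_integral:
  fixes f :: "'b \<Rightarrow> real"
  assumes p: "mixture_kernel \<mu> \<nu> p" and f: "integrable \<nu> f"
  shows "(\<integral>x. (\<integral>y. f y \<partial>p x) \<partial>\<mu>) = (\<integral>y. f y \<partial>\<nu>)"
proof -
  have pos: "(\<integral>x. (\<integral>y. g y \<partial>p x) \<partial>\<mu>) = (\<integral>y. g y \<partial>\<nu>)"
    if g: "integrable \<nu> g" and nonneg: "\<And>y. 0 \<le> g y" for g :: "'b \<Rightarrow> real"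
  proof -
    have "ennreal (\<integral>x. (\<integral>y. g y \<partial>p x) \<partial>\<mu>) = (\<integral>\<^sup>+x. ennreal (\<integral>y. g y \<partial>p x) \<partial>\<mu>)"
      using mixture_kernel_integrable(2)[OF p g] nonneg by (simp add: nn_integral_eq_integral)
    also have "\<dots> = (\<integral>\<^sup>+x. (\<integral>\<^sup>+y. g y \<partial>p x) \<partial>\<mu>)"
      using mixture_kernel_integrable(1)[OF p g] nonneg
      by (intro nn_integral_cong_AE) (auto elim!: eventually_mono simp: nn_integral_eq_integral)
    also have "\<dots> = (\<integral>\<^sup>+y. g y \<partial>\<nu>)" using g by (intro mixture_kernel_nn_integral[OF p]) auto
    also have "\<dots> = ennreal (\<integral>y. g y \<partial>\<nu>)" using g nonneg by (simp add: nn_integral_eq_integral)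
    finally show ?thesis using nonneg by simp
  qed
  define f1 f2 where "f1 y = max 0 (f y)" and "f2 y = max 0 (- f y)" for y
  have int: "integrable \<nu> f1" "integrable \<nu> f2" unfolding f1_def f2_def using f by auto
  have eq: "f y = f1 y - f2 y" for y by (simp add: f1_def f2_def)
  have "(\<integral>x. (\<integral>y. f y \<partial>p x) \<partial>\<mu>) = (\<integral>x. (\<integral>y. f1 y \<partial>p x) - (\<integral>y. f2 y \<partial>p x) \<partial>\<mu>)"
  proof (rule integral_cong_AE)
    show "AE x in \<mu>. (\<integral>y. f y \<partial>p x) = (\<integral>y. f1 y \<partial>p x) - (\<integral>y. f2 y \<partial>p x)"
      using mixture_kernel_integrable(1)[OF p int(1)] mixture_kernel_integrable(1)[OF p int(2)]
      by eventually_elim (simp add: eq[abs_def])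
  qed (use mixture_kernel_integrable(2)[OF p, THEN borel_measurable_integrable] f int in
      \<open>auto intro!: borel_measurable_diff\<close>)
  also have "\<dots> = (\<integral>y. f1 y \<partial>\<nu>) - (\<integral>y. f2 y \<partial>\<nu>)"
    using mixture_kernel_integrable(2)[OF p int(1)] mixture_kernel_integrable(2)[OF p int(2)]
      pos[OF int(1)] pos[OF int(2)]
    by (subst Bochner_Integration.integral_diff) (simp_all add: f1_def[abs_def] f2_def[abs_def])
  also have "\<dots> = (\<integral>y. f y \<partial>\<nu>)" using int by (simp add: eq[abs_def])
  finally show ?thesis .
qed

lemma mixture_kernel_of_disintegration:
  assumes "prob_space \<mu>" and \<pi>: "\<pi> \<in> couplings \<mu> \<nu>" and p: "p \<in> disintegrations \<mu> \<nu> \<pi>"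
  shows "mixture_kernel \<mu> \<nu> p"
  unfolding mixture_kernel_def
proof (intro conjI ballI)
  show pm: "p \<in> \<mu> \<rightarrow>\<^sub>M prob_algebra \<nu>" using p by (simp add: disintegrations_def)
  fix B assume B: "B \<in> sets \<nu>"
  have s: "sets \<pi> = sets (\<mu> \<Otimes>\<^sub>M \<nu>)" "distr \<pi> \<nu> snd = \<nu>" using \<pi> by (auto simp: couplings_def)
  have A: "space \<mu> \<times> B \<in> sets (\<mu> \<Otimes>\<^sub>M \<nu>)" using B by simp
  have "(\<integral>\<^sup>+x. emeasure (p x) B \<partial>\<mu>) = (\<integral>\<^sup>+x. emeasure (p x) (Pair x -` (space \<mu> \<times> B)) \<partial>\<mu>)"
    by (intro nn_integral_cong arg_cong2[where f=emeasure] refl) auto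
  also have "\<dots> = emeasure \<pi> (space \<mu> \<times> B)" using p A by (simp add: disintegrations_def)
  also have "space \<mu> \<times> B = snd -` B \<inter> space \<pi>"
    using sets_eq_imp_space_eq[OF s(1)] sets.sets_into_space[OF B] by (auto simp: space_pair_measure)
  also have "emeasure \<pi> \<dots> = emeasure (distr \<pi> \<nu> snd) B"
    using B measurable_cong_sets[OF s(1) refl] by (subst emeasure_distr) auto
  finally show "(\<integral>\<^sup>+x. emeasure (p x) B \<partial>\<mu>) = emeasure \<nu> B" by (simp add: s)
qed fact

lemma coupling_of_mixture_kernel:
  assumes p: "mixture_kernel \<mu> \<nu> p"
  obtains \<pi> where "\<pi> \<in> couplings \<mu> \<nu>" "p \<in> disintegrations \<mu> \<nu> \<pi>"
proof -
  interpret prob_space \<mu> using p by (simp add: mixture_kernel_def)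
  have pm [measurable]: "p \<in> \<mu> \<rightarrow>\<^sub>M prob_algebra \<nu>" using p by (simp add: mixture_kernel_def)
  note sp = mixture_kernel_space[OF p]
  define k where "k x = distr (p x) (\<mu> \<Otimes>\<^sub>M \<nu>) (Pair x)" for x
  have k: "k \<in> \<mu> \<rightarrow>\<^sub>M prob_algebra (\<mu> \<Otimes>\<^sub>M \<nu>)"
    unfolding k_def by (rule measurable_distr_prob_space2[OF pm]) measurable
  define \<pi> where "\<pi> = \<mu> \<bind> k"
  have \<mu>: "\<mu> \<in> space (prob_algebra \<mu>)" by (simp add: space_prob_algebra prob_space_axioms)
  have prob: "prob_space \<pi>" unfolding \<pi>_def by (rule prob_space_bind'[OF \<mu> k])
  have sets: "sets \<pi> = sets (\<mu> \<Otimes>\<^sub>M \<nu>)" unfolding \<pi>_def by (rule sets_bind'[OF \<mu> k])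
  have em: "emeasure \<pi> A = (\<integral>\<^sup>+x. emeasure (p x) (Pair x -` A) \<partial>\<mu>)" if A: "A \<in> sets (\<mu> \<Otimes>\<^sub>M \<nu>)" for A
  proof -
    have "emeasure (k x) A = emeasure (p x) (Pair x -` A)" if x: "x \<in> space \<mu>" for x
    proof -
      have "Pair x \<in> p x \<rightarrow>\<^sub>M \<mu> \<Otimes>\<^sub>M \<nu>"
        using measurable_Pair1'[OF x, of \<nu>] measurable_cong_sets[OF sp(2)[OF x] refl] by blast
      moreover have "Pair x -` A \<inter> space (p x) = Pair x -` A"
        using sets.sets_into_space[OF A] sp(3)[OF x] by (auto simp: space_pair_measure)
      ultimately show ?thesis using A by (simp add: k_def emeasure_distr)
    qed
    then show ?thesis
      unfolding \<pi>_def using emeasure_bind_prob_algebra[OF \<mu> k A] by (simp cong: nn_integral_cong)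
  qed
  have "distr \<pi> \<mu> fst = \<mu>"
  proof (rule measure_eqI)
    fix B assume "B \<in> sets (distr \<pi> \<mu> fst)"
    then have B: "B \<in> sets \<mu>" by simp
    have fst: "fst \<in> \<pi> \<rightarrow>\<^sub>M \<mu>" by (simp add: measurable_cong_sets[OF sets refl])
    have sp\<pi>: "space \<pi> = space \<mu> \<times> space \<nu>"
      using sets_eq_imp_space_eq[OF sets] by (simp add: space_pair_measure)
    have "emeasure (distr \<pi> \<mu> fst) B = emeasure \<pi> (B \<times> space \<nu>)"
      using sets.sets_into_space[OF B] B fst sp\<pi>
      by (subst emeasure_distr) (auto intro!: arg_cong2[where f=emeasure])
    also have "\<dots> = (\<integral>\<^sup>+x. emeasure (p x) (Pair x -` (B \<times> space \<nu>)) \<partial>\<mu>)" using B by (intro em) simp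
    also have "\<dots> = (\<integral>\<^sup>+x. indicator B x \<partial>\<mu>)"
    proof (rule nn_integral_cong)
      fix x assume x: "x \<in> space \<mu>"
      have "Pair x -` (B \<times> space \<nu>) = (if x \<in> B then space (p x) else {})" using sp(3)[OF x] by auto
      then show "emeasure (p x) (Pair x -` (B \<times> space \<nu>)) = indicator B x"
        using prob_space.emeasure_space_1[OF sp(1)[OF x]] by (simp add: indicator_def)
    qed
    finally show "emeasure (distr \<pi> \<mu> fst) B = emeasure \<mu> B" using B by simp
  qed simp
  moreover have "distr \<pi> \<nu> snd = \<nu>"
  proof (rule measure_eqI)
    fix B assume "B \<in> sets (distr \<pi> \<nu> snd)"
    then have B: "B \<in> sets \<nu>" by simp
    have snd: "snd \<in> \<pi> \<rightarrow>\<^sub>M \<nu>" by (simp add: measurable_cong_sets[OF sets refl])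
    have sp\<pi>: "space \<pi> = space \<mu> \<times> space \<nu>"
      using sets_eq_imp_space_eq[OF sets] by (simp add: space_pair_measure)
    have "emeasure (distr \<pi> \<nu> snd) B = emeasure \<pi> (space \<mu> \<times> B)"
      using sets.sets_into_space[OF B] B snd sp\<pi>
      by (subst emeasure_distr) (auto intro!: arg_cong2[where f=emeasure])
    also have "\<dots> = (\<integral>\<^sup>+x. emeasure (p x) (Pair x -` (space \<mu> \<times> B)) \<partial>\<mu>)" using B by (intro em) simp
    also have "\<dots> = (\<integral>\<^sup>+x. emeasure (p x) B \<partial>\<mu>)"
      by (intro nn_integral_cong arg_cong2[where f=emeasure] refl) auto
    finally show "emeasure (distr \<pi> \<nu> snd) B = emeasure \<nu> B"
      using p B by (simp add: mixture_kernel_def)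
  qed simp
  ultimately show ?thesis
    using prob sets em pm by (intro that[of \<pi>]) (auto simp: couplings_def disintegrations_def)
qed

subsection \<open>Kernels from positive linear functionals\<close>

text \<open>The vector space to which Hahn-Banach is applied. Domination by a sum of one-coordinate
  functions provides each element and its negative with a hedge by the marginals alone, so that its
  price is finite as soon as 0 has no negative price.\<close>

definition sum_dominated :: "'a measure \<Rightarrow> 'b measure \<Rightarrow> ('a \<times> 'b \<Rightarrow> real) set" where
  "sum_dominated \<mu> \<nu> = {F. \<exists>a b. integrable \<mu> a \<and> integrable \<nu> b
     \<and> (\<forall>x\<in>space \<mu>. \<forall>y\<in>space \<nu>. \<bar>F (x, y)\<bar> \<le> a x + b y)}"

lemma sum_dominatedI:
  assumes "integrable \<mu> a" "integrable \<nu> b"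
    "\<And>x y. x \<in> space \<mu> \<Longrightarrow> y \<in> space \<nu> \<Longrightarrow> \<bar>F (x, y)\<bar> \<le> a x + b y"
  shows "F \<in> sum_dominated \<mu> \<nu>"
  using assms unfolding sum_dominated_def by blast

lemma sum_dominated_add:
  assumes "F \<in> sum_dominated \<mu> \<nu>" "G \<in> sum_dominated \<mu> \<nu>"
  shows "(\<lambda>z. F z + G z) \<in> sum_dominated \<mu> \<nu>"
proof -
  obtain a b where ab: "integrable \<mu> a" "integrable \<nu> b"
    "\<And>x y. x \<in> space \<mu> \<Longrightarrow> y \<in> space \<nu> \<Longrightarrow> \<bar>F (x, y)\<bar> \<le> a x + b y"
    using assms(1) unfolding sum_dominated_def by blast
  obtain a' b' where ab': "integrable \<mu> a'" "integrable \<nu> b'"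
    "\<And>x y. x \<in> space \<mu> \<Longrightarrow> y \<in> space \<nu> \<Longrightarrow> \<bar>G (x, y)\<bar> \<le> a' x + b' y"
    using assms(2) unfolding sum_dominated_def by blast
  show ?thesis
  proof (rule sum_dominatedI[of _ "\<lambda>x. a x + a' x" _ "\<lambda>y. b y + b' y"])
    fix x y assume "x \<in> space \<mu>" "y \<in> space \<nu>"
    then show "\<bar>F (x, y) + G (x, y)\<bar> \<le> a x + a' x + (b y + b' y)"
      using ab(3)[of x y] ab'(3)[of x y] by linarith
  qed (use ab ab' in auto)
qed

lemma sum_dominated_scale:
  assumes "F \<in> sum_dominated \<mu> \<nu>"
  shows "(\<lambda>z. c * F z) \<in> sum_dominated \<mu> \<nu>"
proof -
  obtain a b where ab: "integrable \<mu> a" "integrable \<nu> b"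
    "\<And>x y. x \<in> space \<mu> \<Longrightarrow> y \<in> space \<nu> \<Longrightarrow> \<bar>F (x, y)\<bar> \<le> a x + b y"
    using assms unfolding sum_dominated_def by blast
  show ?thesis
  proof (rule sum_dominatedI[of _ "\<lambda>x. \<bar>c\<bar> * a x" _ "\<lambda>y. \<bar>c\<bar> * b y"])
    fix x y assume "x \<in> space \<mu>" "y \<in> space \<nu>"
    then have "\<bar>c\<bar> * \<bar>F (x, y)\<bar> \<le> \<bar>c\<bar> * (a x + b y)" by (intro mult_left_mono ab) auto
    then show "\<bar>c * F (x, y)\<bar> \<le> \<bar>c\<bar> * a x + \<bar>c\<bar> * b y" by (simp add: abs_mult distrib_left)
  qed (use ab in auto)
qed

lemma sum_dominated_indicator_mult:
  assumes g: "integrable \<nu> g"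
  shows "(\<lambda>z. indicator A (fst z) * g (snd z)) \<in> sum_dominated \<mu> \<nu>"
  using g by (intro sum_dominatedI[of _ "\<lambda>_. 0" _ "\<lambda>y. \<bar>g y\<bar>"]) (auto simp: indicator_def)

lemma sum_dominated_fst: "integrable \<mu> h \<Longrightarrow> (\<lambda>z. h (fst z)) \<in> sum_dominated \<mu> \<nu>"
  by (rule sum_dominatedI[of _ "\<lambda>x. \<bar>h x\<bar>" _ "\<lambda>y. 0"]) auto

lemma sum_dominated_snd: "integrable \<nu> g \<Longrightarrow> (\<lambda>z. g (snd z)) \<in> sum_dominated \<mu> \<nu>"
  by (rule sum_dominatedI[of _ "\<lambda>x. 0" _ "\<lambda>y. \<bar>g y\<bar>"]) auto

lemma linear_on_sum:
  assumes L: "linear_on V L" and add: "\<And>f g. f \<in> V \<Longrightarrow> g \<in> V \<Longrightarrow> (\<lambda>x. f x + g x) \<in> V"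
    and "finite I" "I \<noteq> {}" "\<And>i. i \<in> I \<Longrightarrow> f i \<in> V"
  shows "(\<lambda>x. \<Sum>i\<in>I. f i x) \<in> V \<and> L (\<lambda>x. \<Sum>i\<in>I. f i x) = (\<Sum>i\<in>I. L (f i))"
  using assms(3-5)
proof (induction I rule: finite_ne_induct)
  case (singleton i)
  then show ?case by simp
next
  case (insert i I)
  then have "(\<lambda>x. \<Sum>i\<in>I. f i x) \<in> V" "L (\<lambda>x. \<Sum>i\<in>I. f i x) = (\<Sum>i\<in>I. L (f i))" "f i \<in> V" by auto
  then show ?case using insert(1,3) L add unfolding linear_on_def by simp
qed

text \<open>What integration against a coupling would give, short of countable additivity on the
  product.\<close>

definition coupling_functional ::
    "'a measure \<Rightarrow> 'b measure \<Rightarrow> (('a \<times> 'b \<Rightarrow> real) \<Rightarrow> real) \<Rightarrow> bool" where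
  "coupling_functional \<mu> \<nu> \<Lambda> \<longleftrightarrow> linear_on (sum_dominated \<mu> \<nu>) \<Lambda>
     \<and> (\<forall>F\<in>sum_dominated \<mu> \<nu>. (\<forall>x\<in>space \<mu>. \<forall>y\<in>space \<nu>. 0 \<le> F (x, y)) \<longrightarrow> 0 \<le> \<Lambda> F)
     \<and> (\<forall>h. integrable \<mu> h \<longrightarrow> \<Lambda> (\<lambda>z. h (fst z)) = (\<integral>x. h x \<partial>\<mu>))
     \<and> (\<forall>g. integrable \<nu> g \<longrightarrow> \<Lambda> (\<lambda>z. g (snd z)) = (\<integral>y. g y \<partial>\<nu>))"

lemma coupling_functional_linear:
  assumes \<Lambda>: "coupling_functional \<mu> \<nu> \<Lambda>" and F: "F \<in> sum_dominated \<mu> \<nu>"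
  shows coupling_functional_scale: "\<Lambda> (\<lambda>z. c * F z) = c * \<Lambda> F"
    and coupling_functional_add: "G \<in> sum_dominated \<mu> \<nu> \<Longrightarrow> \<Lambda> (\<lambda>z. F z + G z) = \<Lambda> F + \<Lambda> G"
    and coupling_functional_diff: "G \<in> sum_dominated \<mu> \<nu> \<Longrightarrow> \<Lambda> (\<lambda>z. F z - G z) = \<Lambda> F - \<Lambda> G"
proof -
  have lin: "linear_on (sum_dominated \<mu> \<nu>) \<Lambda>" using \<Lambda> by (simp add: coupling_functional_def)
  have scale: "\<Lambda> (\<lambda>z. c * F z) = c * \<Lambda> F" if "F \<in> sum_dominated \<mu> \<nu>" for F c
    using lin that unfolding linear_on_def by blast
  have add: "\<Lambda> (\<lambda>z. F z + G z) = \<Lambda> F + \<Lambda> G" if "G \<in> sum_dominated \<mu> \<nu>" for G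
    using lin F that unfolding linear_on_def by blast
  show "\<Lambda> (\<lambda>z. c * F z) = c * \<Lambda> F" by (rule scale[OF F])
  assume G: "G \<in> sum_dominated \<mu> \<nu>"
  show "\<Lambda> (\<lambda>z. F z + G z) = \<Lambda> F + \<Lambda> G" by (rule add[OF G])
  show "\<Lambda> (\<lambda>z. F z - G z) = \<Lambda> F - \<Lambda> G"
    using add[OF sum_dominated_scale[OF G, of "-1"]] scale[OF G, of "-1"] by simp
qed

lemma coupling_functional_mono:
  assumes \<Lambda>: "coupling_functional \<mu> \<nu> \<Lambda>" and F: "F \<in> sum_dominated \<mu> \<nu>" and G: "G \<in> sum_dominated \<mu> \<nu>"
    and le: "\<And>x y. x \<in> space \<mu> \<Longrightarrow> y \<in> space \<nu> \<Longrightarrow> F (x, y) \<le> G (x, y)"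
  shows "\<Lambda> F \<le> \<Lambda> G"
proof -
  have "(\<lambda>z. G z + (-1) * F z) \<in> sum_dominated \<mu> \<nu>"
    by (intro sum_dominated_add sum_dominated_scale F G)
  then have "0 \<le> \<Lambda> (\<lambda>z. G z - F z)" using \<Lambda> le by (auto simp: coupling_functional_def)
  then show ?thesis by (simp add: coupling_functional_diff[OF \<Lambda> G F])
qed

lemma bimeasure_of_coupling_functional:
  assumes \<mu>: "prob_space \<mu>" and \<nu>: "prob_space \<nu>" and \<Lambda>: "coupling_functional \<mu> \<nu> \<Lambda>"
  shows "bimeasure \<mu> \<nu> (\<lambda>A B. \<Lambda> (\<lambda>z. indicator A (fst z) * indicator B (snd z)))"
proof -
  interpret \<mu>: prob_space \<mu> by fact
  interpret \<nu>: prob_space \<nu> by fact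
  define \<beta> where "\<beta> = (\<lambda>A B. \<Lambda> (\<lambda>z. indicator A (fst z) * indicator B (snd z)))"
  have V: "(\<lambda>z. indicator A (fst z) * indicator B (snd z)) \<in> sum_dominated \<mu> \<nu>" if "B \<in> sets \<nu>" for A B
    using that by (intro sum_dominated_indicator_mult) (simp add: \<nu>.emeasure_eq_measure)
  \<comment> \<open>Monotonicity in both directions shows that values off the product of the two
    spaces are invisible to \<open>\<Lambda>\<close>.\<close>
  have cong: "\<Lambda> F = \<Lambda> G" if "F \<in> sum_dominated \<mu> \<nu>" "G \<in> sum_dominated \<mu> \<nu>"
    "\<And>x y. x \<in> space \<mu> \<Longrightarrow> y \<in> space \<nu> \<Longrightarrow> F (x, y) = G (x, y)" for F G
    using that by (intro antisym coupling_functional_mono[OF \<Lambda>]) auto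
  have lin: "\<Lambda> (\<lambda>z. F z + G z) = \<Lambda> F + \<Lambda> G" if "F \<in> sum_dominated \<mu> \<nu>" "G \<in> sum_dominated \<mu> \<nu>" for F G
    using that by (rule coupling_functional_add[OF \<Lambda>])
  have nonneg: "0 \<le> \<beta> A B" if "B \<in> sets \<nu>" for A B
    using \<Lambda> V[OF that, of A] by (auto simp: coupling_functional_def \<beta>_def)
  have "bimeasure \<mu> \<nu> \<beta>"
    unfolding bimeasure_def
  proof (intro conjI ballI impI)
    fix A A' B assume AB: "A \<in> sets \<mu>" "A' \<in> sets \<mu>" "B \<in> sets \<nu>" "A \<inter> A' = {}"
    have "indicator (A \<union> A') x = (indicator A x + indicator A' x :: real)" for x
      using AB(4) by (auto simp: indicator_def)
    then show "\<beta> (A \<union> A') B = \<beta> A B + \<beta> A' B"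
      using lin[OF V[OF AB(3)] V[OF AB(3)]] by (simp add: \<beta>_def distrib_right)
  next
    fix A B B' assume AB: "A \<in> sets \<mu>" "B \<in> sets \<nu>" "B' \<in> sets \<nu>" "B \<inter> B' = {}"
    have "indicator (B \<union> B') x = (indicator B x + indicator B' x :: real)" for x
      using AB(4) by (auto simp: indicator_def)
    then show "\<beta> A (B \<union> B') = \<beta> A B + \<beta> A B'"
      using lin[OF V[OF AB(2)] V[OF AB(3)]] by (simp add: \<beta>_def distrib_left)
  next
    fix A assume A: "A \<in> sets \<mu>"
    then have i: "integrable \<mu> (indicator A :: _ \<Rightarrow> real)" by (simp add: \<mu>.emeasure_eq_measure)
    have "\<beta> A (space \<nu>) = \<Lambda> (\<lambda>z. indicator A (fst z))"
      unfolding \<beta>_def by (intro cong V sum_dominated_fst i) auto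
    also have "\<dots> = (\<integral>x. indicator A x \<partial>\<mu>)" using \<Lambda> i by (auto simp: coupling_functional_def)
    finally show "\<beta> A (space \<nu>) = measure \<mu> A" using A by simp
  next
    fix B assume B: "B \<in> sets \<nu>"
    then have i: "integrable \<nu> (indicator B :: _ \<Rightarrow> real)" by (simp add: \<nu>.emeasure_eq_measure)
    have "\<beta> (space \<mu>) B = \<Lambda> (\<lambda>z. indicator B (snd z))"
      unfolding \<beta>_def by (intro cong V sum_dominated_snd i B) auto
    also have "\<dots> = (\<integral>x. indicator B x \<partial>\<nu>)" using \<Lambda> i by (auto simp: coupling_functional_def)
    finally show "\<beta> (space \<mu>) B = measure \<nu> B" using B by simp
  qed (use nonneg in auto)
  then show ?thesis by (simp add: \<beta>_def)
qed

text \<open>On indicators the kernel reproduces \<open>\<Lambda>\<close> by construction. The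
  identity extends to integrable \<open>g\<close> because both sides are linear in \<open>g\<close>
  and 1-Lipschitz for the L1 distance of \<nu>; on the side of \<open>\<Lambda>\<close> this follows
  from positivity and the second marginal.\<close>

theorem kernel_of_coupling_functional:
  fixes \<iota> :: "'b \<Rightarrow> real"
  assumes \<mu>: "prob_space \<mu>" and \<nu>: "prob_space \<nu>" and \<Lambda>: "coupling_functional \<mu> \<nu> \<Lambda>"
    and \<iota>: "\<iota> \<in> borel_measurable \<nu>" and r: "r \<in> borel \<rightarrow>\<^sub>M \<nu>"
    and inv: "\<And>y. y \<in> space \<nu> \<Longrightarrow> r (\<iota> y) = y" and range: "\<And>y. y \<in> space \<nu> \<Longrightarrow> \<iota> y \<in> {0..2}"
  obtains p where "mixture_kernel \<mu> \<nu> p"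
    "\<And>A g. A \<in> sets \<mu> \<Longrightarrow> integrable \<nu> g \<Longrightarrow>
      \<Lambda> (\<lambda>z. indicator A (fst z) * g (snd z)) = (\<integral>x. indicator A x * (\<integral>y. g y \<partial>p x) \<partial>\<mu>)"
proof -
  interpret \<mu>: prob_space \<mu> by fact
  interpret \<nu>: prob_space \<nu> by fact
  define \<beta> where "\<beta> = (\<lambda>A B. \<Lambda> (\<lambda>z. indicator A (fst z) * indicator B (snd z)))"
  have \<beta>: "bimeasure \<mu> \<nu> \<beta>"
    unfolding \<beta>_def by (rule bimeasure_of_coupling_functional[OF \<mu> \<nu> \<Lambda>])
  obtain p where pm: "p \<in> \<mu> \<rightarrow>\<^sub>M prob_algebra \<nu>"
    and p_int: "\<And>A B. A \<in> sets \<mu> \<Longrightarrow> B \<in> sets \<nu> \<Longrightarrow>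
      (\<integral>\<^sup>+x. emeasure (p x) B * indicator A x \<partial>\<mu>) = ennreal (\<beta> A B)"
    by (rule kernel_of_bimeasure[OF \<mu> \<nu> \<beta> \<iota> r inv range]) blast+
  have p: "mixture_kernel \<mu> \<nu> p"
    unfolding mixture_kernel_def
  proof (intro conjI ballI \<mu> pm)
    fix B assume B: "B \<in> sets \<nu>"
    have "(\<integral>\<^sup>+x. emeasure (p x) B \<partial>\<mu>) = (\<integral>\<^sup>+x. emeasure (p x) B * indicator (space \<mu>) x \<partial>\<mu>)"
      by (intro nn_integral_cong) simp
    also have "\<dots> = emeasure \<nu> B"
      using p_int[OF sets.top B] bimeasure_right[OF \<beta> sets.top B] by (simp add: \<nu>.emeasure_eq_measure)
    finally show "(\<integral>\<^sup>+x. emeasure (p x) B \<partial>\<mu>) = emeasure \<nu> B" .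
  qed
  note pk = mixture_kernel_integrable[OF p]
  have int_ind: "integrable \<mu> (\<lambda>x. indicator A x * (\<integral>y. g y \<partial>p x))"
    if "A \<in> sets \<mu>" "integrable \<nu> g" for A and g :: "'b \<Rightarrow> real"
    using integrable_real_mult_indicator[OF that(1) pk(2)[OF that(2)]] by (simp add: mult.commute)
  have "\<Lambda> (\<lambda>z. indicator A (fst z) * g (snd z)) = (\<integral>x. indicator A x * (\<integral>y. g y \<partial>p x) \<partial>\<mu>)"
    if A: "A \<in> sets \<mu>" and "integrable \<nu> g" for A and g :: "'b \<Rightarrow> real"
    using that(2)
  proof (induction g rule: integrable_induct)
    case (base B c)
    have [measurable]: "(\<lambda>x. measure (p x) B) \<in> borel_measurable \<mu>"
      using measurable_compose[OF pm measurable_measure_prob_algebra[OF base(1)]] .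
    have le1: "measure (p x) B \<le> 1" if "x \<in> space \<mu>" for x
      using prob_space.prob_le_1[OF mixture_kernel_space(1)[OF p that]] .
    have "integrable \<mu> (\<lambda>x. indicator A x * measure (p x) B)"
      using A le1 by (intro \<mu>.integrable_const_bound[where B=1]) (auto simp: indicator_def)
    then have "ennreal (\<integral>x. indicator A x * measure (p x) B \<partial>\<mu>) = (\<integral>\<^sup>+x. ennreal (indicator A x * measure (p x) B) \<partial>\<mu>)"
      by (intro nn_integral_eq_integral[symmetric]) auto
    also have "\<dots> = (\<integral>\<^sup>+x. emeasure (p x) B * indicator A x \<partial>\<mu>)"
    proof (rule nn_integral_cong)
      fix x assume x: "x \<in> space \<mu>"
      interpret px: prob_space "p x" by (rule mixture_kernel_space(1)[OF p x])
      show "ennreal (indicator A x * measure (p x) B) = emeasure (p x) B * indicator A x"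
        by (simp add: px.emeasure_eq_measure indicator_def)
    qed
    also have "\<dots> = ennreal (\<beta> A B)" by (rule p_int[OF A base(1)])
    finally have eq: "(\<integral>x. indicator A x * measure (p x) B \<partial>\<mu>) = \<beta> A B"
      using bimeasure_nonneg[OF \<beta> A base(1)] by (simp add: integral_nonneg_AE)
    have "(\<integral>x. indicator A x * (\<integral>y. indicator B y *\<^sub>R c \<partial>p x) \<partial>\<mu>)
        = (\<integral>x. c * (indicator A x * measure (p x) B) \<partial>\<mu>)"
    proof (rule Bochner_Integration.integral_cong[OF refl])
      fix x assume x: "x \<in> space \<mu>"
      interpret px: prob_space "p x" by (rule mixture_kernel_space(1)[OF p x])
      have "B \<in> sets (p x)" using base(1) mixture_kernel_space(2)[OF p x] by simp
      then show "indicator A x * (\<integral>y. indicator B y *\<^sub>R c \<partial>p x) = c * (indicator A x * measure (p x) B)"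
        by simp
    qed
    also have "\<dots> = c * \<beta> A B" using eq by simp
    also have "\<dots> = \<Lambda> (\<lambda>z. c * (indicator A (fst z) * indicator B (snd z)))"
      unfolding \<beta>_def using base
      by (intro coupling_functional_scale[OF \<Lambda>, symmetric] sum_dominated_indicator_mult) simp
    finally show ?case by (simp add: mult_ac)
  next
    case (add f g)
    have "\<Lambda> (\<lambda>z. indicator A (fst z) * (f (snd z) + g (snd z)))
      = \<Lambda> (\<lambda>z. indicator A (fst z) * f (snd z)) + \<Lambda> (\<lambda>z. indicator A (fst z) * g (snd z))"
      unfolding distrib_left
      by (intro coupling_functional_add[OF \<Lambda>] sum_dominated_indicator_mult add.hyps)
    also have "\<dots> = (\<integral>x. indicator A x * (\<integral>y. f y \<partial>p x) + indicator A x * (\<integral>y. g y \<partial>p x) \<partial>\<mu>)"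
      unfolding add.IH
      by (intro Bochner_Integration.integral_add[symmetric] int_ind A add.hyps)
    also have "\<dots> = (\<integral>x. indicator A x * (\<integral>y. f y + g y \<partial>p x) \<partial>\<mu>)"
    proof (rule integral_cong_AE)
      show "AE x in \<mu>. indicator A x * (\<integral>y. f y \<partial>p x) + indicator A x * (\<integral>y. g y \<partial>p x)
        = indicator A x * (\<integral>y. f y + g y \<partial>p x)"
        using pk(1)[OF add.hyps(1)] pk(1)[OF add.hyps(2)] by eventually_elim (simp add: distrib_left)
    qed (rule borel_measurable_integrable,
        intro Bochner_Integration.integrable_add int_ind A add.hyps)+
    finally show ?case .
  next
    case (lim f s)
    define R where "R g = (\<integral>x. indicator A x * (\<integral>y. g y \<partial>p x) \<partial>\<mu>)" for g :: "'b \<Rightarrow> real"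
    define T where "T g = \<Lambda> (\<lambda>z. indicator A (fst z) * g (snd z))" for g :: "'b \<Rightarrow> real"
    have R_diff: "\<bar>R f - R g\<bar> \<le> (\<integral>y. \<bar>f y - g y\<bar> \<partial>\<nu>)" if f: "integrable \<nu> f" and g: "integrable \<nu> g" for f g
    proof -
      have "R f - R g = (\<integral>x. indicator A x * (\<integral>y. f y \<partial>p x) - indicator A x * (\<integral>y. g y \<partial>p x) \<partial>\<mu>)"
        unfolding R_def using int_ind[OF A f] int_ind[OF A g] by simp
      also have "\<dots> = (\<integral>x. indicator A x * (\<integral>y. f y - g y \<partial>p x) \<partial>\<mu>)"
      proof (rule integral_cong_AE)
        show "AE x in \<mu>. indicator A x * (\<integral>y. f y \<partial>p x) - indicator A x * (\<integral>y. g y \<partial>p x)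
          = indicator A x * (\<integral>y. f y - g y \<partial>p x)"
          using pk(1)[OF f] pk(1)[OF g] by eventually_elim (simp add: right_diff_distrib)
      qed (rule borel_measurable_integrable,
          intro Bochner_Integration.integrable_diff int_ind A f g)+
      finally have "\<bar>R f - R g\<bar> \<le> (\<integral>x. \<bar>indicator A x * (\<integral>y. f y - g y \<partial>p x)\<bar> \<partial>\<mu>)"
        using integral_abs_bound by simp
      also have "\<dots> \<le> (\<integral>x. norm (\<integral>y. f y - g y \<partial>p x) \<partial>\<mu>)"
        using int_ind[OF A, of "\<lambda>y. f y - g y"] pk(2)[of "\<lambda>y. f y - g y"] f g
        by (intro integral_mono) (auto simp: indicator_def)
      also have "\<dots> \<le> (\<integral>y. norm (f y - g y) \<partial>\<nu>)" using f g by (intro pk(3)) simp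
      finally show ?thesis by simp
    qed
    have T_diff: "\<bar>T f - T g\<bar> \<le> (\<integral>y. \<bar>f y - g y\<bar> \<partial>\<nu>)" if f: "integrable \<nu> f" and g: "integrable \<nu> g" for f g
    proof -
      have le: "T f \<le> T g + (\<integral>y. \<bar>f y - g y\<bar> \<partial>\<nu>)" if f: "integrable \<nu> f" and g: "integrable \<nu> g" for f g
      proof -
        have V: "(\<lambda>z. \<bar>f (snd z) - g (snd z)\<bar>) \<in> sum_dominated \<mu> \<nu>"
          using f g sum_dominated_snd[of \<nu> "\<lambda>y. \<bar>f y - g y\<bar>"] by simp
        note Vg = sum_dominated_indicator_mult[OF g, of A \<mu>]
        have "T f \<le> \<Lambda> (\<lambda>z. indicator A (fst z) * g (snd z) + \<bar>f (snd z) - g (snd z)\<bar>)"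
          unfolding T_def
          by (intro coupling_functional_mono[OF \<Lambda>] sum_dominated_add V Vg sum_dominated_indicator_mult f)
            (auto simp: indicator_def)
        also have "\<dots> = T g + \<Lambda> (\<lambda>z. \<bar>f (snd z) - g (snd z)\<bar>)"
          unfolding T_def by (rule coupling_functional_add[OF \<Lambda> Vg V])
        also have "\<Lambda> (\<lambda>z. \<bar>f (snd z) - g (snd z)\<bar>) = (\<integral>y. \<bar>f y - g y\<bar> \<partial>\<nu>)"
        proof -
          have "integrable \<nu> (\<lambda>y. \<bar>f y - g y\<bar>)" using f g by simp
          then show ?thesis using \<Lambda> unfolding coupling_functional_def by blast
        qed
        finally show ?thesis .
      qed
      show ?thesis using le[OF f g] le[OF g f] by (simp add: abs_minus_commute abs_le_iff)
    qed
    have "(\<lambda>i. \<integral>y. \<bar>s i y - f y\<bar> \<partial>\<nu>) \<longlonglongrightarrow> (\<integral>y. 0 \<partial>\<nu>)"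
    proof (rule integral_dominated_convergence[where w="\<lambda>y. 3 * \<bar>f y\<bar>"])
      show "AE y in \<nu>. (\<lambda>i. \<bar>s i y - f y\<bar>) \<longlonglongrightarrow> 0"
        using lim.hyps(2) by (auto intro!: tendsto_rabs_zero LIM_zero)
      show "AE y in \<nu>. norm \<bar>s i y - f y\<bar> \<le> 3 * \<bar>f y\<bar>" for i
      proof (rule AE_I2)
        fix y assume "y \<in> space \<nu>"
        then have "\<bar>s i y\<bar> \<le> 2 * \<bar>f y\<bar>" using lim.hyps(3)[of y i] by simp
        then show "norm \<bar>s i y - f y\<bar> \<le> 3 * \<bar>f y\<bar>" unfolding real_norm_def by linarith
      qed
    qed (use lim in \<open>auto intro!: borel_measurable_abs borel_measurable_diff\<close>)
    then have *: "(\<lambda>i. \<integral>y. \<bar>s i y - f y\<bar> \<partial>\<nu>) \<longlonglongrightarrow> 0" by simp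
    have "(\<lambda>i. R (s i) - R f) \<longlonglongrightarrow> 0"
      by (rule tendsto_rabs_zero_cancel, rule tendsto_sandwich[OF _ _ tendsto_const *])
        (auto intro!: always_eventually R_diff lim)
    moreover have "(\<lambda>i. T (s i) - T f) \<longlonglongrightarrow> 0"
      by (rule tendsto_rabs_zero_cancel, rule tendsto_sandwich[OF _ _ tendsto_const *])
        (auto intro!: always_eventually T_diff lim)
    moreover have "T (s i) = R (s i)" for i using lim.IH by (simp add: T_def R_def)
    ultimately have "R f = T f"
      using LIMSEQ_unique[of "\<lambda>i. R (s i)" "R f" "T f"] by (simp add: LIM_zero_iff)
    then show ?case by (simp add: T_def R_def)
  qed
  then show ?thesis using that p by blast
qed

subsection \<open>Superhedging\<close>

lemma ereal_integral_real:
  assumes "integrable M h"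
  shows "ereal_integral M (\<lambda>x. ereal (h x)) = ereal (\<integral>x. h x \<partial>M)"
proof -
  have fin: "(\<integral>\<^sup>+x. ennreal (h x) \<partial>M) < \<infinity>" "(\<integral>\<^sup>+x. ennreal (- h x) \<partial>M) < \<infinity>"
    using assms by (simp_all add: real_integrable_def less_top)
  have "ereal_integral M (\<lambda>x. ereal (h x))
      = enn2ereal (\<integral>\<^sup>+x. ennreal (h x) \<partial>M) - enn2ereal (\<integral>\<^sup>+x. ennreal (- h x) \<partial>M)"
    by (simp add: ereal_integral_def ennreal.abs_eq e2ennreal_ereal)
  also have "\<dots> = ereal (enn2real (\<integral>\<^sup>+x. ennreal (h x) \<partial>M) - enn2real (\<integral>\<^sup>+x. ennreal (- h x) \<partial>M))"
    using fin by (cases "\<integral>\<^sup>+x. ennreal (h x) \<partial>M"; cases "\<integral>\<^sup>+x. ennreal (- h x) \<partial>M")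
      (auto simp: enn2ereal_ennreal)
  finally show ?thesis using real_lebesgue_integral_def[OF assms] by simp
qed

text \<open>Stated for arbitrary functions because it is applied to \<open>Qinf\<close> and
  \<open>Qbar\<close>, infima over uncountable families: \<open>nn_integral\<close> is monotone
  without measurability.\<close>

lemma ereal_integral_mono_AE:
  assumes "AE x in M. f x \<le> g x"
  shows "ereal_integral M f \<le> ereal_integral M g"
proof -
  have "(\<integral>\<^sup>+x. e2ennreal (f x) \<partial>M) \<le> (\<integral>\<^sup>+x. e2ennreal (g x) \<partial>M)"
    using assms by (intro nn_integral_mono_AE) (auto elim!: eventually_mono intro: e2ennreal_mono)
  moreover have "(\<integral>\<^sup>+x. e2ennreal (- g x) \<partial>M) \<le> (\<integral>\<^sup>+x. e2ennreal (- f x) \<partial>M)"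
    using assms by (intro nn_integral_mono_AE) (auto elim!: eventually_mono intro: e2ennreal_mono)
  ultimately show ?thesis
    unfolding ereal_integral_def by (intro ereal_minus_mono) (simp_all add: less_eq_ennreal.rep_eq)
qed

lemma borel_measurable_restricted_sets:
  "sets M = sets (restrict_space borel X) \<Longrightarrow> f \<in> borel_measurable borel \<Longrightarrow> f \<in> borel_measurable M"
  by (simp only: measurable_cong_sets[of M "restrict_space borel X" borel borel] measurable_restrict_space1)

lemma space_restricted_sets:
  "sets M = sets (restrict_space borel X) \<Longrightarrow> space M = X"
  by (drule sets_eq_imp_space_eq) (simp add: space_restrict_space)

lemma (in finite_measure) lipschitz_integrable:
  fixes \<phi> :: "'b::euclidean_space \<Rightarrow> real"
  assumes \<phi>: "L-lipschitz_on UNIV \<phi>" and f: "integrable M f"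
  shows "integrable M (\<lambda>x. \<phi> (f x))"
proof (rule Bochner_Integration.integrable_bound)
  show "integrable M (\<lambda>x. \<bar>\<phi> 0\<bar> + L * norm (f x))" using f by simp
  have "continuous_on UNIV \<phi>" using \<phi> by (rule lipschitz_on_continuous_on)
  then show "(\<lambda>x. \<phi> (f x)) \<in> borel_measurable M"
    using f by (intro measurable_compose[OF borel_measurable_integrable borel_measurable_continuous_onI])
  show "AE x in M. norm (\<phi> (f x)) \<le> norm (\<bar>\<phi> 0\<bar> + L * norm (f x))"
  proof (rule AE_I2)
    fix x
    have "\<bar>\<phi> (f x) - \<phi> 0\<bar> \<le> L * norm (f x)"
      using lipschitz_onD[OF \<phi>, of "f x" 0] by (simp add: dist_norm)
    then show "norm (\<phi> (f x)) \<le> norm (\<bar>\<phi> 0\<bar> + L * norm (f x))" by simp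
  qed
qed

text \<open>Every term on the right of the hedging inequality has a known bound under an admissible plan:
  the marginals give the integrals of \<open>g\<close> and \<open>h\<close>, and \<open>U x \<bullet> z - C x\<close> minorizes \<open>s \<theta> z\<close>, so that by
  convexity its integral is at most \<open>s d\<close> for a plan of cost at most \<open>d\<close>.\<close>

definition superhedge ::
    "('a::real_inner \<Rightarrow> ennreal) \<Rightarrow> real \<Rightarrow> 'a measure \<Rightarrow> 'a measure \<Rightarrow> ('a \<times> 'a \<Rightarrow> real) \<Rightarrow> real \<Rightarrow> bool" where
  "superhedge \<theta> d \<mu> \<nu> F r \<longleftrightarrow> (\<exists>g h s U C. integrable \<nu> g \<and> integrable \<mu> h \<and> 0 \<le> s
     \<and> (\<exists>B. \<forall>x\<in>space \<mu>. norm (U x) \<le> B)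
     \<and> (\<forall>x\<in>space \<mu>. \<forall>z. ennreal (U x \<bullet> z - C x) \<le> ennreal s * \<theta> z)
     \<and> (\<forall>x\<in>space \<mu>. \<forall>y\<in>space \<nu>. F (x, y) \<le> g y + h x + (U x \<bullet> (x - y) - C x))
     \<and> r = (\<integral>y. g y \<partial>\<nu>) + (\<integral>x. h x \<partial>\<mu>) + s * d)"

section \<open>The cone of superhedges\<close>

lemma superhedge_add:
  assumes "superhedge \<theta> d \<mu> \<nu> F r" "superhedge \<theta> d \<mu> \<nu> G r'"
  shows "superhedge \<theta> d \<mu> \<nu> (\<lambda>z. F z + G z) (r + r')"
proof -
  obtain g h s U C B where 1: "integrable \<nu> g" "integrable \<mu> h" "0 \<le> s"
    "\<And>x. x \<in> space \<mu> \<Longrightarrow> norm (U x) \<le> B"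
    "\<And>x z. x \<in> space \<mu> \<Longrightarrow> ennreal (U x \<bullet> z - C x) \<le> ennreal s * \<theta> z"
    "\<And>x y. x \<in> space \<mu> \<Longrightarrow> y \<in> space \<nu> \<Longrightarrow> F (x, y) \<le> g y + h x + (U x \<bullet> (x - y) - C x)"
    "r = (\<integral>y. g y \<partial>\<nu>) + (\<integral>x. h x \<partial>\<mu>) + s * d"
    using assms(1) unfolding superhedge_def by blast
  obtain g' h' s' U' C' B' where 2: "integrable \<nu> g'" "integrable \<mu> h'" "0 \<le> s'"
    "\<And>x. x \<in> space \<mu> \<Longrightarrow> norm (U' x) \<le> B'"
    "\<And>x z. x \<in> space \<mu> \<Longrightarrow> ennreal (U' x \<bullet> z - C' x) \<le> ennreal s' * \<theta> z"
    "\<And>x y. x \<in> space \<mu> \<Longrightarrow> y \<in> space \<nu> \<Longrightarrow> G (x, y) \<le> g' y + h' x + (U' x \<bullet> (x - y) - C' x)"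
    "r' = (\<integral>y. g' y \<partial>\<nu>) + (\<integral>x. h' x \<partial>\<mu>) + s' * d"
    using assms(2) unfolding superhedge_def by blast
  show ?thesis
    unfolding superhedge_def
  proof (intro exI conjI ballI allI)
    show "integrable \<nu> (\<lambda>y. g y + g' y)" "integrable \<mu> (\<lambda>x. h x + h' x)" "0 \<le> s + s'"
      using 1 2 by auto
    fix x assume x: "x \<in> space \<mu>"
    show "norm (U x + U' x) \<le> B + B'"
      using 1(4)[OF x] 2(4)[OF x] by (intro norm_triangle_le) simp
    show "ennreal ((U x + U' x) \<bullet> z - (C x + C' x)) \<le> ennreal (s + s') * \<theta> z" for z
    proof -
      \<comment> \<open>Both parts are truncated at 0 before the sum is split, as
        \<open>ennreal\<close> is additive on nonnegative reals.\<close>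
      have "(U x + U' x) \<bullet> z - (C x + C' x) \<le> max 0 (U x \<bullet> z - C x) + max 0 (U' x \<bullet> z - C' x)"
        by (simp add: inner_add_left)
      then have "ennreal ((U x + U' x) \<bullet> z - (C x + C' x))
        \<le> ennreal (max 0 (U x \<bullet> z - C x) + max 0 (U' x \<bullet> z - C' x))" by (rule ennreal_leI)
      also have "\<dots> = ennreal (U x \<bullet> z - C x) + ennreal (U' x \<bullet> z - C' x)"
        by (simp add: ennreal_plus ennreal_max_0)
      also have "\<dots> \<le> ennreal s * \<theta> z + ennreal s' * \<theta> z"
        by (intro add_mono 1(5) 2(5) x)
      finally show ?thesis using 1(3) 2(3) by (simp add: ennreal_plus distrib_right)
    qed
    fix y assume y: "y \<in> space \<nu>"
    show "F (x, y) + G (x, y) \<le> g y + g' y + (h x + h' x) + ((U x + U' x) \<bullet> (x - y) - (C x + C' x))"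
      using 1(6)[OF x y] 2(6)[OF x y] by (simp add: inner_add_left)
  qed (use 1 2 in \<open>simp_all add: algebra_simps\<close>)
qed

lemma superhedge_scale:
  assumes "superhedge \<theta> d \<mu> \<nu> F r" "0 \<le> c"
  shows "superhedge \<theta> d \<mu> \<nu> (\<lambda>z. c * F z) (c * r)"
proof -
  obtain g h s U C B where 1: "integrable \<nu> g" "integrable \<mu> h" "0 \<le> s"
    "\<And>x. x \<in> space \<mu> \<Longrightarrow> norm (U x) \<le> B"
    "\<And>x z. x \<in> space \<mu> \<Longrightarrow> ennreal (U x \<bullet> z - C x) \<le> ennreal s * \<theta> z"
    "\<And>x y. x \<in> space \<mu> \<Longrightarrow> y \<in> space \<nu> \<Longrightarrow> F (x, y) \<le> g y + h x + (U x \<bullet> (x - y) - C x)"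
    "r = (\<integral>y. g y \<partial>\<nu>) + (\<integral>x. h x \<partial>\<mu>) + s * d"
    using assms(1) unfolding superhedge_def by blast
  show ?thesis
    unfolding superhedge_def
  proof (intro exI conjI ballI allI)
    show "integrable \<nu> (\<lambda>y. c * g y)" "integrable \<mu> (\<lambda>x. c * h x)" "0 \<le> c * s"
      using 1 assms(2) by auto
    fix x assume x: "x \<in> space \<mu>"
    show "norm (c *\<^sub>R U x) \<le> c * B" using 1(4)[OF x] assms(2) by (simp add: mult_left_mono)
    show "ennreal ((c *\<^sub>R U x) \<bullet> z - c * C x) \<le> ennreal (c * s) * \<theta> z" for z
    proof -
      have "ennreal ((c *\<^sub>R U x) \<bullet> z - c * C x) = ennreal c * ennreal (U x \<bullet> z - C x)"
        using assms(2) by (simp add: ennreal_mult' flip: right_diff_distrib)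
      also have "\<dots> \<le> ennreal c * (ennreal s * \<theta> z)" by (intro mult_left_mono 1(5) x) simp
      finally show ?thesis using assms(2) by (simp add: ennreal_mult' mult.assoc)
    qed
    fix y assume y: "y \<in> space \<nu>"
    have "c * F (x, y) \<le> c * (g y + h x + (U x \<bullet> (x - y) - C x))"
      using 1(6)[OF x y] assms(2) by (rule mult_left_mono)
    then show "c * F (x, y) \<le> c * g y + c * h x + ((c *\<^sub>R U x) \<bullet> (x - y) - c * C x)"
      by (simp add: algebra_simps)
  qed (use 1 in \<open>simp_all add: algebra_simps\<close>)
qed

text \<open>With multiplier s = 0 only the marginals are paid for and \<open>d\<close> does not
  enter; this is how the functional will be pinned on functions of one coordinate.\<close>

lemma superhedge_marginals:
  assumes "integrable \<nu> g" "integrable \<mu> h"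
    "\<And>x y. x \<in> space \<mu> \<Longrightarrow> y \<in> space \<nu> \<Longrightarrow> F (x, y) \<le> g y + h x"
  shows "superhedge \<theta> d \<mu> \<nu> F ((\<integral>y. g y \<partial>\<nu>) + (\<integral>x. h x \<partial>\<mu>))"
  unfolding superhedge_def
  by (rule exI[of _ g], rule exI[of _ h], rule exI[of _ 0], rule exI[of _ "\<lambda>_. 0"],
      rule exI[of _ "\<lambda>_. 0"]) (use assms in auto)

text \<open>The supremum over \<open>x\<close> of the affine parts of a superhedge of \<open>0\<close> is an admissible dual
  potential, up to truncation from below.\<close>

lemma superhedge_zero_nonneg:
  fixes \<theta> :: "real^'m \<Rightarrow> ennreal"
  assumes \<mu>: "prob_space \<mu>" and \<nu>: "prob_space \<nu>" and \<nu>_id: "integrable \<nu> (\<lambda>y. y)"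
    and dual: "\<And>\<phi> L. convex_on UNIV \<phi> \<Longrightarrow> L-lipschitz_on UNIV \<phi> \<Longrightarrow> bdd_below (range \<phi>) \<Longrightarrow>
      ereal_integral \<mu> (Qinf \<theta> \<phi>) - ereal (\<integral>y. \<phi> y \<partial>\<nu>) \<le> ereal d"
    and r: "superhedge \<theta> d \<mu> \<nu> (\<lambda>z. 0) r"
  shows "0 \<le> r"
proof -
  interpret \<mu>: prob_space \<mu> by fact
  interpret \<nu>: prob_space \<nu> by fact
  obtain g h s U C B where g: "integrable \<nu> g" and h: "integrable \<mu> h" and s: "0 \<le> s"
    and B: "\<And>x. x \<in> space \<mu> \<Longrightarrow> norm (U x) \<le> B"
    and minor: "\<And>x z. x \<in> space \<mu> \<Longrightarrow> ennreal (U x \<bullet> z - C x) \<le> ennreal s * \<theta> z"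
    and hedge: "\<And>x y. x \<in> space \<mu> \<Longrightarrow> y \<in> space \<nu> \<Longrightarrow> 0 \<le> g y + h x + (U x \<bullet> (x - y) - C x)"
    and r_eq: "r = (\<integral>y. g y \<partial>\<nu>) + (\<integral>x. h x \<partial>\<mu>) + s * d"
    using r unfolding superhedge_def by blast
  obtain x0 y0 where x0: "x0 \<in> space \<mu>" and y0: "y0 \<in> space \<nu>"
    using \<mu>.not_empty \<nu>.not_empty by blast
  have B0: "0 \<le> B" using B[OF x0] norm_ge_zero order_trans by blast
  show ?thesis
  proof (cases "s = 0")
    case True
    \<comment> \<open>With s = 0 the affine part is nonpositive at every z, so the marginal parts
      alone hedge 0.\<close>
    have "0 \<le> g y + h x" if "x \<in> space \<mu>" "y \<in> space \<nu>" for x y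
      using hedge[OF that] minor[OF that(1), of "x - y"] True by (simp add: ennreal_eq_0_iff)
    then have "0 \<le> g y + (\<integral>x. h x \<partial>\<mu>)" if "y \<in> space \<nu>" for y
      using integral_nonneg_AE[where M=\<mu> and f="\<lambda>x. g y + h x"] that h \<mu>.prob_space by simp
    then have "0 \<le> (\<integral>y. g y + (\<integral>x. h x \<partial>\<mu>) \<partial>\<nu>)" by (intro integral_nonneg_AE AE_I2)
    then show ?thesis using g \<nu>.prob_space True by (simp add: r_eq)
  next
    case False
    then have s: "0 < s" using s by simp
    \<comment> \<open>The hedging inequality solved for \<open>g y\<close> and divided by
      \<open>s\<close>. The supremum over x is therefore below \<open>g y / s\<close> on the space
      of \<nu>, is Lipschitz with constant \<open>B / s\<close>, and is large enough for
      \<open>- h / s\<close> to bound its \<open>Qinf\<close> from below on the space of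
      \<mu>.\<close>
    define A where "A x y = (U x \<bullet> (y - x) + C x - h x) / s" for x y
    define \<phi> where "\<phi> y = (SUP x\<in>space \<mu>. A x y)" for y
    have A_lip: "A x y \<le> A x y' + B / s * norm (y - y')" if "x \<in> space \<mu>" for x y y'
    proof -
      have "U x \<bullet> (y - y') \<le> norm (U x) * norm (y - y')" by (rule norm_cauchy_schwarz)
      also have "\<dots> \<le> B * norm (y - y')" by (intro mult_right_mono B that) simp
      finally have "U x \<bullet> (y - y') / s \<le> B * norm (y - y') / s" using s by (simp add: divide_right_mono)
      moreover have "A x y = A x y' + U x \<bullet> (y - y') / s"
        by (simp add: A_def inner_diff_right add_divide_distrib diff_divide_distrib)
      ultimately show ?thesis by simp
    qed
    have A_le: "A x y \<le> g y / s" if "x \<in> space \<mu>" "y \<in> space \<nu>" for x y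
      using hedge[OF that] s by (simp add: A_def divide_right_mono inner_diff_right)
    have bdd: "bdd_above ((\<lambda>x. A x y) ` space \<mu>)" for y
    proof (rule bdd_aboveI2)
      fix x assume x: "x \<in> space \<mu>"
      show "A x y \<le> g y0 / s + B / s * norm (y - y0)"
        using A_lip[OF x, of y y0] A_le[OF x y0] by simp
    qed
    have \<phi>_ge: "A x y \<le> \<phi> y" if "x \<in> space \<mu>" for x y
      unfolding \<phi>_def using that bdd by (rule cSUP_upper)
    have \<phi>_le: "\<phi> y \<le> a" if "\<And>x. x \<in> space \<mu> \<Longrightarrow> A x y \<le> a" for y a
      unfolding \<phi>_def using that x0 by (intro cSUP_least) auto
    have \<phi>_lip': "\<phi> y \<le> \<phi> y' + B / s * norm (y - y')" for y y'
      using A_lip \<phi>_ge by (intro \<phi>_le) (smt (verit))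
    have \<phi>_lip: "(B / s)-lipschitz_on UNIV \<phi>"
    proof (rule lipschitz_onI)
      fix y y'
      show "dist (\<phi> y) (\<phi> y') \<le> B / s * dist y y'"
        using \<phi>_lip'[of y y'] \<phi>_lip'[of y' y]
        by (simp add: dist_real_def dist_norm abs_le_iff norm_minus_commute)
    qed (use B0 s in simp)
    have \<phi>_conv: "convex_on UNIV \<phi>"
    proof (unfold convex_on_def, intro conjI ballI allI impI)
      fix x y :: "real^'m" and u v :: real
      assume uv: "0 \<le> u" "0 \<le> v" "u + v = 1"
      show "\<phi> (u *\<^sub>R x + v *\<^sub>R y) \<le> u * \<phi> x + v * \<phi> y"
      proof (rule \<phi>_le)
        fix w assume w: "w \<in> space \<mu>"
        have v: "v = 1 - u" using uv by simp
        have "A w (u *\<^sub>R x + v *\<^sub>R y) = u * A w x + v * A w y"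
          unfolding A_def v using s by (simp add: field_simps inner_diff_right inner_add_right)
        also have "\<dots> \<le> u * \<phi> x + v * \<phi> y"
          using uv \<phi>_ge[OF w] by (intro add_mono mult_left_mono) auto
        finally show "A w (u *\<^sub>R x + v *\<^sub>R y) \<le> u * \<phi> x + v * \<phi> y" .
      qed
    qed simp
    \<comment> \<open>Potentials must be bounded from below, so \<open>\<phi>\<close> is cut at -n.
      The cut does not increase absolute values, and dominated convergence removes it again.\<close>
    define T where "T n y = max (\<phi> y) (- real n)" for n y
    have \<phi>_int: "integrable \<nu> \<phi>" using \<nu>.lipschitz_integrable[OF \<phi>_lip \<nu>_id] by simp
    have T_lip: "(B / s)-lipschitz_on UNIV (T n)" for n
    proof (rule lipschitz_onI)
      show "dist (T n y) (T n y') \<le> B / s * dist y y'" for y y'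
        using lipschitz_onD[OF \<phi>_lip, of y y'] by (auto simp: T_def dist_real_def)
    qed (use B0 s in simp)
    have T_conv: "convex_on UNIV (T n)" for n
    proof (unfold convex_on_def, intro conjI ballI allI impI)
      fix x y :: "real^'m" and u v :: real
      assume uv: "0 \<le> u" "0 \<le> v" "u + v = 1"
      have "\<phi> (u *\<^sub>R x + v *\<^sub>R y) \<le> u * \<phi> x + v * \<phi> y"
        using \<phi>_conv uv by (simp add: convex_on_def)
      also have "\<dots> \<le> u * T n x + v * T n y"
        using uv by (intro add_mono mult_left_mono) (auto simp: T_def)
      finally have 1: "\<phi> (u *\<^sub>R x + v *\<^sub>R y) \<le> u * T n x + v * T n y" .
      have "- real n = (u + v) * (- real n)" using uv by simp
      also have "\<dots> = u * (- real n) + v * (- real n)" by (rule distrib_right)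
      also have "\<dots> \<le> u * T n x + v * T n y"
        using uv by (intro add_mono mult_left_mono) (auto simp: T_def)
      finally show "T n (u *\<^sub>R x + v *\<^sub>R y) \<le> u * T n x + v * T n y"
        using 1 by (simp add: T_def[of n "u *\<^sub>R x + v *\<^sub>R y"])
    qed simp
    have bound: "- (\<integral>x. h x \<partial>\<mu>) / s - (\<integral>y. T n y \<partial>\<nu>) \<le> d" for n
    proof -
      have Q: "ereal (- h x / s) \<le> Qinf \<theta> (T n) x" if x: "x \<in> space \<mu>" for x
        unfolding Qinf_def
      proof (rule INF_greatest)
        fix y
        show "ereal (- h x / s) \<le> ereal (T n y) + enn2ereal (\<theta> (x - y))"
        proof (cases "\<theta> (x - y)")
          case (real t)
          have "ennreal (U x \<bullet> (x - y) - C x) \<le> ennreal (s * t)"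
            using minor[OF x, of "x - y"] real s by (simp add: ennreal_mult)
          then have "U x \<bullet> (x - y) - C x \<le> s * t"
            using real s by (simp add: ennreal_le_iff)
          then have "- h x / s \<le> A x y + t" using s by (simp add: A_def field_simps inner_diff_right)
          also have "A x y \<le> T n y" using \<phi>_ge[OF x, of y] by (simp add: T_def)
          finally show ?thesis using real by (simp add: enn2ereal_ennreal)
        qed simp
      qed
      have "ereal (\<integral>x. - h x / s \<partial>\<mu>) = ereal_integral \<mu> (\<lambda>x. ereal (- h x / s))"
        using h by (intro ereal_integral_real[symmetric]) simp
      also have "\<dots> \<le> ereal_integral \<mu> (Qinf \<theta> (T n))"
        using Q by (intro ereal_integral_mono_AE AE_I2)
      finally have "ereal (\<integral>x. - h x / s \<partial>\<mu>) - ereal (\<integral>y. T n y \<partial>\<nu>)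
        \<le> ereal_integral \<mu> (Qinf \<theta> (T n)) - ereal (\<integral>y. T n y \<partial>\<nu>)"
        by (intro ereal_minus_mono) simp_all
      also have "\<dots> \<le> ereal d"
        by (rule dual[OF T_conv T_lip]) (auto simp: T_def intro!: bdd_belowI2[where m="- real n"])
      finally show ?thesis by simp
    qed
    have "(\<lambda>n. \<integral>y. T n y \<partial>\<nu>) \<longlonglongrightarrow> (\<integral>y. \<phi> y \<partial>\<nu>)"
    proof (rule integral_dominated_convergence[where w="\<lambda>y. \<bar>\<phi> y\<bar>"])
      show "T n \<in> borel_measurable \<nu>" for n
        using \<phi>_int unfolding T_def[abs_def] by (intro borel_measurable_max) auto
      show "AE y in \<nu>. (\<lambda>n. T n y) \<longlonglongrightarrow> \<phi> y"
      proof (rule AE_I2)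
        fix y
        obtain m :: nat where "- \<phi> y \<le> real m" using real_arch_simple by blast
        then have "eventually (\<lambda>n. T n y = \<phi> y) sequentially"
          by (intro eventually_sequentiallyI[of m]) (simp add: T_def)
        then show "(\<lambda>n. T n y) \<longlonglongrightarrow> \<phi> y" by (rule tendsto_eventually)
      qed
      show "AE y in \<nu>. norm (T n y) \<le> \<bar>\<phi> y\<bar>" for n by (rule AE_I2) (simp add: T_def)
    qed (use \<phi>_int in auto)
    then have "(\<lambda>n. - (\<integral>x. h x \<partial>\<mu>) / s - (\<integral>y. T n y \<partial>\<nu>)) \<longlonglongrightarrow> - (\<integral>x. h x \<partial>\<mu>) / s - (\<integral>y. \<phi> y \<partial>\<nu>)"
      by (intro tendsto_intros)
    then have "- (\<integral>x. h x \<partial>\<mu>) / s - (\<integral>y. \<phi> y \<partial>\<nu>) \<le> d"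
      using bound by (intro LIMSEQ_le_const2) auto
    moreover have "(\<integral>y. \<phi> y \<partial>\<nu>) \<le> (\<integral>y. g y / s \<partial>\<nu>)"
      using \<phi>_int g A_le by (intro integral_mono \<phi>_le) auto
    ultimately have "- (\<integral>x. h x \<partial>\<mu>) / s - (\<integral>y. g y \<partial>\<nu>) / s \<le> d" by simp
    then show ?thesis using s by (simp add: r_eq field_simps)
  qed
qed

text \<open>A superhedge of F and one of -F add up to a superhedge of 0, so the assumption bounds
  prices from below and makes the least price a real sublinear functional. Hedging \<open>h\<close>
  and \<open>- h\<close> by themselves fixes the marginals of a linear functional below it; hedging
  \<open>- F\<close> by 0 for nonnegative F makes it positive.\<close>

lemma coupling_functional_of_superhedge:
  fixes \<theta> :: "'a::real_inner \<Rightarrow> ennreal"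
  assumes nonneg: "\<And>r. superhedge \<theta> d \<mu> \<nu> (\<lambda>z. 0) r \<Longrightarrow> 0 \<le> r"
  obtains \<Lambda> where "coupling_functional \<mu> \<nu> \<Lambda>"
    "\<And>F r. F \<in> sum_dominated \<mu> \<nu> \<Longrightarrow> superhedge \<theta> d \<mu> \<nu> F r \<Longrightarrow> \<Lambda> F \<le> r"
proof -
  define V where "V = sum_dominated \<mu> \<nu>"
  define P where "P F = Inf {r. superhedge \<theta> d \<mu> \<nu> F r}" for F
  have V_add: "(\<lambda>z. F z + G z) \<in> V" if "F \<in> V" "G \<in> V" for F G
    using that sum_dominated_add unfolding V_def by blast
  have V_scale: "(\<lambda>z. c * F z) \<in> V" if "F \<in> V" for F c
    using that sum_dominated_scale unfolding V_def by blast
  have ex: "\<exists>r. superhedge \<theta> d \<mu> \<nu> F r" if F: "F \<in> V" for F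
  proof -
    obtain a b where ab: "integrable \<mu> a" "integrable \<nu> b"
      "\<And>x y. x \<in> space \<mu> \<Longrightarrow> y \<in> space \<nu> \<Longrightarrow> \<bar>F (x, y)\<bar> \<le> a x + b y"
      using F unfolding V_def sum_dominated_def by blast
    have "F (x, y) \<le> b y + a x" if "x \<in> space \<mu>" "y \<in> space \<nu>" for x y
      using ab(3)[OF that] by linarith
    then have "superhedge \<theta> d \<mu> \<nu> F ((\<integral>y. b y \<partial>\<nu>) + (\<integral>x. a x \<partial>\<mu>))"
      by (rule superhedge_marginals[OF ab(2,1)])
    then show ?thesis ..
  qed
  have bdd: "bdd_below {r. superhedge \<theta> d \<mu> \<nu> F r}" if F: "F \<in> V" for F
  proof -
    obtain r' where r': "superhedge \<theta> d \<mu> \<nu> (\<lambda>z. (-1) * F z) r'" using ex[OF V_scale[OF F]] by blast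
    have "- r' \<le> r" if "superhedge \<theta> d \<mu> \<nu> F r" for r
      using nonneg[of "r + r'"] superhedge_add[OF that r'] by simp
    then show ?thesis by (auto intro!: bdd_belowI[of _ "- r'"])
  qed
  have P_le: "P F \<le> r" if "F \<in> V" "superhedge \<theta> d \<mu> \<nu> F r" for F r
    unfolding P_def using that bdd by (intro cInf_lower) auto
  have P_ge: "a \<le> P F" if "F \<in> V" "\<And>r. superhedge \<theta> d \<mu> \<nu> F r \<Longrightarrow> a \<le> r" for F a
    unfolding P_def using that ex by (intro cInf_greatest) auto
  have zero: "(\<lambda>z. 0) \<in> V"
    unfolding V_def by (rule sum_dominatedI[of _ "\<lambda>_. 0" _ "\<lambda>_. 0"]) auto
  have "sublinear_on V P"
    unfolding sublinear_on_def
  proof (intro conjI ballI allI impI)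
    fix F G assume FG: "F \<in> V" "G \<in> V"
    have *: "P (\<lambda>z. F z + G z) \<le> r + r'"
      if "superhedge \<theta> d \<mu> \<nu> F r" "superhedge \<theta> d \<mu> \<nu> G r'" for r r'
      using superhedge_add[OF that] V_add[OF FG] by (intro P_le)
    have "P (\<lambda>z. F z + G z) - r' \<le> P F" if "superhedge \<theta> d \<mu> \<nu> G r'" for r'
    proof (rule P_ge[OF FG(1)])
      show "P (\<lambda>z. F z + G z) - r' \<le> r" if "superhedge \<theta> d \<mu> \<nu> F r" for r
        using *[OF that \<open>superhedge \<theta> d \<mu> \<nu> G r'\<close>] by simp
    qed
    then have "P (\<lambda>z. F z + G z) - P F \<le> P G"
      by (intro P_ge[OF FG(2)]) (simp add: algebra_simps)
    then show "P (\<lambda>z. F z + G z) \<le> P F + P G" by simp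
  next
    fix c :: real and F assume c: "0 \<le> c" and F: "F \<in> V"
    show "P (\<lambda>z. c * F z) = c * P F"
    proof (cases "c = 0")
      case True
      have "superhedge \<theta> d \<mu> \<nu> (\<lambda>z. 0) 0"
        using superhedge_marginals[of \<nu> "\<lambda>_. 0" \<mu> "\<lambda>_. 0" "\<lambda>_. 0" \<theta> d] by simp
      then have "P (\<lambda>z. 0) = 0"
        using P_le[OF zero] P_ge[OF zero nonneg] by (intro antisym) auto
      then show ?thesis using True by simp
    next
      case False
      have le: "P (\<lambda>z. a * G z) \<le> a * P G" if "0 < a" "G \<in> V" for a G
      proof -
        have "P (\<lambda>z. a * G z) / a \<le> P G"
        proof (rule P_ge[OF that(2)])
          fix r assume "superhedge \<theta> d \<mu> \<nu> G r"
          then have "P (\<lambda>z. a * G z) \<le> a * r"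
            using that by (intro P_le V_scale superhedge_scale) auto
          then show "P (\<lambda>z. a * G z) / a \<le> r" using that by (simp add: field_simps)
        qed
        then show ?thesis using that by (simp add: field_simps)
      qed
      have "P F \<le> (1 / c) * P (\<lambda>z. c * F z)"
        using le[of "1 / c" "\<lambda>z. c * F z"] V_scale[OF F] c False by simp
      then show ?thesis using le[of c F] F c False by (simp add: field_simps)
    qed
  qed
  then obtain \<Lambda> where lin: "linear_on V \<Lambda>" and le_P: "\<And>F. F \<in> V \<Longrightarrow> \<Lambda> F \<le> P F"
    using Hahn_Banach_sublinear[of V P] zero V_add V_scale by blast
  have le: "\<Lambda> F \<le> r" if "F \<in> V" "superhedge \<theta> d \<mu> \<nu> F r" for F r
    using le_P[OF that(1)] P_le[OF that] by simp
  have minus: "\<Lambda> (\<lambda>z. (-1) * F z) = - \<Lambda> F" if "F \<in> V" for F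
  proof -
    have "\<Lambda> (\<lambda>z. (-1) * F z) = (-1) * \<Lambda> F" using lin that unfolding linear_on_def by blast
    then show ?thesis by simp
  qed
  have le_neg: "- r \<le> \<Lambda> F" if "F \<in> V" "superhedge \<theta> d \<mu> \<nu> (\<lambda>z. - F z) r" for F r
    using le[OF V_scale[OF that(1), of "-1"], of r] that(2) minus[OF that(1)] by simp
  have "coupling_functional \<mu> \<nu> \<Lambda>"
    unfolding coupling_functional_def V_def[symmetric]
  proof (intro conjI ballI allI impI)
    fix F assume F: "F \<in> V" "\<forall>x\<in>space \<mu>. \<forall>y\<in>space \<nu>. 0 \<le> F (x, y)"
    have "superhedge \<theta> d \<mu> \<nu> (\<lambda>z. - F z) ((\<integral>y. 0 \<partial>\<nu>) + (\<integral>x. 0 \<partial>\<mu>))"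
      using F by (intro superhedge_marginals) auto
    from le_neg[OF F(1) this] show "0 \<le> \<Lambda> F" by simp
  next
    fix h :: "'a \<Rightarrow> real" assume h: "integrable \<mu> h"
    have V: "(\<lambda>z. h (fst z)) \<in> V" unfolding V_def by (rule sum_dominated_fst[OF h])
    have "superhedge \<theta> d \<mu> \<nu> (\<lambda>z. h (fst z)) ((\<integral>y. 0 \<partial>\<nu>) + (\<integral>x. h x \<partial>\<mu>))"
      "superhedge \<theta> d \<mu> \<nu> (\<lambda>z. - h (fst z)) ((\<integral>y. 0 \<partial>\<nu>) + (\<integral>x. - h x \<partial>\<mu>))"
      using h by (intro superhedge_marginals; simp)+
    then show "\<Lambda> (\<lambda>z. h (fst z)) = (\<integral>x. h x \<partial>\<mu>)"
      using le[OF V] le_neg[OF V] by (intro antisym) fastforce+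
  next
    fix g :: "'a \<Rightarrow> real" assume g: "integrable \<nu> g"
    have V: "(\<lambda>z. g (snd z)) \<in> V" unfolding V_def by (rule sum_dominated_snd[OF g])
    have "superhedge \<theta> d \<mu> \<nu> (\<lambda>z. g (snd z)) ((\<integral>y. g y \<partial>\<nu>) + (\<integral>x. 0 \<partial>\<mu>))"
      "superhedge \<theta> d \<mu> \<nu> (\<lambda>z. - g (snd z)) ((\<integral>y. - g y \<partial>\<nu>) + (\<integral>x. 0 \<partial>\<mu>))"
      using g by (intro superhedge_marginals; simp)+
    then show "\<Lambda> (\<lambda>z. g (snd z)) = (\<integral>y. g y \<partial>\<nu>)"
      using le[OF V] le_neg[OF V] by (intro antisym) fastforce+
  qed (rule lin)
  then show ?thesis using that le by (simp add: V_def)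
qed

lemma mixture_kernel_inner:
  assumes p: "mixture_kernel \<mu> \<nu> p" and int: "integrable \<nu> (\<lambda>y::'b::euclidean_space. y)"
  shows "AE x in \<mu>. (\<integral>y. u \<bullet> y \<partial>p x) = u \<bullet> (\<integral>y. y \<partial>p x)"
  using mixture_kernel_integrable(1)[OF p int] by eventually_elim simp

text \<open>The cost is a supremum of affine functions of the barycenter; the finite maxima are reached by
  selecting one of them measurably in \<open>x\<close>, and each such selection has a superhedge of value \<open>d\<close>.\<close>

lemma bary_cost_le_of_superhedge:
  fixes \<theta> :: "real^'m \<Rightarrow> ennreal"
  assumes lsc: "lsc \<theta>" and conv: "convex_ennreal \<theta>"
    and \<mu>: "prob_space \<mu>" and \<mu>_id: "integrable \<mu> (\<lambda>x. x)" and \<nu>_id: "integrable \<nu> (\<lambda>y. y)"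
    and \<Lambda>: "coupling_functional \<mu> \<nu> \<Lambda>"
    and le: "\<And>F r. F \<in> sum_dominated \<mu> \<nu> \<Longrightarrow> superhedge \<theta> d \<mu> \<nu> F r \<Longrightarrow> \<Lambda> F \<le> r"
    and p: "mixture_kernel \<mu> \<nu> p"
    and p_int: "\<And>A g. A \<in> sets \<mu> \<Longrightarrow> integrable \<nu> g \<Longrightarrow>
      \<Lambda> (\<lambda>z. indicator A (fst z) * g (snd z)) = (\<integral>x. indicator A x * (\<integral>y. g y \<partial>p x) \<partial>\<mu>)"
  shows "(\<integral>\<^sup>+x. \<theta> (x - (\<integral>y. y \<partial>p x)) \<partial>\<mu>) \<le> ennreal d"
proof -
  interpret \<mu>: prob_space \<mu> by fact
  obtain l :: "nat \<Rightarrow> (real^'m) \<times> real" where l0: "l 0 = 0" and l: "\<And>n. affine_minorant \<theta> (l n)"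
    and \<theta>: "\<And>z. \<theta> z = (SUP n. ennreal (fst (l n) \<bullet> z - snd (l n)))"
    by (rule lsc_convex_eq_SUP_affine[OF lsc conv]) blast
  define b where "b x = (\<integral>y. y \<partial>p x)" for x
  have b_int: "integrable \<mu> b"
    unfolding b_def by (rule mixture_kernel_integrable(2)[OF p \<nu>_id])
  define a where "a i x = fst (l i) \<bullet> (x - b x) - snd (l i)" for i x
  have a_int: "integrable \<mu> (a i)" for i
    unfolding a_def using \<mu>_id b_int by simp
  then have [measurable]: "a i \<in> borel_measurable \<mu>" for i by blast
  define M where "M n x = (SUP i\<in>{..n}. ennreal (a i x))" for n x
  have M_int: "(\<integral>\<^sup>+x. M n x \<partial>\<mu>) \<le> ennreal d" for n
  proof -
    \<comment> \<open>The first index at which the maximum of the n + 1 affine values is attained;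
      taking the first one makes the sets \<open>A i\<close> with \<open>i \<le> n\<close> a
      partition.\<close>
    define k where "k x = (LEAST i. i \<le> n \<and> (\<forall>j\<le>n. a j x \<le> a i x))" for x
    have k: "k x \<le> n" "\<And>j. j \<le> n \<Longrightarrow> a j x \<le> a (k x) x" for x
    proof -
      have "\<exists>i. i \<le> n \<and> (\<forall>j\<le>n. a j x \<le> a i x)"
      proof -
        define m where "m = Max ((\<lambda>i. a i x) ` {..n})"
        have "m \<in> (\<lambda>i. a i x) ` {..n}" unfolding m_def by (intro Max_in) auto
        then obtain i where i: "i \<le> n" "m = a i x" by auto
        have "a j x \<le> a i x" if "j \<le> n" for j
          unfolding i(2)[symmetric] m_def using that by (intro Max_ge) auto
        then show ?thesis using i by blast
      qed
      then have "k x \<le> n \<and> (\<forall>j\<le>n. a j x \<le> a (k x) x)" unfolding k_def by (rule LeastI_ex)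
      then show "k x \<le> n" "\<And>j. j \<le> n \<Longrightarrow> a j x \<le> a (k x) x" by auto
    qed
    define A where "A i = {x \<in> space \<mu>. (\<forall>j\<in>{..n}. a j x \<le> a i x) \<and> (\<forall>j\<in>{..<i}. a j x < a i x)}" for i
    have A [measurable]: "A i \<in> sets \<mu>" for i unfolding A_def by measurable
    have A_iff: "x \<in> A i \<longleftrightarrow> i = k x" if "x \<in> space \<mu>" "i \<le> n" for x i
    proof
      assume i: "x \<in> A i"
      show "i = k x"
      proof (rule antisym)
        show "k x \<le> i" unfolding k_def using i that by (intro Least_le) (auto simp: A_def)
        show "i \<le> k x"
        proof (rule ccontr)
          assume "\<not> i \<le> k x"
          then have "a (k x) x < a i x" using i by (auto simp: A_def)
          then show False using k(2)[OF that(2), of x] by simp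
        qed
      qed
    next
      assume i: "i = k x"
      have "a j x < a (k x) x" if j: "j < k x" for j
      proof (rule ccontr)
        assume "\<not> ?thesis"
        then have "j \<le> n \<and> (\<forall>j'\<le>n. a j' x \<le> a j x)"
          using k(1)[of x] k(2)[of _ x] j by (force intro: order_trans)
        then have "k x \<le> j" unfolding k_def by (rule Least_le)
        then show False using j by simp
      qed
      then show "x \<in> A i" using that k(2)[of _ x] by (auto simp: A_def i)
    qed
    have sum_A: "(\<Sum>i\<le>n. indicator (A i) x * t i) = t (k x)" if "x \<in> space \<mu>" for x and t :: "nat \<Rightarrow> real"
    proof -
      have "(\<Sum>i\<le>n. indicator (A i) x * t i) = (\<Sum>i\<le>n. if i = k x then t i else 0)"
        by (intro sum.cong) (auto simp: A_iff that indicator_def)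
      also have "\<dots> = t (k x)" using k(1)[of x] by simp
      finally show ?thesis .
    qed
    \<comment> \<open>The affine value with y in place of the barycenter, split into an x-part and a
      y-part: these are the two kinds of functions on which \<open>\<Lambda>\<close> is
      known.\<close>
    define G where "G i z = indicator (A i) (fst z) * (fst (l i) \<bullet> fst z - snd (l i))
      - indicator (A i) (fst z) * (fst (l i) \<bullet> snd z)" for i and z :: "(real^'m) \<times> (real^'m)"
    have ind_int: "integrable \<mu> (\<lambda>x. indicator (A i) x * (fst (l i) \<bullet> x - snd (l i)))"
      "integrable \<mu> (\<lambda>x. indicator (A i) x * (fst (l i) \<bullet> b x))"
      "integrable \<mu> (\<lambda>x. indicator (A i) x * a i x)" for i
      using \<mu>_id b_int a_int
      by (simp_all add: mult.commute[of "indicator (A i) _"] integrable_real_mult_indicator[OF A])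
    have V1: "(\<lambda>z. indicator (A i) (fst z) * (fst (l i) \<bullet> fst z - snd (l i))) \<in> sum_dominated \<mu> \<nu>" for i
      by (rule sum_dominated_fst[OF ind_int(1)])
    have V2: "(\<lambda>z. indicator (A i) (fst z) * (fst (l i) \<bullet> snd z)) \<in> sum_dominated \<mu> \<nu>" for i
      using \<nu>_id by (intro sum_dominated_indicator_mult) simp
    have V: "G i \<in> sum_dominated \<mu> \<nu>" for i
      using sum_dominated_add[OF V1[of i] sum_dominated_scale[OF V2[of i], of "-1"]]
      unfolding G_def by simp
    have \<Lambda>_G: "\<Lambda> (G i) = (\<integral>x. indicator (A i) x * a i x \<partial>\<mu>)" for i
    proof -
      have "\<Lambda> (G i) = \<Lambda> (\<lambda>z. indicator (A i) (fst z) * (fst (l i) \<bullet> fst z - snd (l i)))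
        - \<Lambda> (\<lambda>z. indicator (A i) (fst z) * (fst (l i) \<bullet> snd z))"
        unfolding G_def by (rule coupling_functional_diff[OF \<Lambda> V1 V2])
      also have "\<Lambda> (\<lambda>z. indicator (A i) (fst z) * (fst (l i) \<bullet> fst z - snd (l i)))
        = (\<integral>x. indicator (A i) x * (fst (l i) \<bullet> x - snd (l i)) \<partial>\<mu>)"
        using \<Lambda> ind_int(1)[of i] unfolding coupling_functional_def by blast
      also have "\<Lambda> (\<lambda>z. indicator (A i) (fst z) * (fst (l i) \<bullet> snd z))
        = (\<integral>x. indicator (A i) x * (\<integral>y. fst (l i) \<bullet> y \<partial>p x) \<partial>\<mu>)"
        using \<nu>_id by (intro p_int A) simp
      also have "\<dots> = (\<integral>x. indicator (A i) x * (fst (l i) \<bullet> b x) \<partial>\<mu>)"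
      proof (rule integral_cong_AE)
        show "AE x in \<mu>. indicator (A i) x * (\<integral>y. fst (l i) \<bullet> y \<partial>p x) = indicator (A i) x * (fst (l i) \<bullet> b x)"
          using mixture_kernel_inner[OF p \<nu>_id, of "fst (l i)"] by eventually_elim (simp add: b_def)
        have "integrable \<mu> (\<lambda>x. \<integral>y. fst (l i) \<bullet> y \<partial>p x)"
          using \<nu>_id by (intro mixture_kernel_integrable(2)[OF p]) simp
        then show "(\<lambda>x. indicator (A i) x * (\<integral>y. fst (l i) \<bullet> y \<partial>p x)) \<in> borel_measurable \<mu>" by simp
      qed (use ind_int(2) in blast)
      also have "(\<integral>x. indicator (A i) x * (fst (l i) \<bullet> x - snd (l i)) \<partial>\<mu>) - \<dots>
        = (\<integral>x. indicator (A i) x * (fst (l i) \<bullet> x - snd (l i)) - indicator (A i) x * (fst (l i) \<bullet> b x) \<partial>\<mu>)"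
        by (intro Bochner_Integration.integral_diff[symmetric] ind_int)
      also have "\<dots> = (\<integral>x. indicator (A i) x * a i x \<partial>\<mu>)"
        by (intro Bochner_Integration.integral_cong refl) (simp add: a_def inner_diff_right algebra_simps)
      finally show ?thesis .
    qed
    have "(\<lambda>z. \<Sum>i\<le>n. G i z) \<in> sum_dominated \<mu> \<nu> \<and> \<Lambda> (\<lambda>z. \<Sum>i\<le>n. G i z) = (\<Sum>i\<le>n. \<Lambda> (G i))"
      using \<Lambda> V sum_dominated_add unfolding coupling_functional_def by (intro linear_on_sum) auto
    \<comment> \<open>A hedge with s = 1 and no marginal part: \<open>U\<close> and \<open>C\<close>
      come from the affine minorant selected at x, and the slopes are bounded since only n + 1 of
      them occur.\<close>
    moreover have "superhedge \<theta> d \<mu> \<nu> (\<lambda>z. \<Sum>i\<le>n. G i z) d"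
      unfolding superhedge_def
    proof (intro exI conjI ballI allI)
      fix x assume x: "x \<in> space \<mu>"
      show "norm (fst (l (k x))) \<le> (\<Sum>i\<le>n. norm (fst (l i)))"
        using k(1)[of x] by (intro member_le_sum) auto
      show "ennreal (fst (l (k x)) \<bullet> z - snd (l (k x))) \<le> ennreal 1 * \<theta> z" for z
        using l by (simp add: affine_minorant_def)
      fix y
      have "(\<Sum>i\<le>n. G i (x, y)) = (\<Sum>i\<le>n. indicator (A i) x * (fst (l i) \<bullet> (x - y) - snd (l i)))"
        by (intro sum.cong refl) (simp add: G_def inner_diff_right algebra_simps)
      then show "(\<Sum>i\<le>n. G i (x, y)) \<le> 0 + 0 + (fst (l (k x)) \<bullet> (x - y) - snd (l (k x)))"
        using sum_A[OF x] by simp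
    qed auto
    ultimately have "(\<Sum>i\<le>n. \<Lambda> (G i)) \<le> d"
      using le[of "\<lambda>z. \<Sum>i\<le>n. G i z" d] by simp
    then have le_d: "(\<Sum>i\<le>n. \<integral>x. indicator (A i) x * a i x \<partial>\<mu>) \<le> d" by (simp add: \<Lambda>_G)
    have "(\<integral>\<^sup>+x. M n x \<partial>\<mu>) \<le> (\<integral>\<^sup>+x. ennreal (\<Sum>i\<le>n. indicator (A i) x * a i x) \<partial>\<mu>)"
    proof (rule nn_integral_mono)
      fix x assume x: "x \<in> space \<mu>"
      show "M n x \<le> ennreal (\<Sum>i\<le>n. indicator (A i) x * a i x)"
        unfolding M_def sum_A[OF x] by (intro SUP_least ennreal_leI k(2)) simp
    qed
    also have "\<dots> = ennreal (\<integral>x. (\<Sum>i\<le>n. indicator (A i) x * a i x) \<partial>\<mu>)"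
    proof (rule nn_integral_eq_integral)
      show "AE x in \<mu>. 0 \<le> (\<Sum>i\<le>n. indicator (A i) x * a i x)"
      proof (rule AE_I2)
        fix x assume x: "x \<in> space \<mu>"
        \<comment> \<open>The zero function at index 0 makes the maximum nonnegative, so truncation
          by \<open>ennreal\<close> does not change its integral.\<close>
        have "a 0 x = 0" by (simp add: a_def l0)
        then show "0 \<le> (\<Sum>i\<le>n. indicator (A i) x * a i x)" using sum_A[OF x] k(2)[of 0 x] by simp
      qed
    qed (intro Bochner_Integration.integrable_sum ind_int)
    also have "(\<integral>x. (\<Sum>i\<le>n. indicator (A i) x * a i x) \<partial>\<mu>) = (\<Sum>i\<le>n. \<integral>x. indicator (A i) x * a i x \<partial>\<mu>)"
      by (intro Bochner_Integration.integral_sum ind_int)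
    finally show ?thesis using le_d ennreal_leI order_trans by blast
  qed
  have "(\<integral>\<^sup>+x. \<theta> (x - b x) \<partial>\<mu>) = (\<integral>\<^sup>+x. (SUP n. M n x) \<partial>\<mu>)"
  proof (rule nn_integral_cong)
    fix x
    show "\<theta> (x - b x) = (SUP n. M n x)"
    proof (rule antisym)
      have "ennreal (a i x) \<le> (SUP n. M n x)" for i
        by (rule SUP_upper2[of i]) (auto simp: M_def intro: SUP_upper)
      then show "\<theta> (x - b x) \<le> (SUP n. M n x)" unfolding \<theta> a_def[symmetric] by (intro SUP_least)
      show "(SUP n. M n x) \<le> \<theta> (x - b x)"
        unfolding \<theta> a_def[symmetric] M_def by (intro SUP_least SUP_upper) simp
    qed
  qed
  also have "\<dots> = (SUP n. \<integral>\<^sup>+x. M n x \<partial>\<mu>)"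
  proof (rule nn_integral_monotone_convergence_SUP)
    show "incseq M"
      by (intro incseq_SucI le_funI) (auto simp: M_def intro!: SUP_subset_mono)
    show "M n \<in> borel_measurable \<mu>" for n unfolding M_def by measurable
  qed
  also have "\<dots> \<le> ennreal d" using M_int by (intro SUP_least)
  finally show ?thesis by (simp add: b_def)
qed

theorem bary_cost_le_dual:
  fixes \<theta> :: "real^'m \<Rightarrow> ennreal"
  assumes X: "X \<in> sets borel" and lsc: "lsc \<theta>" and conv: "convex_ennreal \<theta>"
    and \<mu>: "prob_space \<mu>" "integrable \<mu> (\<lambda>x. x)"
    and \<nu>: "prob_space \<nu>" "sets \<nu> = sets (restrict_space borel X)" "integrable \<nu> (\<lambda>y. y)"
    and dual: "\<And>\<phi> L. convex_on UNIV \<phi> \<Longrightarrow> L-lipschitz_on UNIV \<phi> \<Longrightarrow> bdd_below (range \<phi>) \<Longrightarrow>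
      ereal_integral \<mu> (Qinf \<theta> \<phi>) - ereal (\<integral>y. \<phi> y \<partial>\<nu>) \<le> ereal d"
  shows "bary_cost \<theta> \<nu> \<mu> \<le> ennreal d"
proof -
  obtain \<Lambda> where \<Lambda>: "coupling_functional \<mu> \<nu> \<Lambda>"
    "\<And>F r. F \<in> sum_dominated \<mu> \<nu> \<Longrightarrow> superhedge \<theta> d \<mu> \<nu> F r \<Longrightarrow> \<Lambda> F \<le> r"
  proof (rule coupling_functional_of_superhedge)
    show "0 \<le> r" if "superhedge \<theta> d \<mu> \<nu> (\<lambda>z. 0) r" for r
      by (rule superhedge_zero_nonneg[OF \<mu>(1) \<nu>(1) \<nu>(3) dual that])
  qed blast
  have sp: "space \<nu> = X" by (rule space_restricted_sets[OF \<nu>(2)])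
  obtain x0 where x0: "x0 \<in> X" using prob_space.not_empty[OF \<nu>(1)] sp by blast
  obtain \<iota> :: "real^'m \<Rightarrow> real" and r where \<iota>: "\<iota> \<in> borel_measurable borel" and r: "r \<in> borel_measurable borel"
    "\<And>x. r (\<iota> x) = x" and rng: "\<And>x. 0 \<le> \<iota> x" "\<And>x. \<iota> x \<le> 2"
    by (rule borel_embedding_real) blast
  \<comment> \<open>The decoded point may lie outside \<open>X\<close>; sending it to
    \<open>x0\<close> then gives a measurable map into the restricted space.\<close>
  define r' where "r' t = (if r t \<in> X then r t else x0)" for t
  have "r' \<in> borel \<rightarrow>\<^sub>M restrict_space borel X"
  proof (rule measurable_restrict_space2)
    show "r' \<in> space borel \<rightarrow> X" using x0 by (auto simp: r'_def)
    show "r' \<in> borel_measurable borel" unfolding r'_def using r(1) X by measurable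
  qed
  then have r': "r' \<in> borel \<rightarrow>\<^sub>M \<nu>" by (simp add: measurable_cong_sets[OF refl \<nu>(2)])
  obtain p where p: "mixture_kernel \<mu> \<nu> p"
    "\<And>A g. A \<in> sets \<mu> \<Longrightarrow> integrable \<nu> g \<Longrightarrow>
      \<Lambda> (\<lambda>z. indicator A (fst z) * g (snd z)) = (\<integral>x. indicator A x * (\<integral>y. g y \<partial>p x) \<partial>\<mu>)"
    by (rule kernel_of_coupling_functional[OF \<mu>(1) \<nu>(1) \<Lambda>(1) borel_measurable_restricted_sets[OF \<nu>(2) \<iota>] r'])
      (use r(2) rng in \<open>auto simp: r'_def sp\<close>)
  obtain \<pi> where \<pi>: "\<pi> \<in> couplings \<mu> \<nu>" "p \<in> disintegrations \<mu> \<nu> \<pi>"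
    by (rule coupling_of_mixture_kernel[OF p(1)])
  have "bary_cost \<theta> \<nu> \<mu> \<le> (\<integral>\<^sup>+x. \<theta> (x - (\<integral>y. y \<partial>p x)) \<partial>\<mu>)"
    unfolding bary_cost_def by (intro INF_lower2[OF \<pi>(1)] INF_lower2[OF \<pi>(2)] order_refl)
  also have "\<dots> \<le> ennreal d"
    by (rule bary_cost_le_of_superhedge[OF lsc conv \<mu> \<nu>(3) \<Lambda> p])
  finally show ?thesis .
qed

subsection \<open>Duality and the convex envelope\<close>

text \<open>A real convex function on a Euclidean space is continuous, so the case of a finite cost
  falls under that of a lower semicontinuous one.\<close>

lemma lsc_convex_ennreal_of_real:
  fixes f :: "'a::euclidean_space \<Rightarrow> real"
  assumes nonneg: "\<And>x. 0 \<le> f x" and conv: "convex_on UNIV f"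
  shows "lsc (\<lambda>x. ennreal (f x))" "convex_ennreal (\<lambda>x. ennreal (f x))"
proof -
  have "continuous_on UNIV f" by (rule convex_on_continuous[OF open_UNIV conv])
  then have "(f \<longlongrightarrow> f x) (at x)" for x by (simp add: continuous_on_def)
  then have tend: "((\<lambda>x. ennreal (f x)) \<longlongrightarrow> ennreal (f x)) (at x)" for x by (intro tendsto_ennrealI)
  show "lsc (\<lambda>x. ennreal (f x))"
    unfolding lsc_def using lim_imp_Liminf[OF _ tend] by (simp add: trivial_limit_at)
  show "convex_ennreal (\<lambda>x. ennreal (f x))"
    unfolding convex_ennreal_def
  proof (intro allI impI)
    fix x y and u v :: real assume uv: "0 \<le> u" "0 \<le> v" "u + v = 1"
    then have "f (u *\<^sub>R x + v *\<^sub>R y) \<le> u * f x + v * f y"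
      using conv by (simp add: convex_on_def)
    then have "ennreal (f (u *\<^sub>R x + v *\<^sub>R y)) \<le> ennreal (u * f x + v * f y)" by (rule ennreal_leI)
    also have "\<dots> = ennreal u * ennreal (f x) + ennreal v * ennreal (f y)"
      using uv nonneg by (simp add: ennreal_plus ennreal_mult)
    finally show "ennreal (f (u *\<^sub>R x + v *\<^sub>R y)) \<le> ennreal u * ennreal (f x) + ennreal v * ennreal (f y)" .
  qed
qed

section \<open>Measures with first moment, potentials of linear growth, and weak duality\<close>

lemma is_norm_ineqs:
  assumes "is_norm N"
  shows "0 \<le> N x" "N (x + y) \<le> N x + N y" "N (x - y) \<le> N (x - z) + N (z - y)" "N (- x) = N x"
proof -
  have tri: "N (x + y) \<le> N x + N y" for x y using assms by (simp add: is_norm_def)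
  show "N (x + y) \<le> N x + N y" by (rule tri)
  show "N (x - y) \<le> N (x - z) + N (z - y)" using tri[of "x - z" "z - y"] by simp
  show "0 \<le> N x" using assms by (simp add: is_norm_def)
  have "N ((-1) *\<^sub>R x) = \<bar>-1\<bar> * N x" using assms unfolding is_norm_def by blast
  then show "N (- x) = N x" by simp
qed

lemma P1D:
  assumes N: "is_norm N" and \<mu>: "\<mu> \<in> P1 N Y"
  shows "prob_space \<mu>" "sets \<mu> = sets (restrict_space borel Y)" "space \<mu> = Y"
    "integrable \<mu> N" "integrable \<mu> (\<lambda>x. x)"
proof -
  show prob: "prob_space \<mu>" and s: "sets \<mu> = sets (restrict_space borel Y)" and int: "integrable \<mu> N"
    using \<mu> by (auto simp: P1_def)
  show "space \<mu> = Y" by (rule space_restricted_sets[OF s])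
  obtain c C where c: "0 < c" "0 < C" "\<And>x. c * norm x \<le> N x" "\<And>x. N x \<le> C * norm x"
    "continuous_on UNIV N" by (rule is_norm_equivalent[OF N]) blast
  show "integrable \<mu> (\<lambda>x. x)"
  proof (rule Bochner_Integration.integrable_bound)
    show "integrable \<mu> (\<lambda>x. N x / c)" using int by simp
    show "(\<lambda>x. x) \<in> borel_measurable \<mu>" by (rule borel_measurable_restricted_sets[OF s]) simp
    show "AE x in \<mu>. norm x \<le> norm (N x / c)"
    proof (rule AE_I2)
      fix x
      have "norm x \<le> N x / c" using c(1) c(3)[of x] by (simp add: field_simps)
      also have "\<dots> \<le> norm (N x / c)" unfolding real_norm_def by (rule abs_ge_self)
      finally show "norm x \<le> norm (N x / c)" .
    qed
  qed
qed

lemma Phi1b_integrable: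
  assumes N: "is_norm N" and \<phi>: "\<phi> \<in> Phi1b N Y" and \<nu>: "\<nu> \<in> P1 N Y"
  shows "integrable \<nu> \<phi>"
proof -
  interpret prob_space \<nu> using P1D(1)[OF N \<nu>] .
  obtain a' b' x0 where ab: "continuous_on Y \<phi>" "0 \<le> b'" "\<And>x. x \<in> Y \<Longrightarrow> \<bar>\<phi> x\<bar> \<le> a' + b' * N (x - x0)"
    using \<phi> unfolding Phi1b_def by blast
  show ?thesis
  proof (rule Bochner_Integration.integrable_bound)
    show "integrable \<nu> (\<lambda>x. a' + b' * (N x + N x0))" using P1D(4)[OF N \<nu>] by simp
    have "\<phi> \<in> borel_measurable (restrict_space borel Y)"
      by (rule borel_measurable_continuous_on_restrict[OF ab(1)])
    then show "\<phi> \<in> borel_measurable \<nu>"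
      by (simp only: measurable_cong_sets[OF P1D(2)[OF N \<nu>] refl])
    show "AE x in \<nu>. norm (\<phi> x) \<le> norm (a' + b' * (N x + N x0))"
    proof (rule AE_I2)
      fix x assume "x \<in> space \<nu>"
      then have "\<bar>\<phi> x\<bar> \<le> a' + b' * N (x - x0)" using ab(3) P1D(3)[OF N \<nu>] by simp
      also have "N (x - x0) \<le> N x + N x0"
        using is_norm_ineqs(2)[OF N, of x "- x0"] is_norm_ineqs(4)[OF N, of x0] by simp
      finally have "\<bar>\<phi> x\<bar> \<le> a' + b' * (N x + N x0)" using ab(2) by (simp add: mult_left_mono)
      then show "norm (\<phi> x) \<le> norm (a' + b' * (N x + N x0))" by simp
    qed
  qed
qed

text \<open>The base point of the growth bound must lie in \<open>X\<close>; moving it there costs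
  only a larger constant.\<close>

lemma Phi1b_subset:
  assumes N: "is_norm N" and \<phi>: "\<phi> \<in> Phi1b N UNIV" and X: "X \<noteq> {}"
  shows "\<phi> \<in> Phi1b N X"
proof -
  obtain a' b' x0 where ab: "0 \<le> a'" "0 \<le> b'" "\<And>x. \<bar>\<phi> x\<bar> \<le> a' + b' * N (x - x0)"
    using \<phi> unfolding Phi1b_def by blast
  obtain x1 where x1: "x1 \<in> X" using X by blast
  have "\<bar>\<phi> x\<bar> \<le> (a' + b' * N (x1 - x0)) + b' * N (x - x1)" for x
  proof -
    have "b' * N (x - x0) \<le> b' * (N (x - x1) + N (x1 - x0))"
      by (intro mult_left_mono is_norm_ineqs(3)[OF N] ab)
    then show ?thesis using ab(3)[of x] by (simp add: distrib_left)
  qed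
  moreover have "0 \<le> a' + b' * N (x1 - x0)" using ab is_norm_ineqs(1)[OF N] by simp
  moreover have "continuous_on X \<phi>" "bdd_below (\<phi> ` X)"
    using \<phi> unfolding Phi1b_def by (auto intro: continuous_on_subset bdd_below_mono)
  ultimately show ?thesis using ab(2) x1 unfolding Phi1b_def by blast
qed

text \<open>For almost every x the conditional law \<open>p x\<close> has a first moment and
  therefore competes in the infimum defining \<open>Qbar\<close> at x. Integration over \<mu> turns
  its potential term into the integral over \<nu>, which cancels.\<close>

lemma weak_duality:
  assumes N: "is_norm N" and \<theta>: "\<theta> \<in> borel_measurable borel"
    and \<mu>: "\<mu> \<in> P1 N X" and \<nu>: "\<nu> \<in> P1 N X" and \<phi>: "\<phi> \<in> Phi1b N X"
  shows "ereal_integral \<mu> (Qbar N X \<theta> \<phi>) - ereal (\<integral>y. \<phi> y \<partial>\<nu>) \<le> enn2ereal (bary_cost \<theta> \<nu> \<mu>)"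
proof -
  define K where "K = ereal_integral \<mu> (Qbar N X \<theta> \<phi>) - ereal (\<integral>y. \<phi> y \<partial>\<nu>)"
  have "K \<le> enn2ereal (\<integral>\<^sup>+x. \<theta> (x - (\<integral>y. y \<partial>p x)) \<partial>\<mu>)"
    if \<pi>: "\<pi> \<in> couplings \<mu> \<nu>" and p: "p \<in> disintegrations \<mu> \<nu> \<pi>" for \<pi> p
  proof (cases "(\<integral>\<^sup>+x. \<theta> (x - (\<integral>y. y \<partial>p x)) \<partial>\<mu>) = \<infinity>")
    case False
    have mk: "mixture_kernel \<mu> \<nu> p"
      by (rule mixture_kernel_of_disintegration[OF P1D(1)[OF N \<mu>] \<pi> p])
    define b where "b x = (\<integral>y. y \<partial>p x)" for x
    have b: "integrable \<mu> b"
      unfolding b_def by (rule mixture_kernel_integrable(2)[OF mk P1D(5)[OF N \<nu>]])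
    have "(\<lambda>x. x - b x) \<in> borel_measurable \<mu>"
      using Bochner_Integration.integrable_diff[OF P1D(5)[OF N \<mu>] b] by (rule borel_measurable_integrable)
    then have \<theta>b: "(\<lambda>x. \<theta> (x - b x)) \<in> borel_measurable \<mu>" using \<theta> by (rule measurable_compose)
    define t where "t x = enn2real (\<theta> (x - b x))" for x
    have "AE x in \<mu>. \<theta> (x - b x) \<noteq> \<infinity>"
      using False by (intro nn_integral_noteq_infinite \<theta>b) (simp add: b_def)
    then have fin: "AE x in \<mu>. \<theta> (x - b x) = ennreal (t x)"
      by eventually_elim (simp add: t_def ennreal_enn2real_if)
    have I: "(\<integral>\<^sup>+x. \<theta> (x - b x) \<partial>\<mu>) = (\<integral>\<^sup>+x. ennreal (t x) \<partial>\<mu>)"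
      by (rule nn_integral_cong_AE[OF fin])
    have "t \<in> borel_measurable \<mu>" unfolding t_def using \<theta>b by measurable
    then have t: "integrable \<mu> t"
      using False I by (intro integrableI_nonneg) (auto simp: b_def t_def less_top)
    have I': "(\<integral>\<^sup>+x. \<theta> (x - b x) \<partial>\<mu>) = ennreal (\<integral>x. t x \<partial>\<mu>)"
      unfolding I by (rule nn_integral_eq_integral[OF t]) (simp add: t_def)
    have \<phi>\<nu>: "integrable \<nu> \<phi>" by (rule Phi1b_integrable[OF N \<phi> \<nu>])
    define f where "f x = (\<integral>y. \<phi> y \<partial>p x)" for x
    have f: "integrable \<mu> f" "(\<integral>x. f x \<partial>\<mu>) = (\<integral>y. \<phi> y \<partial>\<nu>)"
      unfolding f_def by (rule mixture_kernel_integrable(2)[OF mk \<phi>\<nu>], rule mixture_kernel_integral[OF mk \<phi>\<nu>])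
    have "AE x in \<mu>. Qbar N X \<theta> \<phi> x \<le> ereal (f x + t x)"
      using fin mixture_kernel_integrable(1)[OF mk P1D(4)[OF N \<nu>]] AE_space
    proof eventually_elim
      case (elim x)
      have "p x \<in> P1 N X"
        using elim(2) mixture_kernel_space[OF mk elim(3)] P1D(2)[OF N \<nu>] by (simp add: P1_def)
      then have "Qbar N X \<theta> \<phi> x \<le> ereal (\<integral>y. \<phi> y \<partial>p x) + enn2ereal (\<theta> (x - b x))"
        unfolding Qbar_def b_def by (rule INF_lower)
      moreover have "0 \<le> t x" by (simp add: t_def)
      ultimately show ?case using elim(1) by (simp add: f_def enn2ereal_ennreal)
    qed
    then have "ereal_integral \<mu> (Qbar N X \<theta> \<phi>) \<le> ereal_integral \<mu> (\<lambda>x. ereal (f x + t x))"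
      by (rule ereal_integral_mono_AE)
    also have "\<dots> = ereal (\<integral>x. f x + t x \<partial>\<mu>)"
      by (rule ereal_integral_real[OF Bochner_Integration.integrable_add[OF f(1) t]])
    also have "(\<integral>x. f x + t x \<partial>\<mu>) = (\<integral>y. \<phi> y \<partial>\<nu>) + (\<integral>x. t x \<partial>\<mu>)"
      using t f by simp
    finally have "K \<le> ereal ((\<integral>y. \<phi> y \<partial>\<nu>) + (\<integral>x. t x \<partial>\<mu>)) - ereal (\<integral>y. \<phi> y \<partial>\<nu>)"
      unfolding K_def by (intro ereal_minus_mono) simp_all
    also have "\<dots> = enn2ereal (\<integral>\<^sup>+x. \<theta> (x - b x) \<partial>\<mu>)"
    proof -
      have "0 \<le> (\<integral>x. t x \<partial>\<mu>)" by (intro integral_nonneg_AE) (simp add: t_def)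
      then show ?thesis unfolding I' by (simp add: enn2ereal_ennreal)
    qed
    finally show ?thesis by (simp add: b_def)
  qed simp
  \<comment> \<open>The infimum defining the cost is taken in \<open>ennreal\<close>; truncating
    \<open>K\<close> at 0 loses nothing against a nonnegative cost.\<close>
  then have "e2ennreal K \<le> (\<integral>\<^sup>+x. \<theta> (x - (\<integral>y. y \<partial>p x)) \<partial>\<mu>)"
    if "\<pi> \<in> couplings \<mu> \<nu>" "p \<in> disintegrations \<mu> \<nu> \<pi>" for \<pi> p
    using e2ennreal_mono[of K "enn2ereal (\<integral>\<^sup>+x. \<theta> (x - (\<integral>y. y \<partial>p x)) \<partial>\<mu>)"] that
    by (simp add: e2ennreal_enn2ereal)
  then have "e2ennreal K \<le> bary_cost \<theta> \<nu> \<mu>"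
    unfolding bary_cost_def by (intro INF_greatest)
  then have "enn2ereal (e2ennreal K) \<le> enn2ereal (bary_cost \<theta> \<nu> \<mu>)"
    by (simp add: less_eq_ennreal.rep_eq)
  moreover have "K \<le> enn2ereal (e2ennreal K)"
    by (cases "0 \<le> K") (auto simp: enn2ereal_e2ennreal intro: order_trans[of _ 0])
  ultimately show ?thesis unfolding K_def by (rule order_trans[rotated])
qed

text \<open>A measure on \<open>X\<close>, viewed on the whole space, has the same integrals and
  competes in the other infimum.\<close>

lemma Qbar_UNIV_le:
  assumes N: "is_norm N" and \<phi>: "continuous_on UNIV \<phi>"
  shows "Qbar N UNIV \<theta> \<phi> x \<le> Qbar N X \<theta> \<phi> x"
  unfolding Qbar_def
proof (rule INF_mono)
  fix p assume p: "p \<in> P1 N X"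
  interpret prob_space p by (rule P1D(1)[OF N p])
  have N_meas: "N \<in> borel_measurable borel"
    using is_norm_equivalent[OF N] borel_measurable_continuous_onI by metis
  define q where "q = distr p borel (\<lambda>x. x)"
  have id: "(\<lambda>x. x) \<in> borel_measurable p" using P1D(5)[OF N p] by auto
  have "q \<in> P1 N UNIV"
    using prob_space_distr[OF id] P1D(4)[OF N p] integrable_distr_eq[OF id N_meas]
    by (simp add: P1_def q_def sets_restrict_space)
  moreover have "(\<integral>y. \<phi> y \<partial>q) = (\<integral>y. \<phi> y \<partial>p)"
    unfolding q_def using \<phi> by (intro integral_distr[OF id] borel_measurable_continuous_onI)
  moreover have "(\<integral>y. y \<partial>q) = (\<integral>y. y \<partial>p)"
    unfolding q_def by (rule integral_distr[OF id]) simp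
  ultimately show "\<exists>q\<in>P1 N UNIV. ereal (\<integral>y. \<phi> y \<partial>q) + enn2ereal (\<theta> (x - (\<integral>y. y \<partial>q)))
    \<le> ereal (\<integral>y. \<phi> y \<partial>p) + enn2ereal (\<theta> (x - (\<integral>y. y \<partial>p)))"
    by (metis order_refl)
qed

text \<open>If the inequality failed, some affine function below the envelope, hence below
  \<open>\<phi>\<close>, would exceed the integral of \<open>\<phi>\<close> at the barycenter, where
  its value is its own integral. The envelope is first shifted by a lower bound of
  \<open>\<phi>\<close>, as \<open>ex_affine_minorant_above\<close> concerns nonnegative
  functions.\<close>

lemma convex_envelope_Jensen:
  fixes \<phi> :: "'a::euclidean_space \<Rightarrow> real"
  assumes p: "prob_space p" and id: "integrable p (\<lambda>y. y)" and \<phi>: "integrable p \<phi>"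
    and bdd: "bdd_below (range \<phi>)"
  shows "convex_envelope \<phi> (\<integral>y. y \<partial>p) \<le> (\<integral>y. \<phi> y \<partial>p)"
proof (rule ccontr)
  interpret prob_space p by fact
  note env = convex_envelope_greatest[OF bdd]
  define z where "z = (\<integral>y. y \<partial>p)"
  obtain c where c: "\<And>x. c \<le> \<phi> x" using bdd by (auto simp: bdd_below_def)
  have const: "convex_on UNIV (\<lambda>_::'a. a)" for a :: real
    by (simp add: convex_on_def flip: distrib_right)
  then have env_c: "c \<le> convex_envelope \<phi> x" for x
    using env(3)[OF const, of c] c by (auto simp: le_fun_def)
  define f where "f x = convex_envelope \<phi> x + (- c)" for x
  have f0: "0 \<le> f x" for x using env_c[of x] by (simp add: f_def)
  have "convex_on UNIV f"
    unfolding f_def by (intro convex_on_add env(1) const)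
  note f = lsc_convex_ennreal_of_real[OF f0 this]
  assume "\<not> convex_envelope \<phi> (\<integral>y. y \<partial>p) \<le> (\<integral>y. \<phi> y \<partial>p)"
  then have "(\<integral>y. \<phi> y \<partial>p) - c < f z" by (simp add: f_def z_def)
  moreover have "0 \<le> (\<integral>y. \<phi> y \<partial>p) - c"
    using integral_mono[of p "\<lambda>_. c" \<phi>] \<phi> c prob_space by simp
  ultimately obtain l where l: "affine_minorant (\<lambda>x. ennreal (f x)) l"
    "(\<integral>y. \<phi> y \<partial>p) - c < fst l \<bullet> z - snd l"
    using ex_affine_minorant_above[OF f, of "(\<integral>y. \<phi> y \<partial>p) - c" z] by (auto simp: ennreal_lessI)
  have "fst l \<bullet> y - snd l \<le> \<phi> y - c" for y
  proof -
    have "ennreal (fst l \<bullet> y - snd l) \<le> ennreal (f y)" using l(1) by (simp add: affine_minorant_def)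
    then have "fst l \<bullet> y - snd l \<le> f y" using f0[of y] by (simp add: ennreal_le_iff)
    also have "f y \<le> \<phi> y - c" using env(2) by (simp add: f_def le_fun_def)
    finally show ?thesis .
  qed
  then have "(\<integral>y. fst l \<bullet> y - snd l \<partial>p) \<le> (\<integral>y. \<phi> y - c \<partial>p)"
    using id \<phi> by (intro integral_mono) auto
  then have "fst l \<bullet> z - snd l \<le> (\<integral>y. \<phi> y \<partial>p) - c"
    using id \<phi> prob_space by (simp add: z_def)
  with l(2) show False by simp
qed

text \<open>The infimum of the expectation over finitely supported laws with barycenter z is below
  \<open>\<phi>\<close> (point masses) and convex in z (mixtures of laws), hence below the
  envelope.\<close>

lemma convex_envelope_ge_finite_mixture:
  fixes \<phi> :: "'a::euclidean_space \<Rightarrow> real"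
  assumes bdd: "bdd_below (range \<phi>)" and e: "0 < e"
  obtains P where "finite (set_pmf P)" "measure_pmf.expectation P (\<lambda>y. y) = z"
    "measure_pmf.expectation P \<phi> < convex_envelope \<phi> z + e"
proof -
  define K where "K z = {measure_pmf.expectation P \<phi> | P. finite (set_pmf P)
    \<and> measure_pmf.expectation P (\<lambda>y. y) = z}" for z
  define k where "k z = Inf (K z)" for z
  obtain c where c: "\<And>x. c \<le> \<phi> x" using bdd by (auto simp: bdd_below_def)
  have self: "\<phi> z \<in> K z" for z
    unfolding K_def by (auto intro!: exI[of _ "return_pmf z"])
  have bddK: "bdd_below (K z)" for z
  proof (rule bdd_belowI)
    fix r assume "r \<in> K z"
    then obtain P where P: "finite (set_pmf P)" "r = measure_pmf.expectation P \<phi>" by (auto simp: K_def)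
    have "measure_pmf.expectation P (\<lambda>_. c) \<le> measure_pmf.expectation P \<phi>"
      using P c by (intro integral_mono integrable_measure_pmf_finite) auto
    then show "c \<le> r" using P by simp
  qed
  have k_less: "\<exists>r\<in>K z. r < a" if "k z < a" for z a
    using that cInf_lessD[of "K z" a] self[of z] unfolding k_def by blast
  have "k z \<le> \<phi> z" for z unfolding k_def by (rule cInf_lower[OF self bddK])
  moreover have "convex_on UNIV k"
  proof (unfold convex_on_def, intro conjI ballI allI impI)
    fix x y :: 'a and u v :: real
    assume uv: "0 \<le> u" "0 \<le> v" "u + v = 1"
    show "k (u *\<^sub>R x + v *\<^sub>R y) \<le> u * k x + v * k y"
    proof (rule field_le_epsilon)
      fix e :: real assume e: "0 < e"
      obtain P where P: "finite (set_pmf P)" "measure_pmf.expectation P (\<lambda>y. y) = x"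
        "measure_pmf.expectation P \<phi> < k x + e"
        using k_less[of x "k x + e"] e by (auto simp: K_def)
      obtain Q where Q: "finite (set_pmf Q)" "measure_pmf.expectation Q (\<lambda>y. y) = y"
        "measure_pmf.expectation Q \<phi> < k y + e"
        using k_less[of y "k y + e"] e by (auto simp: K_def)
      \<comment> \<open>A coin of bias u decides between the two nearly optimal laws; barycenters
        and expectations mix in the same way.\<close>
      define R where "R = bernoulli_pmf u \<bind> (\<lambda>b. if b then P else Q)"
      have v: "v = 1 - u" "u \<le> 1" using uv by auto
      have R: "measure_pmf.expectation R h = u *\<^sub>R measure_pmf.expectation P h + v *\<^sub>R measure_pmf.expectation Q h"
        for h :: "'a \<Rightarrow> 'c::{banach, second_countable_topology}"
        unfolding R_def using P Q uv v
        by (subst pmf_expectation_bind[of UNIV]) (auto simp: UNIV_bool)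
      have "finite (set_pmf R)" unfolding R_def using P Q by auto
      moreover have "measure_pmf.expectation R (\<lambda>y. y) = u *\<^sub>R x + v *\<^sub>R y" by (simp add: R P Q)
      ultimately have "measure_pmf.expectation R \<phi> \<in> K (u *\<^sub>R x + v *\<^sub>R y)"
        unfolding K_def by blast
      then have "k (u *\<^sub>R x + v *\<^sub>R y) \<le> measure_pmf.expectation R \<phi>"
        unfolding k_def using bddK by (rule cInf_lower)
      also have "\<dots> = u * measure_pmf.expectation P \<phi> + v * measure_pmf.expectation Q \<phi>" by (simp add: R)
      also have "\<dots> \<le> u * (k x + e) + v * (k y + e)"
        using uv P(3) Q(3) by (intro add_mono mult_left_mono) auto
      also have "\<dots> = u * k x + v * k y + (u + v) * e" by (simp add: algebra_simps)
      finally show "k (u *\<^sub>R x + v *\<^sub>R y) \<le> u * k x + v * k y + e" using uv by simp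
    qed
  qed simp
  ultimately have "k z \<le> convex_envelope \<phi> z"
    using convex_envelope_greatest(3)[OF bdd, of k] by (auto simp: le_fun_def)
  then obtain r where "r \<in> K z" "r < convex_envelope \<phi> z + e"
    using k_less[of z "convex_envelope \<phi> z + e"] e by auto
  then show ?thesis using that by (auto simp: K_def)
qed

text \<open>A law may be replaced by its barycenter, by Jensen for the envelope, and a point by
  nearly optimal finite laws with that barycenter; both moves leave the cost term unchanged.\<close>

lemma Qbar_UNIV_eq_Qinf_envelope:
  assumes N: "is_norm N" and \<phi>: "\<phi> \<in> Phi1b N UNIV"
  shows "Qbar N UNIV \<theta> \<phi> x = Qinf \<theta> (convex_envelope \<phi>) x"
proof (rule antisym)
  have bdd: "bdd_below (range \<phi>)" and cont: "continuous_on UNIV \<phi>"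
    using \<phi> by (auto simp: Phi1b_def)
  have N_meas: "N \<in> borel_measurable borel"
    using is_norm_equivalent[OF N] borel_measurable_continuous_onI by metis
  show "Qinf \<theta> (convex_envelope \<phi>) x \<le> Qbar N UNIV \<theta> \<phi> x"
    unfolding Qbar_def Qinf_def
  proof (rule INF_mono)
    fix p assume p: "p \<in> P1 N UNIV"
    have "convex_envelope \<phi> (\<integral>y. y \<partial>p) \<le> (\<integral>y. \<phi> y \<partial>p)"
      by (rule convex_envelope_Jensen[OF P1D(1,5)[OF N p] Phi1b_integrable[OF N \<phi> p] bdd])
    then show "\<exists>y\<in>UNIV. ereal (convex_envelope \<phi> y) + enn2ereal (\<theta> (x - y))
      \<le> ereal (\<integral>y. \<phi> y \<partial>p) + enn2ereal (\<theta> (x - (\<integral>y. y \<partial>p)))"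
      by (intro bexI[of _ "\<integral>y. y \<partial>p"] add_right_mono) auto
  qed
  show "Qbar N UNIV \<theta> \<phi> x \<le> Qinf \<theta> (convex_envelope \<phi>) x"
    unfolding Qinf_def
  proof (rule INF_greatest)
    fix z
    have le: "Qbar N UNIV \<theta> \<phi> x \<le> ereal (measure_pmf.expectation P \<phi>) + enn2ereal (\<theta> (x - z))"
      if P: "finite (set_pmf P)" "measure_pmf.expectation P (\<lambda>y. y) = z" for P
    proof -
      define q where "q = distr (measure_pmf P) borel (\<lambda>x. x)"
      have id: "(\<lambda>x. x) \<in> borel_measurable (measure_pmf P)" by simp
      have "q \<in> P1 N UNIV"
        using measure_pmf.prob_space_distr[OF id] integrable_measure_pmf_finite[OF P(1), of N]
          integrable_distr_eq[OF id N_meas]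
        by (simp add: P1_def q_def sets_restrict_space)
      then have "Qbar N UNIV \<theta> \<phi> x \<le> ereal (\<integral>y. \<phi> y \<partial>q) + enn2ereal (\<theta> (x - (\<integral>y. y \<partial>q)))"
        unfolding Qbar_def by (rule INF_lower)
      moreover have "(\<integral>y. \<phi> y \<partial>q) = measure_pmf.expectation P \<phi>"
        unfolding q_def using cont by (intro integral_distr[OF id] borel_measurable_continuous_onI)
      moreover have "(\<integral>y. y \<partial>q) = z"
        unfolding q_def P(2)[symmetric] by (rule integral_distr[OF id]) simp
      ultimately show ?thesis by simp
    qed
    show "Qbar N UNIV \<theta> \<phi> x \<le> ereal (convex_envelope \<phi> z) + enn2ereal (\<theta> (x - z))"
    proof (rule ereal_le_epsilon2)
      fix e :: real assume "0 < e"
      then obtain P where P: "finite (set_pmf P)" "measure_pmf.expectation P (\<lambda>y. y) = z"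
        "measure_pmf.expectation P \<phi> < convex_envelope \<phi> z + e"
        using convex_envelope_ge_finite_mixture[OF bdd] by metis
      have "Qbar N UNIV \<theta> \<phi> x \<le> ereal (measure_pmf.expectation P \<phi>) + enn2ereal (\<theta> (x - z))"
        by (rule le[OF P(1,2)])
      also have "\<dots> \<le> ereal (convex_envelope \<phi> z + e) + enn2ereal (\<theta> (x - z))"
        using P(3) by (intro add_right_mono) simp
      also have "\<dots> = ereal (convex_envelope \<phi> z) + enn2ereal (\<theta> (x - z)) + ereal e"
        by (simp add: add_ac flip: plus_ereal.simps(1))
      finally show "Qbar N UNIV \<theta> \<phi> x \<le> ereal (convex_envelope \<phi> z) + enn2ereal (\<theta> (x - z)) + ereal e" .
    qed
  qed
qed

lemma convex_envelope_of_convex: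
  assumes "convex_on UNIV \<phi>" "bdd_below (range \<phi>)"
  shows "convex_envelope \<phi> = \<phi>"
  using convex_envelope_greatest[OF assms(2)] assms(1) by (intro antisym) auto

section \<open>Convex Lipschitz potentials and the reverse inequality\<close>

definition dual_convex :: "('a::real_vector \<Rightarrow> real) \<Rightarrow> ('a \<Rightarrow> real) set" where
  "dual_convex N = {\<phi>. convex_on UNIV \<phi>
     \<and> (\<exists>L\<ge>0. \<forall>x y. \<bar>\<phi> x - \<phi> y\<bar> \<le> L * N (x - y)) \<and> bdd_below (range \<phi>)}"

lemma dual_convex_subset_Phi1b:
  assumes N: "is_norm N" and \<phi>: "\<phi> \<in> dual_convex N"
  shows "\<phi> \<in> Phi1b N UNIV"
proof -
  obtain L where L: "0 \<le> L" "\<And>x y. \<bar>\<phi> x - \<phi> y\<bar> \<le> L * N (x - y)"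
    and conv: "convex_on UNIV \<phi>" and bdd: "bdd_below (range \<phi>)"
    using \<phi> by (auto simp: dual_convex_def)
  have "\<bar>\<phi> x\<bar> \<le> \<bar>\<phi> 0\<bar> + L * N (x - 0)" for x using L(2)[of x 0] by simp
  then show ?thesis
    using L(1) bdd convex_on_continuous[OF open_UNIV conv] unfolding Phi1b_def
    by (intro CollectI conjI exI[of _ "\<bar>\<phi> 0\<bar>"] exI[of _ L] bexI[of _ 0]) auto
qed

text \<open>The zero potential rules out negative dual values: the supremum is never minus infinity,
  and a finite one survives truncation by \<open>ennreal\<close>.\<close>

lemma ereal_integral_Qinf_zero_nonneg: "0 \<le> ereal_integral \<mu> (Qinf \<theta> (\<lambda>_. 0))"
proof -
  have "ereal_integral \<mu> (\<lambda>x. ereal 0) \<le> ereal_integral \<mu> (Qinf \<theta> (\<lambda>_. 0))"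
    by (intro ereal_integral_mono_AE AE_I2)
      (auto simp: Qinf_def zero_ereal_def[symmetric] intro!: INF_greatest)
  then show ?thesis using ereal_integral_real[of \<mu> "\<lambda>_. 0"] by (simp add: zero_ereal_def)
qed

lemma strong_duality:
  fixes X :: "(real^'m) set"
  assumes N: "is_norm N" and X: "closed X" and lsc: "lsc \<theta>" and conv: "convex_ennreal \<theta>"
    and \<mu>: "\<mu> \<in> P1 N X" and \<nu>: "\<nu> \<in> P1 N X"
  shows "enn2ereal (bary_cost \<theta> \<nu> \<mu>)
    \<le> (SUP \<phi>\<in>dual_convex N. ereal_integral \<mu> (Qinf \<theta> \<phi>) - ereal (\<integral>y. \<phi> y \<partial>\<nu>))" (is "_ \<le> ?S")
proof -
  have zero: "(\<lambda>_. 0) \<in> dual_convex N"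
    using is_norm_ineqs(1)[OF N] by (auto simp: dual_convex_def convex_on_def intro!: exI[of _ 0])
  show ?thesis
  proof (cases ?S)
    case PInf
    then show ?thesis by simp
  next
    case (real d)
    have S: "ereal_integral \<mu> (Qinf \<theta> \<phi>) - ereal (\<integral>y. \<phi> y \<partial>\<nu>) \<le> ereal d" if "\<phi> \<in> dual_convex N" for \<phi>
      unfolding real[symmetric] using that by (rule SUP_upper)
    obtain c C where c: "0 < c" "0 < C" "\<And>x. c * norm x \<le> N x" "\<And>x. N x \<le> C * norm x"
      "continuous_on UNIV N" by (rule is_norm_equivalent[OF N]) blast
    have "bary_cost \<theta> \<nu> \<mu> \<le> ennreal d"
    proof (rule bary_cost_le_dual[OF borel_closed[OF X] lsc conv P1D(1,5)[OF N \<mu>] P1D(1,2,5)[OF N \<nu>] S])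
      fix \<phi> :: "real^'m \<Rightarrow> real" and L
      assume \<phi>: "convex_on UNIV \<phi>" "L-lipschitz_on UNIV \<phi>" "bdd_below (range \<phi>)"
      have L: "0 \<le> L" by (rule lipschitz_on_nonneg[OF \<phi>(2)])
      \<comment> \<open>The potentials coming from hedges are Lipschitz for the Euclidean norm; the
        equivalence of norms converts the constant to one for \<open>N\<close>.\<close>
      have "\<bar>\<phi> x - \<phi> y\<bar> \<le> L / c * N (x - y)" for x y
      proof -
        have "\<bar>\<phi> x - \<phi> y\<bar> \<le> L * norm (x - y)"
          using lipschitz_onD[OF \<phi>(2), of x y] by (simp add: dist_norm)
        also have "\<dots> \<le> L * (N (x - y) / c)"
          using c(1) c(3)[of "x - y"] by (intro mult_left_mono L) (simp add: field_simps)
        finally show ?thesis by simp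
      qed
      moreover have "0 \<le> L / c" using L c by simp
      ultimately show "\<phi> \<in> dual_convex N" using \<phi> unfolding dual_convex_def by blast
    qed
    moreover have "0 \<le> d"
    proof -
      have "0 \<le> ereal d"
        by (rule order_trans[OF ereal_integral_Qinf_zero_nonneg[of \<mu> \<theta>]]) (use S[OF zero] in simp)
      then show ?thesis by simp
    qed
    ultimately have "enn2ereal (bary_cost \<theta> \<nu> \<mu>) \<le> enn2ereal (ennreal d)"
      by (simp add: less_eq_ennreal.rep_eq)
    also have "\<dots> = ereal d" using \<open>0 \<le> d\<close> by (rule enn2ereal_ennreal)
    finally show ?thesis by (simp add: real)
  next
    case MInf
    have "ereal_integral \<mu> (Qinf \<theta> (\<lambda>_. 0)) - ereal (\<integral>y. 0 \<partial>\<nu>) \<le> ?S" using zero by (rule SUP_upper)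
    then show ?thesis using MInf ereal_integral_Qinf_zero_nonneg[of \<mu> \<theta>] by simp
  qed
qed

theorem theorem2p11:
  fixes X :: "(real^'m) set"
    and N :: "real^'m \<Rightarrow> real"
    and \<theta> :: "real^'m \<Rightarrow> ennreal"
  assumes norm: "is_norm N"
    and closed: "closed X"
    and theta:
      "(\<exists>\<theta>'::real^'m \<Rightarrow> real. (\<forall>x. 0 \<le> \<theta>' x) \<and> \<theta> = (\<lambda>x. ennreal (\<theta>' x)) \<and> convex_on UNIV \<theta>'
          \<and> (\<exists>a>0. \<exists>b. \<forall>x. \<theta>' x \<ge> a * N x + b))
       \<or> (lsc \<theta> \<and> convex_ennreal \<theta> \<and> (compact X \<or> (countable X \<and> (\<forall>x\<in>X. x isolated_in X))))"
  shows
    "(\<forall>\<mu>\<in>P1 N X. \<forall>\<nu>\<in>P1 N X.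
        enn2ereal (bary_cost \<theta> \<nu> \<mu>) =
          (SUP \<phi>\<in>Phi1b N X. ereal_integral \<mu> (Qbar N X \<theta> \<phi>) - ereal (\<integral> y. \<phi> y \<partial>\<nu>)))
     \<and> (\<forall>\<mu>\<in>P1 N X. \<forall>\<nu>\<in>P1 N X.
        enn2ereal (bary_cost \<theta> \<nu> \<mu>) =
          (SUP \<phi>\<in>Phi1b N UNIV. ereal_integral \<mu> (Qbar N UNIV \<theta> \<phi>) - ereal (\<integral> y. \<phi> y \<partial>\<nu>)))
     \<and> (\<forall>\<phi>\<in>Phi1b N UNIV. \<forall>x. Qbar N UNIV \<theta> \<phi> x = Qinf \<theta> (convex_envelope \<phi>) x)
     \<and> (\<forall>\<mu>\<in>P1 N X. \<forall>\<nu>\<in>P1 N X.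
        enn2ereal (bary_cost \<theta> \<nu> \<mu>) =
          (SUP \<phi>\<in>{\<phi>::real^'m \<Rightarrow> real. convex_on UNIV \<phi>
                     \<and> (\<exists>L\<ge>0. \<forall>x y. \<bar>\<phi> x - \<phi> y\<bar> \<le> L * N (x - y)) \<and> bdd_below (range \<phi>)}.
             ereal_integral \<mu> (Qinf \<theta> \<phi>) - ereal (\<integral> y. \<phi> y \<partial>\<nu>)))"
proof -
  have lsc: "lsc \<theta>" and conv: "convex_ennreal \<theta>"
    using theta lsc_convex_ennreal_of_real by auto
  note env = Qbar_UNIV_eq_Qinf_envelope[OF norm]
  have all: "enn2ereal (bary_cost \<theta> \<nu> \<mu>) =
        (SUP \<phi>\<in>Phi1b N X. ereal_integral \<mu> (Qbar N X \<theta> \<phi>) - ereal (\<integral> y. \<phi> y \<partial>\<nu>))"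
      "enn2ereal (bary_cost \<theta> \<nu> \<mu>) =
        (SUP \<phi>\<in>Phi1b N UNIV. ereal_integral \<mu> (Qbar N UNIV \<theta> \<phi>) - ereal (\<integral> y. \<phi> y \<partial>\<nu>))"
      "enn2ereal (bary_cost \<theta> \<nu> \<mu>) =
        (SUP \<phi>\<in>dual_convex N. ereal_integral \<mu> (Qinf \<theta> \<phi>) - ereal (\<integral> y. \<phi> y \<partial>\<nu>))"
    if \<mu>: "\<mu> \<in> P1 N X" and \<nu>: "\<nu> \<in> P1 N X" for \<mu> \<nu>
  proof -
    define T where "T = enn2ereal (bary_cost \<theta> \<nu> \<mu>)"
    define S1 where "S1 = (SUP \<phi>\<in>Phi1b N X. ereal_integral \<mu> (Qbar N X \<theta> \<phi>) - ereal (\<integral> y. \<phi> y \<partial>\<nu>))"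
    define S2 where "S2 = (SUP \<phi>\<in>Phi1b N UNIV. ereal_integral \<mu> (Qbar N UNIV \<theta> \<phi>) - ereal (\<integral> y. \<phi> y \<partial>\<nu>))"
    define S3 where "S3 = (SUP \<phi>\<in>dual_convex N. ereal_integral \<mu> (Qinf \<theta> \<phi>) - ereal (\<integral> y. \<phi> y \<partial>\<nu>))"
    have "X \<noteq> {}" using prob_space.not_empty[OF P1D(1)[OF norm \<mu>]] P1D(3)[OF norm \<mu>] by simp
    \<comment> \<open>The cycle \<open>T \<le> S3 \<le> S2 \<le> S1 \<le> T\<close> yields all
      equalities. A convex potential is its own envelope, which gives \<open>S3 \<le> S2\<close>;
      passing from the whole space to \<open>X\<close> leaves fewer laws in the infimum, which gives
      \<open>S2 \<le> S1\<close>.\<close>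
    have "T \<le> S3" unfolding T_def S3_def by (rule strong_duality[OF norm closed lsc conv \<mu> \<nu>])
    moreover have "S3 \<le> S2"
      unfolding S3_def S2_def
    proof (rule SUP_mono)
      fix \<phi> assume \<phi>: "\<phi> \<in> dual_convex N"
      then have "convex_envelope \<phi> = \<phi>" by (auto simp: dual_convex_def intro: convex_envelope_of_convex)
      then have "Qbar N UNIV \<theta> \<phi> = Qinf \<theta> \<phi>"
        using env[OF dual_convex_subset_Phi1b[OF norm \<phi>], of \<theta>] by (intro ext) simp
      then show "\<exists>\<psi>\<in>Phi1b N UNIV. ereal_integral \<mu> (Qinf \<theta> \<phi>) - ereal (\<integral> y. \<phi> y \<partial>\<nu>)
        \<le> ereal_integral \<mu> (Qbar N UNIV \<theta> \<psi>) - ereal (\<integral> y. \<psi> y \<partial>\<nu>)"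
        using dual_convex_subset_Phi1b[OF norm \<phi>] by (metis order_refl)
    qed
    moreover have "S2 \<le> S1"
      unfolding S2_def S1_def
    proof (rule SUP_mono)
      fix \<phi> assume \<phi>: "\<phi> \<in> Phi1b N UNIV"
      have "ereal_integral \<mu> (Qbar N UNIV \<theta> \<phi>) \<le> ereal_integral \<mu> (Qbar N X \<theta> \<phi>)"
        using \<phi> by (intro ereal_integral_mono_AE AE_I2 Qbar_UNIV_le[OF norm]) (simp add: Phi1b_def)
      then show "\<exists>\<psi>\<in>Phi1b N X. ereal_integral \<mu> (Qbar N UNIV \<theta> \<phi>) - ereal (\<integral> y. \<phi> y \<partial>\<nu>)
        \<le> ereal_integral \<mu> (Qbar N X \<theta> \<psi>) - ereal (\<integral> y. \<psi> y \<partial>\<nu>)"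
        using Phi1b_subset[OF norm \<phi> \<open>X \<noteq> {}\<close>] by (intro bexI[of _ \<phi>] ereal_minus_mono) auto
    qed
    moreover have "S1 \<le> T"
      unfolding S1_def T_def
      by (intro SUP_least weak_duality[OF norm lsc_borel_measurable[OF lsc] \<mu> \<nu>])
    ultimately have "T = S1" "T = S2" "T = S3" by auto
    then show "T = S1" "T = S2" "T = S3" by auto
  qed
  show ?thesis
    using all env unfolding dual_convex_def by blast
qed

end
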